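(* Let $(u^0,u^1)\in H^1_{\Gamma_0}(\Omega)\times L^2(\Omega)$ and $h\in C^1([0,\infty);L^2(\Gamma_1))$, and let $a$ satisfy $a_{\max}\ge a(x)\ge a_{\min}>0$ on $\Omega$ for two positive constants $a_{\min},a_{\max}$. Let $c_p$ be the Poincaré constant, satisfying $\|\phi\|_{L^2(\Omega)}^2\le c_p\|\nabla \phi\|_{L^2(\Omega)}^2$ for $\phi\in H^1_{\Gamma_0}(\Omega)$, and put $$\epsilon_0=\min\left\{\frac{a_{\min}}{4},\frac{a_{\min}}{2a_{\max}^2c_p}\right\}.$$ Let $\alpha\in(0,\frac{\epsilon_0}{2})$, $\delta\in(0,\frac{1}{2c_p})$, $\delta_1:=\dfrac{4\delta\alpha c_p}{1-2\delta c_p}$, and $$H(t)=\|u^0\|_{H^1_{\Gamma_0}(\Omega)}^2+\|u^1\|_{L^2(\Omega)}^2+\int_0^t e^{2\alpha s}\Big(\|h(s)\|_{L^2(\Gamma_1)}^2+\|h_t(s)\|_{L^2(\Gamma_1)}^2\Big)ds+e^{2\alpha t}\|h(t)\|_{L^2(\Gamma_1)}^2+\|h(0)\|_{L^2(\Gamma_1)}^2+\int_0^t\|h(s)\|_{L^2(\Gamma_1)}^2ds .$$ Let $u$ be the weak solution of $$u_{tt}-\Delta u+a(x)u_t=0 \text{ in }\Omega\times(0,\infty),\quad u|_{\Gamma_0}=0,\quad \frac{\partial u}{\partial n}\Big|_{\Gamma_1}=h,\quad (u(0),u_t(0))=(u^0,u^1),$$ and let $\varepsilon_a(t)=\frac12\|\nabla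 u(t)\|_{L^2(\Omega)}^2+\frac12\|u_t(t)\|_{L^2(\Omega)}^2$. Then there exists a positive constant $c=c(\alpha,\delta,\Omega)$ such that $$\varepsilon_a(t)\le c\,e^{-2\alpha t}e^{\delta_1 t}H(t),\qquad t\ge 0.$$ Moreover, this estimate implies uniform exponential decay of the energy (that is, $\varepsilon_a(t)\le Ce^{-\omega t}$ for all $t\ge0$, for some constants $C,\omega>0$) if for some $\gamma>0$ $$\|h(t)\|_{L^2(\Gamma_1)}^2=\mathcal O(e^{-\gamma t})\quad\text{and}\quad \|h_t(t)\|_{L^2(\Gamma_1)}^2=\mathcal O(e^{-\gamma t})\quad (t\to\infty).$$
   Context: $\Omega\subset\mathbb R^d$ ($d\ge1$) is a bounded domain with smooth boundary $\Gamma=\partial\Omega=\overline{\Gamma_0}\cup\overline{\Gamma_1}$, with $\Gamma_0\ne\emptyset$, $\Gamma_0\cap\Gamma_1=\emptyset$; $n$ is the outward unit normal. $H^1_{\Gamma_0}(\Omega)$ is the space of $H^1(\Omega)$ functions with zero trace on $\Gamma_0$. Convention on constants: the constants denoted by $c$ may also depend on other fixed parameters of the problem (here the coefficient $a$), even when not listed; $c$ does not depend on $t$, on the initial data or on $h$. Weak solution: $u$ is a weak solution on $(0,T)$ if $u=v+w$, where (i) $v$ is the weak solution, with $v\in C([0,T];H^1_{\Gamma_0}(\Omega))$, $v_t\in C([0,T];L^2(\Omega))$, of $v_{tt}=\Delta v$ in $\Omega\times(0,T)$, $v(0)=u^0$, $v_t(0)=u^1$, $v=0$ on $\Gamma_0\times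 (0,T)$, $\frac{\partial v}{\partial n}=h$ on $\Gamma_1\times (0,T)$; and (ii) $w$ is the weak solution, with $w\in C([0,T];H^1_{\Gamma_0}(\Omega))$, $w_t\in C([0,T];L^2(\Omega))$, of $w_{tt}-\Delta w+a(x)(w_t+v_t)=0$ in $\Omega\times(0,T)$, $w(0)=w_t(0)=0$, $w|_{\Gamma_0}=0$, $\frac{\partial w}{\partial n}|_{\Gamma_1}=0$. Weak solutions in (i), (ii) are in the usual variational sense: for all $\phi\in H^1_{\Gamma_0}(\Omega)$, in the sense of distributions in $t$, $\frac{d}{dt}(v_t,\phi)_{L^2(\Omega)}+(\nabla v,\nabla\phi)_{L^2(\Omega)}=\int_{\Gamma_1}h\phi\,d\Gamma$ and $\frac{d}{dt}(w_t,\phi)_{L^2(\Omega)}+(\nabla w,\nabla\phi)_{L^2(\Omega)}+(a(w_t+v_t),\phi)_{L^2(\Omega)}=0$. Here $T>0$ is arbitrary. *)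

theory Defs
  imports "HOL-Analysis.Analysis" "HOL-Library.Landau_Symbols"
begin

section \<open>Smooth functions, domains with smooth boundary, surface measure\<close>

fun Ck :: "nat \<Rightarrow> ('a::euclidean_space \<Rightarrow> real) \<Rightarrow> bool" where
  "Ck 0 f \<longleftrightarrow> continuous_on UNIV f"
| "Ck (Suc k) f \<longleftrightarrow> (\<forall>x. f differentiable at x) \<and>
     (\<forall>b\<in>Basis. Ck k (\<lambda>x. frechet_derivative f (at x) b))"

definition smooth :: "('a::euclidean_space \<Rightarrow> real) \<Rightarrow> bool" where
  "smooth f \<longleftrightarrow> (\<forall>k. Ck k f)"

definition test_function :: "'a::euclidean_space set \<Rightarrow> ('a \<Rightarrow> real) \<Rightarrow> bool" where
  "test_function S \<psi> \<longleftrightarrow> smooth \<psi> \<and> (\<exists>K. compact K \<and> K \<subseteq> S \<and> (\<forall>x. x \<notin> K \<longrightarrow> \<psi> x = 0))"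

text \<open>Near each boundary point the domain lies on one side of the graph of a smooth function.
  The graph is taken over the hyperplane orthogonal to the unit vector \<open>e\<close>: a function on that
  hyperplane is represented by a function on the whole space that is constant along \<open>e\<close>.\<close>

definition smooth_boundary :: "'a::euclidean_space set \<Rightarrow> bool" where
  "smooth_boundary \<Omega> \<longleftrightarrow>
     (\<forall>p\<in>frontier \<Omega>. \<exists>r>0. \<exists>e. \<exists>\<gamma>. norm e = 1 \<and> smooth \<gamma> \<and> (\<forall>x s. \<gamma> (x + s *\<^sub>R e) = \<gamma> x) \<and>
        \<Omega> \<inter> ball p r = {x \<in> ball p r. \<gamma> x < x \<bullet> e})"

definition smooth_bounded_domain :: "'a::euclidean_space set \<Rightarrow> bool" where
  "smooth_bounded_domain \<Omega> \<longleftrightarrow>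
     \<Omega> \<noteq> {} \<and> open \<Omega> \<and> connected \<Omega> \<and> bounded \<Omega> \<and> smooth_boundary \<Omega>"

text \<open>The \<open>m\<close>-dimensional Hausdorff measure, normalised so that it agrees with the usual surface
  measure for \<open>m = DIM('a) - 1\<close>. For \<open>m = 0\<close> it is the counting measure; the empty set is
  treated separately because \<open>0 ^ 0 = 1\<close>.\<close>

definition hausdorff_weight :: "nat \<Rightarrow> 'a::metric_space set \<Rightarrow> ennreal" where
  "hausdorff_weight m A =
     (if A = {} then 0 else ennreal (unit_ball_vol (real m) * (diameter A / 2) ^ m))"

definition hausdorff_pre :: "nat \<Rightarrow> real \<Rightarrow> 'a::metric_space set \<Rightarrow> ennreal" where
  "hausdorff_pre m \<delta> A =
     (INF C\<in>{C :: nat \<Rightarrow> 'a set. A \<subseteq> (\<Union>i. C i) \<and> (\<forall>i. bounded (C i) \<and> diameter (C i) \<le> \<delta>)}.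
        \<Sum>i. hausdorff_weight m (C i))"

definition hausdorff_outer :: "nat \<Rightarrow> 'a::metric_space set \<Rightarrow> ennreal" where
  "hausdorff_outer m A = (SUP \<delta>\<in>{0<..}. hausdorff_pre m \<delta> A)"

definition hausdorff_measure :: "nat \<Rightarrow> 'a::metric_space measure" where
  "hausdorff_measure m = measure_of UNIV (sets borel) (hausdorff_outer m)"

definition surface_on :: "'a::euclidean_space set \<Rightarrow> 'a measure" where
  "surface_on S = restrict_space (hausdorff_measure (DIM('a) - 1)) S"

section \<open>Square integrable functions\<close>

text \<open>Elements of function spaces are represented by functions; equality of elements is equality
  almost everywhere.\<close>

definition L2 :: "'a measure \<Rightarrow> ('a \<Rightarrow> 'b::euclidean_space) set" where
  "L2 M = {f \<in> borel_measurable M. integrable M (\<lambda>x. (norm (f x))\<^sup>2)}"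

definition L2_norm :: "'a measure \<Rightarrow> ('a \<Rightarrow> 'b::euclidean_space) \<Rightarrow> real" where
  "L2_norm M f = sqrt (\<integral>x. (norm (f x))\<^sup>2 \<partial>M)"

definition L2_inner :: "'a measure \<Rightarrow> ('a \<Rightarrow> 'b::euclidean_space) \<Rightarrow> ('a \<Rightarrow> 'b) \<Rightarrow> real" where
  "L2_inner M f g = (\<integral>x. f x \<bullet> g x \<partial>M)"

text \<open>Curves with values in a space of functions with norm \<open>N\<close>, on a time interval \<open>I\<close>.\<close>

definition norm_continuous_on ::
    "(('a \<Rightarrow> real) \<Rightarrow> real) \<Rightarrow> real set \<Rightarrow> (real \<Rightarrow> 'a \<Rightarrow> real) \<Rightarrow> bool" where
  "norm_continuous_on N I f \<longleftrightarrow>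
     (\<forall>t\<in>I. ((\<lambda>s. N (\<lambda>x. f s x - f t x)) \<longlongrightarrow> 0) (at t within I))"

definition has_L2_deriv ::
    "'a measure \<Rightarrow> real set \<Rightarrow> (real \<Rightarrow> 'a \<Rightarrow> real) \<Rightarrow> real \<Rightarrow> ('a \<Rightarrow> real) \<Rightarrow> bool" where
  "has_L2_deriv M I f t g \<longleftrightarrow> g \<in> L2 M \<and>
     ((\<lambda>s. L2_norm M (\<lambda>x. (f s x - f t x) / (s - t) - g x)) \<longlongrightarrow> 0) (at t within I)"

definition L2_deriv ::
    "'a measure \<Rightarrow> real set \<Rightarrow> (real \<Rightarrow> 'a \<Rightarrow> real) \<Rightarrow> real \<Rightarrow> 'a \<Rightarrow> real" where
  "L2_deriv M I f t = (SOME g. has_L2_deriv M I f t g)"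

definition C1_L2 :: "'a measure \<Rightarrow> real set \<Rightarrow> (real \<Rightarrow> 'a \<Rightarrow> real) \<Rightarrow> bool" where
  "C1_L2 M I f \<longleftrightarrow> (\<forall>t\<in>I. f t \<in> L2 M \<and> (\<exists>g. has_L2_deriv M I f t g)) \<and>
     norm_continuous_on (L2_norm M) I (L2_deriv M I f)"

section \<open>Weak derivatives, the Sobolev space, traces\<close>

definition locally_integrable_on :: "('a::euclidean_space \<Rightarrow> real) \<Rightarrow> 'a set \<Rightarrow> bool" where
  "locally_integrable_on f S \<longleftrightarrow> (\<forall>K. compact K \<and> K \<subseteq> S \<longrightarrow> integrable (lebesgue_on K) f)"

text \<open>\<open>g\<close> is the distributional derivative of \<open>f\<close> on the open set \<open>S\<close> in the direction \<open>b\<close>.\<close>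

definition has_weak_deriv ::
    "'a::euclidean_space set \<Rightarrow> 'a \<Rightarrow> ('a \<Rightarrow> real) \<Rightarrow> ('a \<Rightarrow> real) \<Rightarrow> bool" where
  "has_weak_deriv S b f g \<longleftrightarrow> locally_integrable_on f S \<and> locally_integrable_on g S \<and>
     (\<forall>\<psi>. test_function S \<psi> \<longrightarrow>
        (\<integral>x. f x * frechet_derivative \<psi> (at x) b \<partial>lebesgue_on S) = - (\<integral>x. g x * \<psi> x \<partial>lebesgue_on S))"

definition has_weak_grad ::
    "'a::euclidean_space set \<Rightarrow> ('a \<Rightarrow> real) \<Rightarrow> ('a \<Rightarrow> 'a) \<Rightarrow> bool" where
  "has_weak_grad \<Omega> f g \<longleftrightarrow> (\<forall>b\<in>Basis. has_weak_deriv \<Omega> b f (\<lambda>x. g x \<bullet> b))"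

definition H1 :: "'a::euclidean_space set \<Rightarrow> ('a \<Rightarrow> real) set" where
  "H1 \<Omega> = {f \<in> L2 (lebesgue_on \<Omega>). \<exists>g \<in> L2 (lebesgue_on \<Omega>). has_weak_grad \<Omega> f g}"

definition wgrad :: "'a::euclidean_space set \<Rightarrow> ('a \<Rightarrow> real) \<Rightarrow> 'a \<Rightarrow> 'a" where
  "wgrad \<Omega> f = (SOME g. g \<in> L2 (lebesgue_on \<Omega>) \<and> has_weak_grad \<Omega> f g)"

definition H1_norm :: "'a::euclidean_space set \<Rightarrow> ('a \<Rightarrow> real) \<Rightarrow> real" where
  "H1_norm \<Omega> f =
     sqrt ((L2_norm (lebesgue_on \<Omega>) f)\<^sup>2 + (L2_norm (lebesgue_on \<Omega>) (wgrad \<Omega> f))\<^sup>2)"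

text \<open>\<open>g\<close> is the boundary trace of \<open>f\<close>: the trace operator is the continuous extension to \<open>H1\<close> of
  the restriction to the boundary of functions that are smooth up to the boundary.\<close>

definition is_trace :: "'a::euclidean_space set \<Rightarrow> ('a \<Rightarrow> real) \<Rightarrow> ('a \<Rightarrow> real) \<Rightarrow> bool" where
  "is_trace \<Omega> f g \<longleftrightarrow> f \<in> H1 \<Omega> \<and> g \<in> L2 (surface_on (frontier \<Omega>)) \<and>
     (\<exists>\<phi> :: nat \<Rightarrow> 'a \<Rightarrow> real. (\<forall>k. smooth (\<phi> k)) \<and>
        (\<lambda>k. H1_norm \<Omega> (\<lambda>x. \<phi> k x - f x)) \<longlonglongrightarrow> 0 \<and>
        (\<lambda>k. L2_norm (surface_on (frontier \<Omega>)) (\<lambda>x. \<phi> k x - g x)) \<longlonglongrightarrow> 0)"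

definition H1_zero :: "'a::euclidean_space set \<Rightarrow> 'a set \<Rightarrow> ('a \<Rightarrow> real) set" where
  "H1_zero \<Omega> \<Gamma>\<^sub>0 =
     {f. \<exists>g. is_trace \<Omega> f g \<and> (AE x in surface_on (frontier \<Omega>). x \<in> \<Gamma>\<^sub>0 \<longrightarrow> g x = 0)}"

section \<open>Weak solutions and the energy\<close>

text \<open>\<open>v \<in> C([0,T]; H1_zero)\<close> and \<open>v\<^sub>t \<in> C([0,T]; L\<^sup>2)\<close>. Since \<open>v\<^sub>t\<close> is continuous, it is the
  derivative of \<open>v\<close> in the norm of \<open>L\<^sup>2\<close>, one-sided at the endpoints.\<close>

definition finite_energy :: "'a::euclidean_space set \<Rightarrow> 'a set \<Rightarrow> real \<Rightarrow> (real \<Rightarrow> 'a \<Rightarrow> real) \<Rightarrow> bool" where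
  "finite_energy \<Omega> \<Gamma>\<^sub>0 T v \<longleftrightarrow>
     (\<forall>t\<in>{0..T}. v t \<in> H1_zero \<Omega> \<Gamma>\<^sub>0) \<and> norm_continuous_on (H1_norm \<Omega>) {0..T} v \<and>
     C1_L2 (lebesgue_on \<Omega>) {0..T} v"

definition weak_solution_v ::
    "'a::euclidean_space set \<Rightarrow> 'a set \<Rightarrow> 'a set \<Rightarrow> real \<Rightarrow> ('a \<Rightarrow> real) \<Rightarrow> ('a \<Rightarrow> real) \<Rightarrow>
     (real \<Rightarrow> 'a \<Rightarrow> real) \<Rightarrow> (real \<Rightarrow> 'a \<Rightarrow> real) \<Rightarrow> bool" where
  "weak_solution_v \<Omega> \<Gamma>\<^sub>0 \<Gamma>\<^sub>1 T u0 u1 h v \<longleftrightarrow>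
     (let M = lebesgue_on \<Omega>; vt = L2_deriv M {0..T} v in
      finite_energy \<Omega> \<Gamma>\<^sub>0 T v \<and> (AE x in M. v 0 x = u0 x) \<and> (AE x in M. vt 0 x = u1 x) \<and>
      (\<forall>\<phi>\<in>H1_zero \<Omega> \<Gamma>\<^sub>0. \<forall>\<phi>\<^sub>\<Gamma>. is_trace \<Omega> \<phi> \<phi>\<^sub>\<Gamma> \<longrightarrow>
         has_weak_deriv {0<..<T} 1 (\<lambda>t. L2_inner M (vt t) \<phi>)
           (\<lambda>t. L2_inner (surface_on \<Gamma>\<^sub>1) (h t) \<phi>\<^sub>\<Gamma> - L2_inner M (wgrad \<Omega> (v t)) (wgrad \<Omega> \<phi>))))"

definition weak_solution_w ::
    "'a::euclidean_space set \<Rightarrow> 'a set \<Rightarrow> real \<Rightarrow> ('a \<Rightarrow> real) \<Rightarrow>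
     (real \<Rightarrow> 'a \<Rightarrow> real) \<Rightarrow> (real \<Rightarrow> 'a \<Rightarrow> real) \<Rightarrow> bool" where
  "weak_solution_w \<Omega> \<Gamma>\<^sub>0 T a v w \<longleftrightarrow>
     (let M = lebesgue_on \<Omega>; vt = L2_deriv M {0..T} v; wt = L2_deriv M {0..T} w in
      finite_energy \<Omega> \<Gamma>\<^sub>0 T w \<and> (AE x in M. w 0 x = 0) \<and> (AE x in M. wt 0 x = 0) \<and>
      (\<forall>\<phi>\<in>H1_zero \<Omega> \<Gamma>\<^sub>0.
         has_weak_deriv {0<..<T} 1 (\<lambda>t. L2_inner M (wt t) \<phi>)
           (\<lambda>t. - L2_inner M (wgrad \<Omega> (w t)) (wgrad \<Omega> \<phi>)
                - L2_inner M (\<lambda>x. a x * (wt t x + vt t x)) \<phi>)))"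

definition weak_solution ::
    "'a::euclidean_space set \<Rightarrow> 'a set \<Rightarrow> 'a set \<Rightarrow> ('a \<Rightarrow> real) \<Rightarrow> real \<Rightarrow> ('a \<Rightarrow> real) \<Rightarrow>
     ('a \<Rightarrow> real) \<Rightarrow> (real \<Rightarrow> 'a \<Rightarrow> real) \<Rightarrow> (real \<Rightarrow> 'a \<Rightarrow> real) \<Rightarrow> bool" where
  "weak_solution \<Omega> \<Gamma>\<^sub>0 \<Gamma>\<^sub>1 a T u0 u1 h u \<longleftrightarrow>
     (\<exists>v w. weak_solution_v \<Omega> \<Gamma>\<^sub>0 \<Gamma>\<^sub>1 T u0 u1 h v \<and> weak_solution_w \<Omega> \<Gamma>\<^sub>0 T a v w \<and>
        (\<forall>t\<in>{0..T}. AE x in lebesgue_on \<Omega>. u t x = v t x + w t x))"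

definition global_weak_solution ::
    "'a::euclidean_space set \<Rightarrow> 'a set \<Rightarrow> 'a set \<Rightarrow> ('a \<Rightarrow> real) \<Rightarrow> ('a \<Rightarrow> real) \<Rightarrow>
     ('a \<Rightarrow> real) \<Rightarrow> (real \<Rightarrow> 'a \<Rightarrow> real) \<Rightarrow> (real \<Rightarrow> 'a \<Rightarrow> real) \<Rightarrow> bool" where
  "global_weak_solution \<Omega> \<Gamma>\<^sub>0 \<Gamma>\<^sub>1 a u0 u1 h u \<longleftrightarrow>
     (\<forall>T>0. weak_solution \<Omega> \<Gamma>\<^sub>0 \<Gamma>\<^sub>1 a T u0 u1 h u)"

definition energy :: "'a::euclidean_space set \<Rightarrow> (real \<Rightarrow> 'a \<Rightarrow> real) \<Rightarrow> real \<Rightarrow> real" where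
  "energy \<Omega> u t = 1/2 * (L2_norm (lebesgue_on \<Omega>) (wgrad \<Omega> (u t)))\<^sup>2 +
     1/2 * (L2_norm (lebesgue_on \<Omega>) (L2_deriv (lebesgue_on \<Omega>) {0..} u t))\<^sup>2"

definition eps0 :: "real \<Rightarrow> real \<Rightarrow> real \<Rightarrow> real" where
  "eps0 a_min a_max c_p = min (a_min / 4) (a_min / (2 * a_max\<^sup>2 * c_p))"

definition data_bound ::
    "'a::euclidean_space set \<Rightarrow> 'a set \<Rightarrow> real \<Rightarrow> ('a \<Rightarrow> real) \<Rightarrow> ('a \<Rightarrow> real) \<Rightarrow>
     (real \<Rightarrow> 'a \<Rightarrow> real) \<Rightarrow> real \<Rightarrow> real" where
  "data_bound \<Omega> \<Gamma>\<^sub>1 \<alpha> u0 u1 h t =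
     (let N = L2_norm (surface_on \<Gamma>\<^sub>1); ht = L2_deriv (surface_on \<Gamma>\<^sub>1) {0..} h in
      (H1_norm \<Omega> u0)\<^sup>2 + (L2_norm (lebesgue_on \<Omega>) u1)\<^sup>2 +
      integral {0..t} (\<lambda>s. exp (2 * \<alpha> * s) * ((N (h s))\<^sup>2 + (N (ht s))\<^sup>2)) +
      exp (2 * \<alpha> * t) * (N (h t))\<^sup>2 + (N (h 0))\<^sup>2 + integral {0..t} (\<lambda>s. (N (h s))\<^sup>2))"

end

theory Submission
  imports Defs "HOL-Computational_Algebra.Polynomial"
begin

text \<open>The proof is the perturbed energy method. Adding the two variational problems, the solution
  satisfies \<open>(u\<^sub>t, \<phi>)' = (h, \<phi>)\<^sub>\<Gamma> - (\<nabla>u, \<nabla>\<phi>) - (a u\<^sub>t, \<phi>)\<close> for every admissible \<open>\<phi>\<close>, where \<open>(h, \<phi>)\<^sub>\<Gamma>\<close> is the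
  integral over \<open>\<Gamma>\<^sub>1\<close>. Let \<open>\<epsilon>\<close> be the energy. Formally, the choice \<open>\<phi> = u\<^sub>t\<close> gives the energy
  identity, and the boundary term
  \<open>(h, u\<^sub>t)\<^sub>\<Gamma>\<close>, for which there is no control of the trace of \<open>u\<^sub>t\<close>, is integrated by parts in time:
  \<open>(\<epsilon> - (h, u)\<^sub>\<Gamma>)' = - (a u\<^sub>t, u\<^sub>t) - (h\<^sub>t, u)\<^sub>\<Gamma>\<close>. For the rate \<open>2\<alpha>\<close> one takes \<open>\<eta> = 2\<alpha>\<close> and
  \<open>E = \<epsilon> - (h, u)\<^sub>\<Gamma> + \<eta> (u\<^sub>t, u)\<close>. The choice \<open>\<phi> = u\<close> gives the derivative of the last term, and
  the Poincare, trace and Young inequalities give \<open>E' + \<eta> E \<le> C \<bar>h\<^sub>t\<bar>\<^sup>2\<close> (\<open>dissipation_bound\<close>)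
  because \<open>\<eta> \<le> eps0\<close>. Integration of this inequality and the equivalence of \<open>E\<close> with the energy up to
  \<open>\<bar>h\<bar>\<^sup>2\<close> (\<open>perturbed_energy_equivalent\<close>) give \<open>\<epsilon> \<le> c exp (- 2\<alpha>t) H\<close> (\<open>energy_decay_estimate\<close>).
  The factor \<open>exp (\<delta>\<^sub>1 t)\<close> is at least 1, so the estimate with that factor follows. If the data decay
  like \<open>exp (- \<gamma>t)\<close>, then for \<open>\<alpha> < \<gamma>/2\<close> the quantity \<open>H\<close> stays bounded, whence exponential decay.

  Two steps of this sketch carry most of the work.

  The function \<open>u\<^sub>t\<close> takes values in \<open>L\<^sup>2\<close> only and is not an admissible \<open>\<phi>\<close>. The identity is therefore
  derived from the scalar function \<open>k(t, s) = (u\<^sub>t(t), u(s))\<close>, whose two partial derivatives exist: the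
  one in \<open>t\<close> by the equation with \<open>\<phi> = u(s)\<close>, the one in \<open>s\<close> because \<open>u\<close> is differentiable in \<open>L\<^sup>2\<close>. A
  symmetric difference of \<open>k\<close> across the diagonal approximates the energy, and its own derivative loses
  all terms without a further derivative by symmetry (\<open>scalar_energy_identity\<close>). That the equation holds
  pointwise in time comes from the continuity of all terms (\<open>continuous_weak_deriv_imp_deriv\<close>).

  The terms with \<open>h\<close> require the trace inequality on \<open>H1\<close> (\<open>trace_inequality\<close>), with the surface
  measure given as a Hausdorff measure. In a chart the boundary is a graph, and the value of a smooth
  function at a boundary point is bounded by an integral along a segment into the domain
  (\<open>endpoint_le_line_integral\<close>). Integrating over the boundary requires that the image of surface
  measure times length under \<open>(x, s) \<mapsto> x + s e\<close> be at most a multiple of Lebesgue measure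
  (\<open>graph_transport\<close>). On cubes this follows from the bound \<open>C l\<^sup>d\<^sup>-\<^sup>1\<close> for the Hausdorff measure of
  the graph in a ball of radius \<open>l\<close>, which is a packing estimate (\<open>card_separated_graph_le\<close>). Density of
  the smooth functions, which is part of the definition of a trace, extends the inequality.\<close>

section \<open>Smooth functions\<close>

lemma Ck_Suc_imp_Ck: "Ck (Suc k) f \<Longrightarrow> Ck k f"
proof (induction k arbitrary: f)
  case 0
  then show ?case
    by (auto intro!: continuous_at_imp_continuous_on differentiable_imp_continuous_within)
next
  case (Suc k)
  from Suc.prems have d: "\<forall>x. f differentiable at x"
    and p: "\<And>b. b \<in> Basis \<Longrightarrow> Ck (Suc k) (\<lambda>x. frechet_derivative f (at x) b)"
    by (simp_all only: Ck.simps(2)[of "Suc k" f]) auto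
  show ?case
    unfolding Ck.simps(2)[of k f] using d Suc.IH[OF p] by blast
qed

lemma Ck_imp_continuous_on: "Ck k f \<Longrightarrow> continuous_on S f"
proof (induction k)
  case 0 then show ?case by (auto intro: continuous_on_subset)
next
  case (Suc k) then show ?case using Ck_Suc_imp_Ck by blast
qed

lemma Ck_has_derivative:
  "Ck (Suc k) f \<Longrightarrow> (f has_derivative frechet_derivative f (at x)) (at x within S)"
  by (auto simp: frechet_derivative_works intro: has_derivative_at_withinI)

text \<open>Any family of linear maps that are derivatives agrees with the Frechet derivatives, so
  smoothness can be checked on an explicitly computed derivative.\<close>

lemma Ck_SucI:
  assumes "\<And>x. (f has_derivative f' x) (at x)" "\<And>b. b \<in> Basis \<Longrightarrow> Ck k (\<lambda>x. f' x b)"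
  shows "Ck (Suc k) f"
proof -
  have "f' x = frechet_derivative f (at x)" for x
    using assms(1) by (rule frechet_derivative_at)
  then show ?thesis
    using assms by (auto simp: differentiable_def fun_eq_iff) 
qed

lemma Ck_const: "Ck k (\<lambda>x. c)"
  by (induction k arbitrary: c) (auto simp: frechet_derivative_const)

lemma Ck_add: "Ck k f \<Longrightarrow> Ck k g \<Longrightarrow> Ck k (\<lambda>x. f x + g x)"
proof (induction k arbitrary: f g)
  case 0 then show ?case by (auto intro: continuous_intros)
next
  case (Suc k)
  show ?case
    by (rule Ck_SucI[OF has_derivative_add[OF Ck_has_derivative Ck_has_derivative]])
       (use Suc in auto)
qed

lemma Ck_mult: "Ck k f \<Longrightarrow> Ck k g \<Longrightarrow> Ck k (\<lambda>x. f x * g x)"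
proof (induction k arbitrary: f g)
  case 0 then show ?case by (auto intro: continuous_intros)
next
  case (Suc k)
  have "Ck k f" "Ck k g" using Suc.prems Ck_Suc_imp_Ck by blast+
  then show ?case
    by (intro Ck_SucI[OF has_derivative_mult[OF Ck_has_derivative Ck_has_derivative]] Ck_add Suc.IH)
       (use Suc in auto)
qed

lemma Ck_prod: "finite I \<Longrightarrow> (\<And>i. i \<in> I \<Longrightarrow> Ck k (f i)) \<Longrightarrow> Ck k (\<lambda>x. \<Prod>i\<in>I. f i x)"
  by (induction I rule: finite_induct) (auto intro: Ck_const Ck_mult)

lemma smooth_imp_continuous_on: "smooth f \<Longrightarrow> continuous_on S f"
  unfolding smooth_def using Ck_imp_continuous_on by blast

lemma smooth_add: "smooth f \<Longrightarrow> smooth g \<Longrightarrow> smooth (\<lambda>x. f x + g x)"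
  by (simp add: smooth_def Ck_add)

lemma smooth_cmult: "smooth f \<Longrightarrow> smooth (\<lambda>x. c * f x)" for c :: real
  by (simp add: smooth_def Ck_mult Ck_const)

lemma smooth_has_derivative:
  "smooth f \<Longrightarrow> (f has_derivative frechet_derivative f (at x)) (at x within S)"
  unfolding smooth_def using Ck_has_derivative by blast

lemma smooth_partial_continuous_on:
  "smooth f \<Longrightarrow> b \<in> Basis \<Longrightarrow> continuous_on S (\<lambda>x. frechet_derivative f (at x) b)"
proof -
  assume "smooth f" "b \<in> Basis"
  then have "Ck (Suc 0) f" unfolding smooth_def by blast
  with \<open>b \<in> Basis\<close> show ?thesis by (auto intro: continuous_on_subset)
qed

section \<open>Smooth bumps on boxes\<close>

text \<open>The functions \<open>p(1/t) exp (-1/t)\<close>, extended by 0 to \<open>t \<le> 0\<close>. Admitting all polynomials \<open>p\<close>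
  makes the class closed under differentiation.\<close>

definition flat :: "real poly \<Rightarrow> real \<Rightarrow> real" where
  "flat p t = (if t > 0 then poly p (1 / t) * exp (- (1 / t)) else 0)"

text \<open>The polynomial \<open>x\<^sup>2 (p(x) - p'(x))\<close> is what the chain rule produces at \<open>x = 1/t\<close>.\<close>

definition flat_deriv :: "real poly \<Rightarrow> real poly" where
  "flat_deriv p = monom 1 2 * (p - pderiv p)"

lemma poly_times_exp_minus_tendsto_0: "((\<lambda>y::real. poly p y * exp (- y)) \<longlongrightarrow> 0) at_top"
proof -
  have "((\<lambda>y::real. \<Sum>i\<le>degree p. coeff p i * (y ^ i / exp y)) \<longlongrightarrow> (\<Sum>i\<le>degree p. coeff p i * 0)) at_top"
    by (intro tendsto_sum tendsto_mult tendsto_const tendsto_power_div_exp_0)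
  then show ?thesis
    by (simp add: poly_altdef sum_divide_distrib sum_distrib_right exp_minus field_simps)
qed

text \<open>At 0 the difference quotient from the right is \<open>x p(x) exp (-x)\<close> with \<open>x = 1/h\<close> tending
  to infinity, and the exponential wins.\<close>

lemma flat_has_derivative: "(flat p has_real_derivative flat (flat_deriv p) t) (at t)"
proof -
  consider "t > 0" | "t < 0" | "t = 0" by linarith
  then show ?thesis
  proof cases
    case 1
    have "((\<lambda>t. poly p (1 / t) * exp (- (1 / t))) has_real_derivative flat (flat_deriv p) t) (at t)"
      using 1 by (auto intro!: derivative_eq_intros simp: flat_def flat_deriv_def poly_monom field_simps power2_eq_square)
    then show ?thesis
      by (rule has_field_derivative_transform_within_open[of _ _ _ "{0<..}"])
         (use 1 in \<open>auto simp: flat_def\<close>)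
  next
    case 2
    have "((\<lambda>t. 0) has_real_derivative flat (flat_deriv p) t) (at t)"
      using 2 by (auto simp: flat_def)
    then show ?thesis
      by (rule has_field_derivative_transform_within_open[of _ _ _ "{..<0}"])
         (use 2 in \<open>auto simp: flat_def\<close>)
  next
    case 3
    have l: "((\<lambda>h. (flat p (0 + h) - flat p 0) / h) \<longlongrightarrow> 0) (at_left 0)"
      by (rule tendsto_eventually) (auto simp: flat_def eventually_at_filter)
    have "((\<lambda>h::real. poly (p * monom 1 1) (inverse h) * exp (- inverse h)) \<longlongrightarrow> 0) (at_right 0)"
      by (rule filterlim_compose[OF poly_times_exp_minus_tendsto_0 filterlim_inverse_at_top_right])
    then have r: "((\<lambda>h. (flat p (0 + h) - flat p 0) / h) \<longlongrightarrow> 0) (at_right 0)"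
      by (rule Lim_transform_eventually)
         (auto simp: flat_def eventually_at_filter poly_monom field_simps)
    show ?thesis
      using filterlim_split_at[OF l r] 3 by (simp add: DERIV_def flat_def)
  qed
qed

lemma Ck_flat: "Ck k (\<lambda>x::'a::euclidean_space. flat p (x \<bullet> v + c))"
proof (induction k arbitrary: p)
  case 0
  have "continuous_on UNIV (flat p)"
    using flat_has_derivative DERIV_isCont continuous_at_imp_continuous_on by blast
  then show ?case
    by (auto intro!: continuous_on_compose2[of UNIV "flat p"] continuous_intros)
next
  case (Suc k)
  have d: "((\<lambda>x::'a. flat p (x \<bullet> v + c)) has_derivative (\<lambda>h. flat (flat_deriv p) (x \<bullet> v + c) * (h \<bullet> v))) (at x)" for x
    by (rule DERIV_compose_FDERIV[OF flat_has_derivative, THEN has_derivative_eq_rhs])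
       (auto intro!: derivative_eq_intros simp: fun_eq_iff)
  show ?case
    by (rule Ck_SucI[OF d]) (intro Ck_mult Ck_const Suc)
qed

text \<open>A product of one flat factor for each face of the box with corners \<open>l\<close> and \<open>u\<close>. As \<open>n\<close>
  grows, the factors increase to 1 inside the box.\<close>

definition box_bump :: "nat \<Rightarrow> 'a::euclidean_space \<Rightarrow> 'a \<Rightarrow> 'a \<Rightarrow> real" where
  "box_bump n l u x =
     (\<Prod>b\<in>Basis. flat 1 (real n * (x \<bullet> b - l \<bullet> b)) * flat 1 (real n * (u \<bullet> b - x \<bullet> b)))"

lemma smooth_box_bump: "smooth (box_bump n l u)"
  unfolding smooth_def
proof
  fix k
  have "Ck k (\<lambda>x. \<Prod>b\<in>Basis. flat 1 (x \<bullet> (real n *\<^sub>R b) + (- real n * (l \<bullet> b))) *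
      flat 1 (x \<bullet> ((- real n) *\<^sub>R b) + real n * (u \<bullet> b)))"
    by (intro Ck_prod Ck_mult Ck_flat finite_Basis)
  moreover have "box_bump n l u = (\<lambda>x. \<Prod>b\<in>Basis. flat 1 (x \<bullet> (real n *\<^sub>R b) + (- real n * (l \<bullet> b))) *
      flat 1 (x \<bullet> ((- real n) *\<^sub>R b) + real n * (u \<bullet> b)))"
    by (simp add: box_bump_def fun_eq_iff algebra_simps)
  ultimately show "Ck k (box_bump n l u)" by simp
qed

lemma flat_one_bounds: "0 \<le> flat 1 t" "flat 1 t \<le> 1"
  by (auto simp: flat_def)

lemma flat_one_pos: "t > 0 \<Longrightarrow> flat 1 t > 0"
  by (auto simp: flat_def)

lemma box_bump_bounds: "0 \<le> box_bump n l u x" "box_bump n l u x \<le> 1"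
  unfolding box_bump_def
  by (auto intro!: prod_nonneg prod_le_1 mult_nonneg_nonneg mult_le_one flat_one_bounds)

lemma box_bump_eq_0: "x \<notin> box l u \<Longrightarrow> box_bump n l u x = 0"
proof -
  assume "x \<notin> box l u"
  then obtain b where b: "b \<in> Basis" "x \<bullet> b \<le> l \<bullet> b \<or> u \<bullet> b \<le> x \<bullet> b"
    by (auto simp: mem_box not_less)
  then have "real n * (x \<bullet> b - l \<bullet> b) \<le> 0 \<or> real n * (u \<bullet> b - x \<bullet> b) \<le> 0"
    by (auto simp: mult_le_0_iff)
  then show ?thesis
    unfolding box_bump_def using b(1) by (intro prod_zero) (auto simp: flat_def intro!: bexI[of _ b])
qed

lemma box_bump_pos: "n > 0 \<Longrightarrow> x \<in> box l u \<Longrightarrow> box_bump n l u x > 0"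
  unfolding box_bump_def by (auto simp: mem_box intro!: prod_pos mult_pos_pos flat_one_pos)

lemma test_function_box_bump: "cbox l u \<subseteq> S \<Longrightarrow> test_function S (box_bump n l u)"
  unfolding test_function_def
  using box_bump_eq_0 box_subset_cbox by (auto simp: smooth_box_bump intro!: exI[of _ "cbox l u"]) blast

lemma flat_one_tendsto:
  assumes "t > 0" shows "(\<lambda>n. flat 1 (real n * t)) \<longlonglongrightarrow> 1"
proof -
  have "(\<lambda>n. exp (- ((1 / t) * (1 / real n)))) \<longlonglongrightarrow> exp (- ((1 / t) * 0))"
    by (intro tendsto_intros lim_const_over_n)
  moreover have "\<forall>\<^sub>F n in sequentially. exp (- ((1 / t) * (1 / real n))) = flat 1 (real n * t)"
    using eventually_gt_at_top[of 0] by eventually_elim (use assms in \<open>auto simp: flat_def field_simps\<close>)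
  ultimately show ?thesis by (auto intro: Lim_transform_eventually)
qed

lemma box_bump_tendsto: "(\<lambda>n. box_bump n l u x) \<longlonglongrightarrow> indicator (box l u) x"
proof (cases "x \<in> box l u")
  case True
  have "(\<lambda>n. box_bump n l u x) \<longlonglongrightarrow> (\<Prod>b\<in>(Basis::'a set). 1 * 1)"
    unfolding box_bump_def
    by (intro tendsto_prod tendsto_mult flat_one_tendsto) (use True in \<open>auto simp: mem_box\<close>)
  then show ?thesis using True by simp
next
  case False
  then show ?thesis by (simp add: box_bump_eq_0)
qed

section \<open>Uniqueness of weak derivatives\<close>

lemma borel_measurable_lebesgue_on_cong_AE:
  fixes f g :: "'a::euclidean_space \<Rightarrow> 'b::euclidean_space"
  assumes S: "S \<in> sets lebesgue" and f: "f \<in> borel_measurable (lebesgue_on S)"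
    and ae: "AE x in lebesgue_on S. f x = g x"
  shows "g \<in> borel_measurable (lebesgue_on S)"
proof -
  have "AE x in lebesgue. (if x \<in> S then f x else 0) = (if x \<in> S then g x else 0)"
    using ae S by (simp add: AE_restrict_space_iff)
  moreover have "(\<lambda>x. if x \<in> S then f x else 0) \<in> borel_measurable lebesgue"
    using f S by (simp add: borel_measurable_if)
  ultimately have "(\<lambda>x. if x \<in> S then g x else 0) \<in> borel_measurable lebesgue"
    by (rule borel_measurable_AE[rotated])
  then show ?thesis using S by (simp add: borel_measurable_if)
qed

lemma test_function_smooth: "test_function S \<psi> \<Longrightarrow> smooth \<psi>"
  by (simp add: test_function_def)

lemma test_function_partial:
  assumes "test_function S \<psi>" "b \<in> Basis"
  shows "test_function S (\<lambda>x. frechet_derivative \<psi> (at x) b)"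
proof -
  obtain K where K: "compact K" "K \<subseteq> S" "\<And>x. x \<notin> K \<Longrightarrow> \<psi> x = 0" and sm: "smooth \<psi>"
    using assms(1) by (auto simp: test_function_def)
  have "smooth (\<lambda>x. frechet_derivative \<psi> (at x) b)"
    unfolding smooth_def using sm[unfolded smooth_def] assms(2) by (metis Ck.simps(2))
  moreover have "frechet_derivative \<psi> (at x) b = 0" if "x \<notin> K" for x
  proof -
    have "((\<lambda>x. 0) has_derivative (\<lambda>h. 0)) (at x)" by simp
    then have "(\<psi> has_derivative (\<lambda>h. 0)) (at x)"
      by (rule has_derivative_transform_within_open[of _ _ _ _ "- K"])
         (use that K in \<open>auto simp: compact_imp_closed\<close>)
    then show ?thesis by (metis frechet_derivative_at)
  qed
  ultimately show ?thesis using K unfolding test_function_def by blast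
qed

lemma test_function_bounded:
  assumes "test_function S \<psi>" obtains B where "\<And>x. \<bar>\<psi> x\<bar> \<le> B"
proof -
  obtain K where K: "compact K" "\<And>x. x \<notin> K \<Longrightarrow> \<psi> x = 0"
    using assms by (auto simp: test_function_def)
  have "compact (\<psi> ` K)"
    using K(1) assms by (intro compact_continuous_image smooth_imp_continuous_on test_function_smooth)
  then obtain B where B: "\<And>x. x \<in> K \<Longrightarrow> \<bar>\<psi> x\<bar> \<le> B"
    using compact_imp_bounded bounded_iff by (metis imageI real_norm_def)
  have "\<bar>\<psi> x\<bar> \<le> max B 0" for x using B[of x] K(2)[of x] by (cases "x \<in> K") auto
  then show ?thesis using that by blast
qed

lemma continuous_imp_borel_measurable_lebesgue_on:
  "continuous_on UNIV (f :: 'a::euclidean_space \<Rightarrow> 'b::euclidean_space) \<Longrightarrow> f \<in> borel_measurable (lebesgue_on S)"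
  by (intro measurable_restrict_space1 measurable_completion) (simp add: borel_measurable_continuous_onI)

text \<open>A locally integrable function need not be integrable over \<open>S\<close>; the support of the second
  factor confines the product to a compact set.\<close>

lemma integrable_mult_supported:
  fixes f \<psi> :: "'a::euclidean_space \<Rightarrow> real"
  assumes f: "integrable (lebesgue_on K) f" and K: "compact K" "K \<subseteq> S" and S: "S \<in> sets lebesgue"
    and \<psi>: "continuous_on UNIV \<psi>" "\<And>x. \<bar>\<psi> x\<bar> \<le> B" "\<And>x. x \<notin> K \<Longrightarrow> \<psi> x = 0"
  shows "integrable (lebesgue_on S) (\<lambda>x. f x * \<psi> x)"
proof -
  have Km: "K \<in> sets lebesgue" using K by (simp add: compact_imp_closed)
  have "integrable lebesgue (\<lambda>x. indicator K x *\<^sub>R f x)"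
    using f Km by (simp add: integrable_restrict_space)
  then have "integrable lebesgue (\<lambda>x. B * (indicator K x *\<^sub>R f x))" by simp
  then have "integrable lebesgue (\<lambda>x. (indicator K x *\<^sub>R f x) * \<psi> x)"
  proof (rule Bochner_Integration.integrable_bound)
    show "(\<lambda>x. (indicator K x *\<^sub>R f x) * \<psi> x) \<in> borel_measurable lebesgue"
      using \<open>integrable lebesgue (\<lambda>x. indicator K x *\<^sub>R f x)\<close>
        continuous_imp_borel_measurable_lebesgue_on[OF \<psi>(1), of UNIV]
      by (auto simp: lebesgue_on_UNIV_eq)
    show "AE x in lebesgue. norm ((indicator K x *\<^sub>R f x) * \<psi> x) \<le> norm (B * (indicator K x *\<^sub>R f x))"
    proof (intro always_eventually allI)
      fix x
      have "\<bar>indicator K x * f x\<bar> * \<bar>\<psi> x\<bar> \<le> \<bar>indicator K x * f x\<bar> * \<bar>B\<bar>"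
        using \<psi>(2)[of x] by (intro mult_left_mono) auto
      then show "norm ((indicator K x *\<^sub>R f x) * \<psi> x) \<le> norm (B * (indicator K x *\<^sub>R f x))"
        by (simp add: abs_mult mult.commute)
    qed
  qed
  moreover have "(\<lambda>x. (indicator K x *\<^sub>R f x) * \<psi> x) = (\<lambda>x. indicator S x *\<^sub>R (f x * \<psi> x))"
    using K \<psi>(3) by (auto simp: fun_eq_iff indicator_def)
  ultimately show ?thesis using S by (simp add: integrable_restrict_space)
qed

lemma locally_integrable_mult_test:
  assumes "locally_integrable_on f S" "test_function S \<psi>" "S \<in> sets lebesgue"
  shows "integrable (lebesgue_on S) (\<lambda>x. f x * \<psi> x)"
proof -
  obtain K where K: "compact K" "K \<subseteq> S" "\<And>x. x \<notin> K \<Longrightarrow> \<psi> x = 0"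
    using assms(2) by (auto simp: test_function_def)
  obtain B where "\<And>x. \<bar>\<psi> x\<bar> \<le> B" using test_function_bounded[OF assms(2)] by blast
  with K assms show ?thesis
    by (intro integrable_mult_supported[of K])
       (auto simp: locally_integrable_on_def intro: smooth_imp_continuous_on test_function_smooth)
qed

lemma locally_integrable_lincomb:
  "locally_integrable_on f S \<Longrightarrow> locally_integrable_on g S \<Longrightarrow> locally_integrable_on (\<lambda>x. f x + c * g x) S"
  by (auto simp: locally_integrable_on_def)

lemma has_weak_deriv_lincomb:
  assumes "has_weak_deriv S b f f'" "has_weak_deriv S b g g'" "b \<in> Basis" "S \<in> sets lebesgue"
  shows "has_weak_deriv S b (\<lambda>x. f x + c * g x) (\<lambda>x. f' x + c * g' x)"
  unfolding has_weak_deriv_def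
proof (intro conjI allI impI)
  fix \<psi> assume t: "test_function S \<psi>"
  note t' = test_function_partial[OF t assms(3)]
  note [simp] = locally_integrable_mult_test[OF _ t assms(4)] locally_integrable_mult_test[OF _ t' assms(4)]
  show "(\<integral>x. (f x + c * g x) * frechet_derivative \<psi> (at x) b \<partial>lebesgue_on S) =
      - (\<integral>x. (f' x + c * g' x) * \<psi> x \<partial>lebesgue_on S)"
    using assms t by (simp add: has_weak_deriv_def ring_distribs mult.assoc)
qed (use assms in \<open>auto simp: has_weak_deriv_def intro: locally_integrable_lincomb\<close>)

text \<open>The bumps of the box converge boundedly to its indicator, so the hypothesis on test
  functions passes to boxes by dominated convergence.\<close>

lemma integral_box_eq_0_if_test_eq_0:
  assumes S: "open S" and g: "locally_integrable_on g S"
    and 0: "\<And>\<psi>. test_function S \<psi> \<Longrightarrow> (\<integral>x. g x * \<psi> x \<partial>lebesgue_on S) = 0"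
    and lu: "cbox l u \<subseteq> S"
  shows "(\<integral>x. indicator (box l u) x * g x \<partial>lebesgue_on S) = 0"
proof -
  have Sm: "S \<in> sets lebesgue" using S by simp
  have ig: "integrable (lebesgue_on S) (\<lambda>x. indicator (cbox l u) x * g x)"
  proof -
    have "integrable (lebesgue_on (cbox l u)) g" using g lu by (auto simp: locally_integrable_on_def)
    then have "integrable lebesgue (\<lambda>x. indicator (cbox l u) x *\<^sub>R g x)"
      by (subst (asm) integrable_restrict_space) auto
    moreover have "(\<lambda>x. indicator (cbox l u) x *\<^sub>R g x) = (\<lambda>x. indicator S x *\<^sub>R (indicator (cbox l u) x * g x))"
      using lu by (auto simp: fun_eq_iff indicator_def)
    ultimately have "integrable lebesgue (\<lambda>x. indicator S x *\<^sub>R (indicator (cbox l u) x * g x))"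
      by (simp only:)
    then show ?thesis using Sm by (subst integrable_restrict_space) auto
  qed
  have "(\<lambda>n. \<integral>x. (indicator (cbox l u) x * g x) * box_bump n l u x \<partial>lebesgue_on S) \<longlonglongrightarrow>
      (\<integral>x. (indicator (cbox l u) x * g x) * indicator (box l u) x \<partial>lebesgue_on S)"
  proof (rule integral_dominated_convergence[where w = "\<lambda>x. \<bar>indicator (cbox l u) x * g x\<bar>"])
    show "(\<lambda>x. indicator (cbox l u) x * g x * indicator (box l u) x) \<in> borel_measurable (lebesgue_on S)"
      using Sm lu box_subset_cbox[of l u]
      by (intro borel_measurable_times[OF borel_measurable_integrable[OF ig] borel_measurable_indicator])
         (auto simp: sets_restrict_space_iff)
    show "(\<lambda>x. indicator (cbox l u) x * g x * box_bump n l u x) \<in> borel_measurable (lebesgue_on S)" for n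
      by (intro borel_measurable_times[OF borel_measurable_integrable[OF ig]]
          continuous_imp_borel_measurable_lebesgue_on smooth_imp_continuous_on smooth_box_bump)
    show "integrable (lebesgue_on S) (\<lambda>x. \<bar>indicator (cbox l u) x * g x\<bar>)"
      using ig by (rule integrable_abs)
    show "AE x in lebesgue_on S. (\<lambda>n. indicator (cbox l u) x * g x * box_bump n l u x)
        \<longlonglongrightarrow> indicator (cbox l u) x * g x * indicator (box l u) x"
      by (intro always_eventually allI tendsto_mult tendsto_const box_bump_tendsto)
    show "AE x in lebesgue_on S. norm (indicator (cbox l u) x * g x * box_bump n l u x)
        \<le> \<bar>indicator (cbox l u) x * g x\<bar>" for n
      using mult_left_mono[OF box_bump_bounds(2), of "\<bar>indicator (cbox l u) x * g x\<bar>" n l u x for x]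
      by (intro always_eventually allI) (simp add: abs_mult box_bump_bounds)
  qed
  moreover have "(\<integral>x. (indicator (cbox l u) x * g x) * box_bump n l u x \<partial>lebesgue_on S) = 0" for n
  proof -
    have "(\<lambda>x. (indicator (cbox l u) x * g x) * box_bump n l u x) = (\<lambda>x. g x * box_bump n l u x)"
      using box_bump_eq_0[of _ l u n] box_subset_cbox[of l u] by (auto simp: fun_eq_iff indicator_def)
    then show ?thesis using 0[OF test_function_box_bump[OF lu]] by simp
  qed
  ultimately have "(\<integral>x. (indicator (cbox l u) x * g x) * indicator (box l u) x \<partial>lebesgue_on S) = 0"
    by (simp add: LIMSEQ_const_iff)
  moreover have "(\<lambda>x. (indicator (cbox l u) x * g x) * indicator (box l u) x) = (\<lambda>x. indicator (box l u) x * g x)"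
    using box_subset_cbox[of l u] by (auto simp: fun_eq_iff indicator_def)
  ultimately show ?thesis by simp
qed

text \<open>Open boxes form an intersection-stable generator of the Borel sets, so the integral of
  the function over every Borel set vanishes. The hypothesis on the whole space is needed to pass to
  complements.\<close>

lemma AE_eq_0_if_integral_box_eq_0:
  fixes g :: "'a::euclidean_space \<Rightarrow> real"
  assumes g: "integrable lebesgue g"
    and box: "\<And>l u. (\<integral>x. indicator (box l u) x * g x \<partial>lebesgue) = 0"
    and all: "(\<integral>x. g x \<partial>lebesgue) = 0"
  shows "AE x in lebesgue. g x = 0"
proof -
  obtain g' where g': "g' \<in> borel_measurable lborel" "AE x in lborel. g x = g' x"
    using completion_ex_borel_measurable_real[of g lborel] g by auto
  have ae: "AE x in lebesgue. g x = g' x" using AE_completion[OF g'(2)] .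
  have "integrable lebesgue g'"
    by (rule integrable_cong_AE_imp[OF g measurable_completion[OF g'(1)] ae])
  then have ig': "integrable lborel g'" using g'(1) by (simp add: integrable_completion)
  have conv: "(\<integral>x. indicator A x * g' x \<partial>lborel) = (\<integral>x. indicator A x * g x \<partial>lebesgue)" if A: "A \<in> sets borel" for A
  proof -
    have "(\<integral>x. indicator A x * g' x \<partial>lborel) = (\<integral>x. indicator A x * g' x \<partial>lebesgue)"
      using A g'(1) by (subst integral_completion) auto
    also have "\<dots> = (\<integral>x. indicator A x * g x \<partial>lebesgue)"
    proof (rule integral_cong_AE)
      show "(\<lambda>x. indicator A x * g' x) \<in> borel_measurable lebesgue"
        using A g'(1) by (intro measurable_completion) auto
      show "(\<lambda>x. indicator A x * g x) \<in> borel_measurable lebesgue"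
        using A g by (intro borel_measurable_times borel_measurable_indicator) auto
      show "AE x in lebesgue. indicator A x * g' x = indicator A x * g x"
        using ae by eventually_elim simp
    qed
    finally show ?thesis .
  qed
  have "(\<integral>x. indicator A x * g' x \<partial>lborel) = 0" if A: "A \<in> sets borel" for A
  proof -
    have "Int_stable (range (\<lambda>(a, b). box a b :: 'a set))"
      by (auto simp: Int_stable_def box_Int_box)
    moreover have "range (\<lambda>(a, b). box a b :: 'a set) \<subseteq> Pow UNIV" by simp
    moreover have "A \<in> sigma_sets UNIV (range (\<lambda>(a, b). box a b :: 'a set))" using A by (simp add: borel_eq_box)
    ultimately show ?thesis
    proof (induction rule: sigma_sets_induct_disjoint)
      case (basic A)
      then show ?case using box conv by auto
    next
      case (compl A)
      then have A: "A \<in> sets borel" by (simp add: borel_eq_box)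
      have "(\<integral>x. indicator (UNIV - A) x * g' x \<partial>lborel) = (\<integral>x. g' x - indicator A x * g' x \<partial>lborel)"
        by (intro Bochner_Integration.integral_cong) (auto simp: indicator_def)
      also have "\<dots> = (\<integral>x. g' x \<partial>lborel) - (\<integral>x. indicator A x * g' x \<partial>lborel)"
        using integrable_mult_indicator[OF _ ig', of A] A ig' by (intro Bochner_Integration.integral_diff) auto
      also have "\<dots> = 0" using compl conv[of UNIV] all by simp
      finally show ?case .
    next
      case (union A)
      then have A: "\<And>i. A i \<in> sets borel" by (auto simp: borel_eq_box)
      have "(LINT x:(\<Union>i. A i)|lborel. g' x) = (\<Sum>i. (LINT x:(A i)|lborel. g' x))"
      proof (rule lebesgue_integral_countable_add)
        show "set_integrable lborel (\<Union>i. A i) g'"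
          unfolding set_integrable_def by (rule integrable_mult_indicator[OF _ ig']) (use A in auto)
      qed (use A union in \<open>auto simp: disjoint_family_on_def\<close>)
      then show ?case using union by (simp add: set_lebesgue_integral_def)
    qed auto
  qed
  then have "AE x in lborel. g' x = 0"
    by (intro sigma_finite_measure.density_zero[OF lborel.sigma_finite_measure_axioms ig']) (simp add: set_lebesgue_integral_def)
  then have "AE x in lebesgue. g' x = 0" by (rule AE_completion)
  with ae show ?thesis by eventually_elim simp
qed

text \<open>An open set is a countable union of closed boxes with rational corners. On each of
  them the function, cut off to the interior of the box, is integrable and has vanishing integral over
  all boxes.\<close>

lemma fundamental_lemma_of_variations:
  assumes S: "open S" and g: "locally_integrable_on g S"
    and 0: "\<And>\<psi>. test_function S \<psi> \<Longrightarrow> (\<integral>x. g x * \<psi> x \<partial>lebesgue_on S) = 0"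
  shows "AE x in lebesgue_on S. g x = 0"
proof -
  have Sm: "S \<in> sets lebesgue" using S by simp
  have cb: "AE x in lebesgue. x \<in> cbox a b \<longrightarrow> g x = 0" if ab: "cbox a b \<subseteq> S" for a b
  proof -
    define f where "f = (\<lambda>x. indicator (box a b) x * g x)"
    have "integrable (lebesgue_on (cbox a b)) g" using g ab by (auto simp: locally_integrable_on_def)
    then have "integrable lebesgue (\<lambda>x. indicator (cbox a b) x *\<^sub>R g x)"
      by (subst (asm) integrable_restrict_space) auto
    from integrable_mult_indicator[OF _ this, of "box a b"]
    have "integrable lebesgue (\<lambda>x. indicator (box a b) x *\<^sub>R (indicator (cbox a b) x *\<^sub>R g x))" by simp
    moreover have "(\<lambda>x. indicator (box a b) x *\<^sub>R (indicator (cbox a b) x *\<^sub>R g x)) = f"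
      using box_subset_cbox[of a b] by (auto simp: fun_eq_iff indicator_def f_def)
    ultimately have f: "integrable lebesgue f" by simp
    have z: "(\<integral>x. indicator (box l u) x * g x \<partial>lebesgue) = 0" if "box l u = {} \<or> cbox l u \<subseteq> S" for l u
    proof (cases "box l u = {}")
      case False
      then have lu: "cbox l u \<subseteq> S" using that by auto
      have bS: "box l u \<subseteq> S" using lu box_subset_cbox[of l u] by blast
      have "(\<lambda>x. indicator S x *\<^sub>R (indicator (box l u) x * g x)) = (\<lambda>x. indicator (box l u) x * g x)"
        by (auto simp: fun_eq_iff indicator_def dest: subsetD[OF bS])
      then have "(\<integral>x. indicator (box l u) x * g x \<partial>lebesgue) = (\<integral>x. indicator (box l u) x * g x \<partial>lebesgue_on S)"
        using Sm by (subst integral_restrict_space) simp_all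
      then show ?thesis using integral_box_eq_0_if_test_eq_0[OF S g 0 lu] by simp
    qed simp
    have "AE x in lebesgue. f x = 0"
    proof (rule AE_eq_0_if_integral_box_eq_0[OF f])
      show "(\<integral>x. f x \<partial>lebesgue) = 0" using z[of a b] ab by (simp add: f_def)
      fix l u :: 'a
      obtain c d where cd: "box l u \<inter> box a b = box c d" using box_Int_box by blast
      have "cbox c d \<subseteq> S" if "box c d \<noteq> {}"
      proof -
        have "cbox c d = closure (box c d)" using that by (simp add: closure_box)
        also have "\<dots> \<subseteq> closure (cbox a b)" using cd box_subset_cbox by (intro closure_mono) blast
        finally show ?thesis using ab by simp
      qed
      then have "(\<integral>x. indicator (box c d) x * g x \<partial>lebesgue) = 0" using z by blast
      moreover have "(\<lambda>x. indicator (box l u) x * f x) = (\<lambda>x. indicator (box c d) x * g x)"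
        unfolding cd[symmetric] by (auto simp: fun_eq_iff f_def indicator_def)
      ultimately show "(\<integral>x. indicator (box l u) x * f x \<partial>lebesgue) = 0" by simp
    qed
    moreover have "AE x in lebesgue. x \<notin> cbox a b - box a b"
      using negligible_frontier_interval[of a b] by (intro AE_not_in) (simp add: negligible_iff_null_sets)
    ultimately show ?thesis by eventually_elim (auto simp: f_def indicator_def split: if_splits)
  qed
  \<comment> \<open>Multi-indices of the closed boxes with rational corners inside \<open>S\<close>.\<close>
  define I where "I = {f\<in>(Basis :: 'a set) \<rightarrow>\<^sub>E \<rat> \<times> \<rat>. cbox (\<Sum>i\<in>Basis. fst (f i) *\<^sub>R i) (\<Sum>i\<in>Basis. snd (f i) *\<^sub>R i) \<subseteq> S}"
  have SU: "S = (\<Union>f\<in>I. cbox (\<Sum>i\<in>Basis. fst (f i) *\<^sub>R i) (\<Sum>i\<in>Basis. snd (f i) *\<^sub>R i))"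
    unfolding I_def using open_UNION_cbox[OF S] by simp
  have "countable I"
    unfolding I_def by (rule countable_subset[OF _ countable_PiE[of Basis "\<lambda>_. \<rat> \<times> \<rat>"]]) (auto simp: countable_rat)
  then have "AE x in lebesgue. \<forall>f\<in>I. x \<in> cbox (\<Sum>i\<in>Basis. fst (f i) *\<^sub>R i) (\<Sum>i\<in>Basis. snd (f i) *\<^sub>R i) \<longrightarrow> g x = 0"
    by (intro AE_ball_countable' cb) (auto simp: I_def)
  then have "AE x in lebesgue. x \<in> S \<longrightarrow> g x = 0"
    by eventually_elim (use SU in blast)
  then show ?thesis using Sm by (simp add: AE_restrict_space_iff)
qed

lemma has_weak_deriv_unique:
  assumes "open S" "b \<in> Basis" "has_weak_deriv S b f g" "has_weak_deriv S b f g'"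
  shows "AE x in lebesgue_on S. g x = g' x"
proof -
  have Sm: "S \<in> sets lebesgue" using assms(1) by simp
  note d = has_weak_deriv_lincomb[OF assms(3,4,2) Sm, of "-1"]
  have "AE x in lebesgue_on S. g x + (-1) * g' x = 0"
  proof (rule fundamental_lemma_of_variations[OF assms(1)])
    show "locally_integrable_on (\<lambda>x. g x + (-1) * g' x) S" using d by (auto simp: has_weak_deriv_def)
    fix \<psi> assume "test_function S \<psi>"
    then show "(\<integral>x. (g x + (-1) * g' x) * \<psi> x \<partial>lebesgue_on S) = 0"
      using d by (auto simp: has_weak_deriv_def)
  qed
  then show ?thesis by eventually_elim simp
qed

lemma has_weak_grad_unique:
  assumes "open S" "has_weak_grad S f g" "has_weak_grad S f g'"
  shows "AE x in lebesgue_on S. g x = g' x"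
proof -
  have "AE x in lebesgue_on S. \<forall>b\<in>Basis. g x \<bullet> b = g' x \<bullet> b"
    using assms by (intro AE_finite_allI has_weak_deriv_unique[OF assms(1)]) (auto simp: has_weak_grad_def)
  then show ?thesis by eventually_elim (blast intro: euclidean_eqI)
qed

lemma has_weak_grad_lincomb:
  assumes "has_weak_grad S f f'" "has_weak_grad S g g'" "S \<in> sets lebesgue"
  shows "has_weak_grad S (\<lambda>x. f x + c * g x) (\<lambda>x. f' x + c *\<^sub>R g' x)"
  using assms by (auto simp: has_weak_grad_def inner_left_distrib intro!: has_weak_deriv_lincomb)

lemma locally_integrable_on_cong_AE:
  assumes S: "S \<in> sets lebesgue" and ae: "AE x in lebesgue_on S. f x = f' x" and f: "locally_integrable_on f S"
  shows "locally_integrable_on f' S"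
  unfolding locally_integrable_on_def
proof (intro allI impI)
  fix K assume K: "compact K \<and> K \<subseteq> S"
  then have Km: "K \<in> sets lebesgue" by (simp add: compact_imp_closed)
  have ae: "AE x in lebesgue_on K. f x = f' x"
  proof -
    have "AE x in lebesgue. x \<in> S \<longrightarrow> f x = f' x" using ae S by (simp add: AE_restrict_space_iff)
    then have "AE x in lebesgue. x \<in> K \<longrightarrow> f x = f' x" by eventually_elim (use K in auto)
    then show ?thesis using Km by (simp add: AE_restrict_space_iff)
  qed
  have f: "integrable (lebesgue_on K) f" using f K by (simp add: locally_integrable_on_def)
  have "f' \<in> borel_measurable (lebesgue_on K)"
    by (rule borel_measurable_lebesgue_on_cong_AE[OF Km _ ae]) (use f in auto)
  then show "integrable (lebesgue_on K) f'"
    by (rule integrable_cong_AE_imp[OF f _ ae])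
qed

lemma has_weak_grad_cong_AE:
  assumes S: "S \<in> sets lebesgue" and ae: "AE x in lebesgue_on S. f x = f' x" and g: "has_weak_grad S f g"
  shows "has_weak_grad S f' g"
  unfolding has_weak_grad_def has_weak_deriv_def
proof (intro ballI conjI allI impI)
  fix b :: 'a assume b: "b \<in> Basis"
  with g have w: "has_weak_deriv S b f (\<lambda>x. g x \<bullet> b)" by (simp add: has_weak_grad_def)
  show l: "locally_integrable_on f' S"
    using locally_integrable_on_cong_AE[OF S ae] w by (auto simp: has_weak_deriv_def)
  show "locally_integrable_on (\<lambda>x. g x \<bullet> b) S" using w by (auto simp: has_weak_deriv_def)
  fix \<psi> assume t: "test_function S \<psi>"
  note t' = test_function_partial[OF t b]
  have "(\<integral>x. f' x * frechet_derivative \<psi> (at x) b \<partial>lebesgue_on S) =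
      (\<integral>x. f x * frechet_derivative \<psi> (at x) b \<partial>lebesgue_on S)"
    using locally_integrable_mult_test[OF l t' S] locally_integrable_mult_test[OF _ t' S, of f] w ae
    by (intro integral_cong_AE) (auto simp: has_weak_deriv_def)
  then show "(\<integral>x. f' x * frechet_derivative \<psi> (at x) b \<partial>lebesgue_on S) =
      - (\<integral>x. (g x \<bullet> b) * \<psi> x \<partial>lebesgue_on S)"
    using w t by (simp add: has_weak_deriv_def)
qed

section \<open>Classical gradients are weak gradients\<close>

lemma has_derivative_along_line:
  assumes "(G has_derivative G') (at (x + t *\<^sub>R b))"
  shows "((\<lambda>t. G (x + t *\<^sub>R b)) has_real_derivative G' b) (at t)"
proof -
  have "((\<lambda>t. x + t *\<^sub>R b) has_derivative (\<lambda>h. h *\<^sub>R b)) (at t)"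
    by (auto intro!: derivative_eq_intros)
  from has_derivative_compose[OF this assms]
  have "((\<lambda>t. G (x + t *\<^sub>R b)) has_derivative (\<lambda>h. G' (h *\<^sub>R b))) (at t)" .
  moreover have "G' (h *\<^sub>R b) = h * G' b" for h
    using assms by (simp add: has_derivative_def bounded_linear.linear linear_cmul)
  ultimately show ?thesis by (simp add: has_field_derivative_def mult.commute[of _ "G' b"])
qed

text \<open>By translation invariance the difference quotients in direction \<open>b\<close> have integral 0.
  They are bounded by the maximum of the derivative and vanish off a fixed ball, so dominated
  convergence applies.\<close>

lemma integral_partial_eq_0:
  fixes G :: "'a::euclidean_space \<Rightarrow> real"
  assumes d: "\<And>x. (G has_derivative G' x) (at x)" and c: "continuous_on UNIV (\<lambda>x. G' x b)"
    and K: "compact K" "\<And>x. x \<notin> K \<Longrightarrow> G x = 0"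
  shows "(\<integral>x. G' x b \<partial>lborel) = 0"
proof -
  have G'0: "G' x b = 0" if "x \<notin> K" for x
  proof -
    have "((\<lambda>x. 0) has_derivative (\<lambda>h. 0)) (at x)" by simp
    then have "(G has_derivative (\<lambda>h. 0)) (at x)"
      by (rule has_derivative_transform_within_open[of _ _ _ _ "- K"])
         (use that K in \<open>auto simp: compact_imp_closed\<close>)
    then show ?thesis using has_derivative_unique[OF d] by metis
  qed
  have Gc: "continuous_on S G" for S
    using d has_derivative_continuous continuous_at_imp_continuous_on by metis
  have "compact ((\<lambda>x. G' x b) ` K)"
    using K(1) c by (intro compact_continuous_image) (auto intro: continuous_on_subset)
  then obtain B0 where "\<And>x. x \<in> K \<Longrightarrow> \<bar>G' x b\<bar> \<le> B0"
    using compact_imp_bounded bounded_iff by (metis imageI real_norm_def)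
  with G'0 have B: "\<bar>G' x b\<bar> \<le> max B0 0" for x by (cases "x \<in> K") (auto simp: le_max_iff_disj)
  obtain R where "\<forall>x\<in>K. norm x \<le> R" using K(1) compact_imp_bounded bounded_iff by blast
  then have R: "K \<subseteq> cball 0 R" by auto
  define t where "t n = inverse (real (Suc n))" for n
  have t: "0 < t n" "t n \<le> 1" for n by (auto simp: t_def field_simps)
  have t0: "t \<longlonglongrightarrow> 0" unfolding t_def by (rule LIMSEQ_inverse_real_of_nat)
  define q where "q n x = (G (x + t n *\<^sub>R b) - G x) / t n" for n x
  have iG: "integrable lborel G"
  proof -
    have "integrable lborel (\<lambda>x. indicator K x *\<^sub>R G x)" by (rule borel_integrable_compact[OF K(1) Gc])
    moreover have "(\<lambda>x. indicator K x *\<^sub>R G x) = G" using K(2) by (auto simp: fun_eq_iff indicator_def)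
    ultimately show ?thesis by simp
  qed
  have Gm: "G \<in> borel_measurable borel" using Gc by (rule borel_measurable_continuous_onI)
  have tr: "integrable lborel (\<lambda>x. G (x + c))" "(\<integral>x. G (x + c) \<partial>lborel) = (\<integral>x. G x \<partial>lborel)" for c
  proof -
    have "integrable (distr lborel borel ((+) c)) G" using iG by (simp add: lborel_distr_plus)
    then show "integrable lborel (\<lambda>x. G (x + c))"
      by (subst (asm) integrable_distr_eq) (auto simp: add.commute Gm)
    have "(\<integral>x. G x \<partial>(distr lborel borel ((+) c))) = (\<integral>x. G (x + c) \<partial>lborel)"
      by (subst integral_distr) (auto simp: add.commute Gm)
    then show "(\<integral>x. G (x + c) \<partial>lborel) = (\<integral>x. G x \<partial>lborel)" by (simp add: lborel_distr_plus)
  qed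
  have q0: "(\<integral>x. q n x \<partial>lborel) = 0" for n
    unfolding q_def using tr iG by simp
  have "(\<lambda>n. \<integral>x. q n x \<partial>lborel) \<longlonglongrightarrow> (\<integral>x. G' x b \<partial>lborel)"
  proof (rule integral_dominated_convergence[where w = "\<lambda>x. indicator (cball 0 (R + norm b)) x *\<^sub>R max B0 0"])
    show "(\<lambda>x. G' x b) \<in> borel_measurable lborel" using c by (simp add: borel_measurable_continuous_onI)
    show "q n \<in> borel_measurable lborel" for n
      unfolding q_def using tr(1) iG by (intro borel_measurable_integrable) auto
    show "integrable lborel (\<lambda>x. indicator (cball (0::'a) (R + norm b)) x *\<^sub>R max B0 0)"
      by (intro borel_integrable_compact) auto
    show "AE x in lborel. (\<lambda>n. q n x) \<longlonglongrightarrow> G' x b"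
    proof (intro always_eventually allI)
      fix x
      have "((\<lambda>s. G (x + s *\<^sub>R b)) has_real_derivative G' x b) (at 0)"
        by (rule has_derivative_along_line) (simp add: d)
      then have "((\<lambda>h. (G (x + h *\<^sub>R b) - G x) / h) \<longlongrightarrow> G' x b) (at 0)"
        by (simp add: DERIV_def)
      moreover have "filterlim t (at 0) sequentially"
        by (rule filterlim_atI[OF t0]) (simp add: t_def)
      ultimately show "(\<lambda>n. q n x) \<longlonglongrightarrow> G' x b"
        unfolding q_def by (rule filterlim_compose)
    qed
    show "AE x in lborel. norm (q n x) \<le> indicator (cball 0 (R + norm b)) x *\<^sub>R max B0 0" for n
    proof (intro always_eventually allI)
      fix x
      show "norm (q n x) \<le> indicator (cball 0 (R + norm b)) x *\<^sub>R max B0 0"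
      proof (cases "x \<in> cball 0 (R + norm b)")
        case True
        have "\<exists>z. 0 < z \<and> z < t n \<and>
            G (x + t n *\<^sub>R b) - G (x + 0 *\<^sub>R b) = (t n - 0) * G' (x + z *\<^sub>R b) b"
          by (rule MVT2[OF t(1)[of n]]) (rule has_derivative_along_line[OF d])
        then obtain z where "G (x + t n *\<^sub>R b) - G (x + 0 *\<^sub>R b) = (t n - 0) * G' (x + z *\<^sub>R b) b"
          by blast
        then have "q n x = G' (x + z *\<^sub>R b) b" using t(1)[of n] by (simp add: q_def)
        then show ?thesis using B True by simp
      next
        case False
        then have far: "R + norm b < norm x" by simp
        have "norm (t n *\<^sub>R b) \<le> norm b" using t[of n] by (simp add: mult_left_le_one_le)
        then have "norm (x + t n *\<^sub>R b) > R"
          using far norm_triangle_ineq4[of "x + t n *\<^sub>R b" "t n *\<^sub>R b"] by simp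
        then have "x + t n *\<^sub>R b \<notin> K" using R by auto
        moreover have "norm x > R" using far norm_ge_zero[of b] by linarith
        then have "x \<notin> K" using R by auto
        ultimately show ?thesis using K(2) by (simp add: q_def)
      qed
    qed
  qed
  then show ?thesis using q0 by (simp add: LIMSEQ_const_iff)
qed

lemma continuous_imp_integrable_on_compact:
  fixes f :: "'a::euclidean_space \<Rightarrow> real"
  assumes "continuous_on UNIV f" "compact K"
  shows "integrable (lebesgue_on K) f"
proof -
  have "integrable lborel (\<lambda>x. indicator K x *\<^sub>R f x)"
    using assms by (intro borel_integrable_compact) (auto intro: continuous_on_subset)
  then have "integrable lebesgue (\<lambda>x. indicator K x *\<^sub>R f x)"
    by (subst integrable_completion) auto
  then show ?thesis using assms by (subst integrable_restrict_space) (auto simp: compact_imp_closed)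
qed

text \<open>The gradient in the classical sense, which for smooth functions represents the weak one.\<close>

definition cgrad :: "('a::euclidean_space \<Rightarrow> real) \<Rightarrow> 'a \<Rightarrow> 'a" where
  "cgrad f x = (\<Sum>b\<in>Basis. frechet_derivative f (at x) b *\<^sub>R b)"

lemma cgrad_inner: "b \<in> Basis \<Longrightarrow> cgrad f x \<bullet> b = frechet_derivative f (at x) b"
  by (simp add: cgrad_def inner_sum_left inner_Basis if_distrib cong: if_cong)

lemma cgrad_continuous_on: "smooth f \<Longrightarrow> continuous_on S (cgrad f)"
  unfolding cgrad_def by (intro continuous_intros smooth_partial_continuous_on)

text \<open>The product \<open>f \<psi>\<close> has compact support, so the integral of its derivative is 0.\<close>

lemma smooth_has_weak_grad:
  fixes f :: "'a::euclidean_space \<Rightarrow> real"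
  assumes f: "smooth f" and S: "S \<in> sets lebesgue"
  shows "has_weak_grad S f (cgrad f)"
  unfolding has_weak_grad_def has_weak_deriv_def
proof (intro ballI conjI allI impI)
  fix b :: 'a assume b: "b \<in> Basis"
  let ?f' = "\<lambda>x. frechet_derivative f (at x) b"
  have cf': "continuous_on UNIV ?f'" using smooth_partial_continuous_on[OF f b] .
  show lf: "locally_integrable_on f S"
    unfolding locally_integrable_on_def
    using continuous_imp_integrable_on_compact smooth_imp_continuous_on[OF f] by blast
  show lf'': "locally_integrable_on (\<lambda>x. cgrad f x \<bullet> b) S"
    unfolding locally_integrable_on_def cgrad_inner[OF b]
    using continuous_imp_integrable_on_compact cf' by blast
  then have lf': "locally_integrable_on ?f' S" by (simp add: cgrad_inner[OF b])
  fix \<psi> assume t: "test_function S \<psi>"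
  note t' = test_function_partial[OF t b]
  let ?p' = "\<lambda>x. frechet_derivative \<psi> (at x) b"
  note sm = test_function_smooth[OF t]
  obtain K where K: "compact K" "K \<subseteq> S" "\<And>x. x \<notin> K \<Longrightarrow> \<psi> x = 0"
    using t by (auto simp: test_function_def)
  obtain K' where K': "K' \<subseteq> S" "\<And>x. x \<notin> K' \<Longrightarrow> ?p' x = 0"
    using t' by (auto simp: test_function_def)
  have cF: "continuous_on UNIV (\<lambda>x. f x * ?p' x + ?f' x * \<psi> x)"
    by (intro continuous_intros smooth_imp_continuous_on f sm cf' smooth_partial_continuous_on b)
  have "(\<integral>x. f x * ?p' x + ?f' x * \<psi> x \<partial>lborel) = 0"
  proof (rule integral_partial_eq_0[of "\<lambda>x. f x * \<psi> x" "\<lambda>x h. f x * frechet_derivative \<psi> (at x) h + frechet_derivative f (at x) h * \<psi> x" b K])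
    show "((\<lambda>x. f x * \<psi> x) has_derivative (\<lambda>h. f x * frechet_derivative \<psi> (at x) h + frechet_derivative f (at x) h * \<psi> x)) (at x)" for x
      by (rule has_derivative_mult[OF smooth_has_derivative[OF f] smooth_has_derivative[OF sm]])
  qed (use K cF in auto)
  then have "(\<integral>x. f x * ?p' x + ?f' x * \<psi> x \<partial>lebesgue) = 0"
    using cF by (subst integral_completion) (auto intro: borel_measurable_continuous_onI)
  moreover have "(\<lambda>x. indicator S x *\<^sub>R (f x * ?p' x + ?f' x * \<psi> x)) = (\<lambda>x. f x * ?p' x + ?f' x * \<psi> x)"
  proof
    fix x
    have "x \<in> S" if "\<psi> x \<noteq> 0 \<or> ?p' x \<noteq> 0" using that K(2,3) K' by blast
    then show "indicator S x *\<^sub>R (f x * ?p' x + ?f' x * \<psi> x) = f x * ?p' x + ?f' x * \<psi> x"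
      by (cases "x \<in> S"; cases "\<psi> x = 0"; cases "?p' x = 0") auto
  qed
  ultimately have "(\<integral>x. f x * ?p' x + ?f' x * \<psi> x \<partial>lebesgue_on S) = 0"
    using S by (subst integral_restrict_space) simp_all
  then show "(\<integral>x. f x * ?p' x \<partial>lebesgue_on S) = - (\<integral>x. (cgrad f x \<bullet> b) * \<psi> x \<partial>lebesgue_on S)"
    using locally_integrable_mult_test[OF lf t' S] locally_integrable_mult_test[OF lf' t S]
    by (simp add: cgrad_inner[OF b])
qed

section \<open>Square integrable functions\<close>

lemma L2_iff: "f \<in> L2 M \<longleftrightarrow> f \<in> borel_measurable M \<and> integrable M (\<lambda>x. (norm (f x))\<^sup>2)"
  by (simp add: L2_def)

lemma L2_measurable: "f \<in> L2 M \<Longrightarrow> f \<in> borel_measurable M"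
  by (simp add: L2_def)

lemma L2_integrable_inner:
  assumes "f \<in> L2 M" "g \<in> L2 M" shows "integrable M (\<lambda>x. f x \<bullet> g x)"
proof (rule Bochner_Integration.integrable_bound)
  show "integrable M (\<lambda>x. (norm (f x))\<^sup>2 + (norm (g x))\<^sup>2)" using assms by (auto simp: L2_def)
  show "(\<lambda>x. f x \<bullet> g x) \<in> borel_measurable M" using assms by (auto simp: L2_def)
  show "AE x in M. norm (f x \<bullet> g x) \<le> norm ((norm (f x))\<^sup>2 + (norm (g x))\<^sup>2)"
  proof (intro always_eventually allI)
    fix x
    have "\<bar>f x \<bullet> g x\<bar> \<le> norm (f x) * norm (g x)" by (rule Cauchy_Schwarz_ineq2)
    also have "\<dots> \<le> (norm (f x))\<^sup>2 + (norm (g x))\<^sup>2"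
      using sum_squares_bound[of "norm (f x)" "norm (g x)"] mult_nonneg_nonneg[OF norm_ge_zero[of "f x"] norm_ge_zero[of "g x"]]
      by linarith
    finally show "norm (f x \<bullet> g x) \<le> norm ((norm (f x))\<^sup>2 + (norm (g x))\<^sup>2)" by simp
  qed
qed

lemma L2_lincomb:
  assumes "f \<in> L2 M" "g \<in> L2 M" shows "(\<lambda>x. f x + c *\<^sub>R g x) \<in> L2 M"
proof -
  have "(norm (f x + c *\<^sub>R g x))\<^sup>2 = (norm (f x))\<^sup>2 + 2 * c * (f x \<bullet> g x) + c\<^sup>2 * (norm (g x))\<^sup>2" for x
    unfolding power2_norm_eq_inner by (simp add: inner_simps inner_commute algebra_simps power2_eq_square)
  then show ?thesis using assms L2_integrable_inner[OF assms] by (auto simp: L2_iff)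
qed

lemma L2_diff: "f \<in> L2 M \<Longrightarrow> g \<in> L2 M \<Longrightarrow> (\<lambda>x. f x - g x) \<in> L2 M"
  using L2_lincomb[of f M g "-1"] by simp

lemma L2_add: "f \<in> L2 M \<Longrightarrow> g \<in> L2 M \<Longrightarrow> (\<lambda>x. f x + g x) \<in> L2 M"
  using L2_lincomb[of f M g 1] by simp

lemma L2_cmult: "f \<in> L2 M \<Longrightarrow> (\<lambda>x. c * f x) \<in> L2 M" for f :: "'a \<Rightarrow> real"
  by (auto simp: L2_iff power_mult_distrib)

lemma L2_norm_nonneg [simp]: "0 \<le> L2_norm M f"
  by (simp add: L2_norm_def)

lemma L2_norm_power2: "(L2_norm M f)\<^sup>2 = L2_inner M f f"
  by (simp add: L2_norm_def L2_inner_def power2_norm_eq_inner)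

lemma L2_inner_commute: "L2_inner M f g = L2_inner M g f"
  by (simp add: L2_inner_def inner_commute)

lemma L2_inner_lincomb_left:
  "f \<in> L2 M \<Longrightarrow> g \<in> L2 M \<Longrightarrow> p \<in> L2 M \<Longrightarrow>
    L2_inner M (\<lambda>x. f x + c *\<^sub>R g x) p = L2_inner M f p + c * L2_inner M g p"
  unfolding L2_inner_def by (simp add: inner_left_distrib L2_integrable_inner)

lemma L2_inner_lincomb_right:
  assumes "f \<in> L2 M" "g \<in> L2 M" "p \<in> L2 M"
  shows "L2_inner M p (\<lambda>x. f x + c *\<^sub>R g x) = L2_inner M p f + c * L2_inner M p g"
  unfolding L2_inner_commute[of M p "\<lambda>x. f x + c *\<^sub>R g x"] L2_inner_commute[of M p f]
    L2_inner_commute[of M p g]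
  by (rule L2_inner_lincomb_left[OF assms])

lemma L2_inner_add_left:
  "f \<in> L2 M \<Longrightarrow> g \<in> L2 M \<Longrightarrow> p \<in> L2 M \<Longrightarrow> L2_inner M (\<lambda>x. f x + g x) p = L2_inner M f p + L2_inner M g p"
  using L2_inner_lincomb_left[of f M g p 1] by simp

lemma L2_inner_diff_left:
  "f \<in> L2 M \<Longrightarrow> g \<in> L2 M \<Longrightarrow> p \<in> L2 M \<Longrightarrow> L2_inner M (\<lambda>x. f x - g x) p = L2_inner M f p - L2_inner M g p"
  using L2_inner_lincomb_left[of f M g p "-1"] by simp

lemma L2_inner_diff_right:
  "f \<in> L2 M \<Longrightarrow> g \<in> L2 M \<Longrightarrow> p \<in> L2 M \<Longrightarrow> L2_inner M p (\<lambda>x. f x - g x) = L2_inner M p f - L2_inner M p g"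
  using L2_inner_lincomb_right[of f M g p "-1"] by simp

lemma L2_norm_lincomb_power2:
  assumes "f \<in> L2 M" "g \<in> L2 M"
  shows "(L2_norm M (\<lambda>x. f x + c *\<^sub>R g x))\<^sup>2 = (L2_norm M f)\<^sup>2 + 2 * c * L2_inner M f g + c\<^sup>2 * (L2_norm M g)\<^sup>2"
proof -
  have "L2_inner M (\<lambda>x. f x + c *\<^sub>R g x) (\<lambda>x. f x + c *\<^sub>R g x) =
      (L2_inner M f f + c * L2_inner M f g) + c * (L2_inner M g f + c * L2_inner M g g)"
    unfolding L2_inner_lincomb_left[OF assms L2_lincomb[OF assms]]
      L2_inner_lincomb_right[OF assms assms(1)] L2_inner_lincomb_right[OF assms assms(2)] ..
  also have "\<dots> = L2_inner M f f + 2 * c * L2_inner M f g + c\<^sup>2 * L2_inner M g g"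
    unfolding L2_inner_commute[of M g f] by (simp add: power2_eq_square algebra_simps)
  finally show ?thesis unfolding L2_norm_power2 .
qed

text \<open>Minimise over \<open>s\<close>. The leading coefficient may vanish, because functions of norm 0 occur.\<close>

lemma nonneg_quadratic_discriminant:
  fixes a b c :: real
  assumes nn: "\<And>s. 0 \<le> a + 2 * s * b + s\<^sup>2 * c" and c: "0 \<le> c"
  shows "b\<^sup>2 \<le> a * c"
proof (cases "c = 0")
  case True
  have "b = 0"
  proof (rule ccontr)
    assume b: "b \<noteq> 0"
    have "2 * (- (a + 1) / (2 * b)) * b = - (a + 1)" using b by simp
    then show False using nn[of "- (a + 1) / (2 * b)"] True by simp
  qed
  then show ?thesis by (simp add: True)
next
  case False
  then have "c > 0" using c by simp
  have "0 \<le> a + 2 * (- b / c) * b + (- b / c)\<^sup>2 * c" by (rule nn)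
  also have "\<dots> = a - b\<^sup>2 / c" using \<open>c > 0\<close> by (simp add: power2_eq_square)
  finally show ?thesis using \<open>c > 0\<close> by (simp add: field_simps)
qed

lemma L2_Cauchy_Schwarz:
  assumes "f \<in> L2 M" "g \<in> L2 M"
  shows "\<bar>L2_inner M f g\<bar> \<le> L2_norm M f * L2_norm M g"
proof -
  have "(L2_inner M f g)\<^sup>2 \<le> (L2_norm M f)\<^sup>2 * (L2_norm M g)\<^sup>2"
  proof (rule nonneg_quadratic_discriminant)
    show "0 \<le> (L2_norm M f)\<^sup>2 + 2 * s * L2_inner M f g + s\<^sup>2 * (L2_norm M g)\<^sup>2" for s
      unfolding L2_norm_lincomb_power2[OF assms, of s, symmetric] by simp
  qed simp
  then have "\<bar>L2_inner M f g\<bar>\<^sup>2 \<le> (L2_norm M f * L2_norm M g)\<^sup>2" by (simp add: power_mult_distrib)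
  then show ?thesis by (rule power2_le_imp_le) simp
qed

lemma L2_norm_triangle:
  assumes "f \<in> L2 M" "g \<in> L2 M"
  shows "L2_norm M (\<lambda>x. f x + g x) \<le> L2_norm M f + L2_norm M g"
proof (rule power2_le_imp_le)
  show "(L2_norm M (\<lambda>x. f x + g x))\<^sup>2 \<le> (L2_norm M f + L2_norm M g)\<^sup>2"
    using L2_norm_lincomb_power2[OF assms, of 1] L2_Cauchy_Schwarz[OF assms] by (simp add: power2_sum)
qed simp

lemma L2_norm_scale: "L2_norm M (\<lambda>x. c *\<^sub>R f x) = \<bar>c\<bar> * L2_norm M f"
  by (simp add: L2_norm_def power_mult_distrib real_sqrt_mult)

lemma L2_norm_triangle_diff:
  assumes "f \<in> L2 M" "g \<in> L2 M" "h \<in> L2 M"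
  shows "L2_norm M (\<lambda>x. f x - h x) \<le> L2_norm M (\<lambda>x. f x - g x) + L2_norm M (\<lambda>x. g x - h x)"
  using L2_norm_triangle[OF L2_diff[OF assms(1,2)] L2_diff[OF assms(2,3)]] by simp

lemma L2_norm_minus_commute: "L2_norm M (\<lambda>x. f x - g x) = L2_norm M (\<lambda>x. g x - f x)"
  by (simp add: L2_norm_def norm_minus_commute)

lemma L2_norm_diff_bound:
  assumes "f \<in> L2 M" "g \<in> L2 M"
  shows "\<bar>L2_norm M f - L2_norm M g\<bar> \<le> L2_norm M (\<lambda>x. f x - g x)"
  using L2_norm_triangle[OF L2_diff[OF assms] assms(2)] L2_norm_triangle[OF L2_diff[OF assms(2,1)] assms(1)]
    L2_norm_minus_commute[of M f g] by simp

lemma borel_measurable_norm_power2: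
  "f \<in> borel_measurable M \<Longrightarrow> (\<lambda>x. (norm (f x))\<^sup>2) \<in> borel_measurable M"
  for f :: "'a \<Rightarrow> 'b::euclidean_space"
  by simp

lemma L2_norm_eq_0_imp_AE:
  assumes "f \<in> L2 M" "L2_norm M f = 0" shows "AE x in M. f x = 0"
proof -
  have "(\<integral>x. (norm (f x))\<^sup>2 \<partial>M) = 0" using assms by (simp add: L2_norm_def)
  then have "AE x in M. (norm (f x))\<^sup>2 = 0"
    using integral_nonneg_eq_0_iff_AE[of M "\<lambda>x. (norm (f x))\<^sup>2"] assms(1) by (simp add: L2_iff)
  then show ?thesis by eventually_elim simp
qed

lemma L2_norm_cong_AE:
  assumes "f \<in> borel_measurable M" "g \<in> borel_measurable M" "AE x in M. f x = g x"
  shows "L2_norm M f = L2_norm M g"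
proof -
  have "AE x in M. (norm (f x))\<^sup>2 = (norm (g x))\<^sup>2" using assms(3) by eventually_elim simp
  then have "(\<integral>x. (norm (f x))\<^sup>2 \<partial>M) = (\<integral>x. (norm (g x))\<^sup>2 \<partial>M)"
    by (rule integral_cong_AE[OF borel_measurable_norm_power2[OF assms(1)] borel_measurable_norm_power2[OF assms(2)]])
  then show ?thesis by (simp add: L2_norm_def)
qed

lemma L2_cong_AE:
  assumes "f \<in> L2 M" "g \<in> borel_measurable M" "AE x in M. f x = g x"
  shows "g \<in> L2 M"
proof -
  have ae: "AE x in M. (norm (f x))\<^sup>2 = (norm (g x))\<^sup>2" using assms(3) by eventually_elim simp
  have "integrable M (\<lambda>x. (norm (g x))\<^sup>2)"
    by (rule integrable_cong_AE_imp[OF _ borel_measurable_norm_power2[OF assms(2)] ae]) (use assms(1) in \<open>simp add: L2_iff\<close>)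
  then show ?thesis using assms by (simp add: L2_iff)
qed

lemma L2_inner_cong_AE:
  assumes "f \<in> L2 M" "g \<in> L2 M" "f' \<in> L2 M" "g' \<in> L2 M" "AE x in M. f x = f' x" "AE x in M. g x = g' x"
  shows "L2_inner M f g = L2_inner M f' g'"
proof -
  have "AE x in M. f x \<bullet> g x = f' x \<bullet> g' x" using assms(5,6) by eventually_elim simp
  then show ?thesis unfolding L2_inner_def
    by (intro integral_cong_AE borel_measurable_integrable L2_integrable_inner assms(1-4))
qed

section \<open>The Hausdorff measure of a graph\<close>

lemma sets_hausdorff_measure [simp, measurable_cong]: "sets (hausdorff_measure m) = sets borel"
  by (simp add: hausdorff_measure_def sets_measure_of_conv sets.sigma_sets_eq[of borel, simplified])

lemma space_hausdorff_measure [simp]: "space (hausdorff_measure m) = UNIV"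
  by (simp add: hausdorff_measure_def space_measure_of_conv)

text \<open>The measure obtained from a set function is that function if it is countably additive on
  the given sets, and 0 otherwise. The inequality covers both cases, and the trace inequality uses
  surface measure through upper bounds only.\<close>

lemma emeasure_hausdorff_le_outer: "emeasure (hausdorff_measure m) A \<le> hausdorff_outer m A"
  unfolding hausdorff_measure_def by (subst emeasure_measure_of_conv) auto

text \<open>The finite cover is padded with empty sets, which have weight 0.\<close>

lemma hausdorff_pre_finite_cover:
  fixes A :: "'a::euclidean_space set"
  assumes X: "finite X" "A \<subseteq> (\<Union>x\<in>X. cball x \<rho>)" and \<rho>: "0 < \<rho>" "2 * \<rho> \<le> \<delta>"
  shows "hausdorff_pre m \<delta> A \<le> ennreal (real (card X) * (unit_ball_vol (real m) * \<rho> ^ m))"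
proof -
  obtain h where h: "bij_betw h {0..<card X} X" using ex_bij_betw_nat_finite[OF X(1)] by blast
  define C where "C i = (if i < card X then cball (h i) \<rho> else {})" for i
  have AC: "A \<subseteq> (\<Union>i. C i)"
  proof
    fix a assume "a \<in> A"
    then obtain x where x: "x \<in> X" "a \<in> cball x \<rho>" using X(2) by blast
    then obtain i where "i < card X" "h i = x" using h by (auto simp: bij_betw_def image_iff) (metis atLeastLessThan_iff imageE)
    then show "a \<in> (\<Union>i. C i)" using x by (auto simp: C_def)
  qed
  have "hausdorff_pre m \<delta> A \<le> (\<Sum>i. hausdorff_weight m (C i))"
    unfolding hausdorff_pre_def by (rule INF_lower) (use AC \<rho> in \<open>auto simp: C_def\<close>)
  also have "\<dots> = (\<Sum>i\<in>{..<card X}. hausdorff_weight m (C i))"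
    by (rule suminf_finite) (auto simp: C_def hausdorff_weight_def)
  also have "\<dots> = (\<Sum>i\<in>{..<card X}. ennreal (unit_ball_vol (real m) * \<rho> ^ m))"
    using \<rho> by (intro sum.cong) (auto simp: C_def hausdorff_weight_def)
  also have "\<dots> = ennreal (real (card X) * (unit_ball_vol (real m) * \<rho> ^ m))"
    by (simp add: ennreal_mult' ennreal_of_nat_eq_real_of_nat)
  finally show ?thesis .
qed

text \<open>The balls of radius \<open>r\<close> around the points are disjoint and lie in a ball of radius
  \<open>R + r\<close>; compare volumes.\<close>

lemma card_packing_le:
  fixes P :: "'a::euclidean_space set"
  assumes P: "finite P" "\<And>x y. x \<in> P \<Longrightarrow> y \<in> P \<Longrightarrow> x \<noteq> y \<Longrightarrow> 2 * r \<le> dist x y" "P \<subseteq> cball z R"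
    and r: "0 < r" "0 \<le> R"
  shows "real (card P) * r ^ DIM('a) \<le> (R + r) ^ DIM('a)"
proof -
  let ?V = "measure lborel (ball (0::'a) 1)"
  have V: "?V > 0" by (simp add: content_ball_pos)
  have "real (card P) * (r ^ DIM('a) * ?V) = (\<Sum>x\<in>P. measure lborel (ball x r))"
    using r by (simp add: content_ball_conv_unit_ball[of r])
  also have "\<dots> = measure lborel (\<Union>x\<in>P. ball x r)"
  proof (rule measure_finite_Union[symmetric])
    show "disjoint_family_on (\<lambda>x. ball x r) P"
      unfolding disjoint_family_on_def
    proof (intro ballI impI)
      fix x y assume "x \<in> P" "y \<in> P" "x \<noteq> y"
      then have "2 * r \<le> dist x y" by (rule P(2))
      then show "ball x r \<inter> ball y r = {}"
        using dist_triangle_less_add[of x _ r y r] by (force simp: dist_commute)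
    qed
    show "emeasure lborel (ball x r) \<noteq> \<infinity>" for x
      using emeasure_bounded_finite[OF bounded_ball[of x r]] by simp
  qed (use P in auto)
  also have "\<dots> \<le> measure lborel (cball z (R + r))"
  proof (rule measure_mono_fmeasurable)
    show "(\<Union>x\<in>P. ball x r) \<subseteq> cball z (R + r)"
    proof
      fix y assume "y \<in> (\<Union>x\<in>P. ball x r)"
      then obtain x where "x \<in> P" "dist x y < r" by auto
      then have "dist z x \<le> R" using P(3) by auto
      then show "y \<in> cball z (R + r)" using dist_triangle[of z y x] \<open>dist x y < r\<close> by simp
    qed
    show "cball z (R + r) \<in> fmeasurable lborel" 
      using emeasure_bounded_finite[OF bounded_cball, of z "R + r"] by (simp add: fmeasurable_def)
  qed (use P in auto)
  also have "\<dots> = (R + r) ^ DIM('a) * ?V"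
    using r by (simp add: content_cball_conv_ball content_ball_conv_unit_ball[of "R + r"])
  finally show ?thesis using V by (simp add: mult.assoc[symmetric])
qed

text \<open>A quantitative form of transversality to \<open>e\<close>: the map \<open>(x, s) \<mapsto> x + s e\<close> on \<open>G \<times> \<real>\<close> is
  injective with inverse Lipschitz for the constant \<open>\<kappa>\<close>. Graphs of Lipschitz functions over the
  hyperplane orthogonal to \<open>e\<close> have this property.\<close>

definition graph_like :: "real \<Rightarrow> 'a::euclidean_space \<Rightarrow> 'a set \<Rightarrow> bool" where
  "graph_like \<kappa> e G \<longleftrightarrow> 1 \<le> \<kappa> \<and> norm e = 1 \<and>
    (\<forall>x\<in>G. \<forall>y\<in>G. \<forall>s t. dist x y \<le> \<kappa> * dist (x + s *\<^sub>R e) (y + t *\<^sub>R e) \<and>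
        \<bar>s - t\<bar> \<le> \<kappa> * dist (x + s *\<^sub>R e) (y + t *\<^sub>R e))"

text \<open>Stack about \<open>l/\<rho>\<close> translates of the points in direction \<open>e\<close>, at distance \<open>\<rho>\<close> from one to
  the next. Transversality keeps all of them \<open>\<rho>/\<kappa>\<close> apart, and they stay in a ball of radius \<open>2l\<close>, so volume
  bounds their number by a multiple of \<open>(l/\<rho>)\<^sup>d\<close>. Division by the number of translates leaves the
  exponent \<open>d - 1\<close>.\<close>

lemma card_separated_graph_le:
  fixes G :: "'a::euclidean_space set"
  assumes G: "graph_like \<kappa> e G" and X: "finite X" "X \<subseteq> G \<inter> cball z l"
    and sep: "\<And>x y. x \<in> X \<Longrightarrow> y \<in> X \<Longrightarrow> x \<noteq> y \<Longrightarrow> \<rho> \<le> dist x y"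
    and \<rho>: "0 < \<rho>" "\<rho> \<le> l"
  shows "real (card X) * \<rho> ^ (DIM('a) - 1) \<le> (6 * \<kappa>) ^ DIM('a) * l ^ (DIM('a) - 1)"
proof -
  have \<kappa>: "1 \<le> \<kappa>" and e: "norm e = 1" using G by (auto simp: graph_like_def)
  define K where "K = nat \<lfloor>l / \<rho>\<rfloor>"
  have Kl: "real K * \<rho> \<le> l"
  proof -
    have "real K \<le> l / \<rho>" using \<rho> by (simp add: K_def)
    then show ?thesis using \<rho> by (simp add: field_simps)
  qed
  have Ku: "l \<le> real (K + 1) * \<rho>"
  proof -
    have "l / \<rho> \<le> real K + 1" using \<rho> by (simp add: K_def)
    then show ?thesis using \<rho> by (simp add: field_simps)
  qed
  \<comment> \<open>The copy of \<open>x\<close> on level \<open>k\<close> of the stack.\<close>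
  define p where "p = (\<lambda>(x, k :: nat). x + (real k * \<rho>) *\<^sub>R e)"
  have psep: "\<rho> \<le> \<kappa> * dist (p a) (p b)" if ab: "a \<in> X \<times> {..K}" "b \<in> X \<times> {..K}" "a \<noteq> b" for a b
  proof -
    obtain x k y j where [simp]: "a = (x, k)" "b = (y, j)" by (cases a, cases b)
    have xy: "x \<in> G" "y \<in> G" "x \<in> X" "y \<in> X" using ab X by auto
    have d: "dist x y \<le> \<kappa> * dist (p a) (p b)" "\<bar>real k * \<rho> - real j * \<rho>\<bar> \<le> \<kappa> * dist (p a) (p b)"
      using G xy unfolding graph_like_def p_def by auto
    show ?thesis
    proof (cases "x = y")
      case False then show ?thesis using sep[of x y] xy d by linarith
    next
      case True
      then have "k \<noteq> j" using ab by simp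
      then have "1 \<le> \<bar>real k - real j\<bar>" by (cases "k < j") (auto simp: not_less)
      then have "1 * \<rho> \<le> \<bar>real k - real j\<bar> * \<rho>" using \<rho> by (intro mult_right_mono) auto
      also have "\<dots> = \<bar>real k * \<rho> - real j * \<rho>\<bar>" using \<rho> by (simp add: abs_mult left_diff_distrib[symmetric])
      finally show ?thesis using d by linarith
    qed
  qed
  have inj: "inj_on p (X \<times> {..K})"
  proof (rule inj_onI, rule ccontr)
    fix a b assume "a \<in> X \<times> {..K}" "b \<in> X \<times> {..K}" "p a = p b" "a \<noteq> b"
    then show False using psep[of a b] \<rho> by simp
  qed
  \<comment> \<open>Half the separation of the stacked points, so that balls of this radius are disjoint.\<close>
  define r where "r = \<rho> / (2 * \<kappa>)"
  have r: "0 < r" "r \<le> l"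
  proof -
    show "0 < r" using \<rho> \<kappa> by (simp add: r_def)
    have "\<rho> / (2 * \<kappa>) \<le> \<rho> / 1" using \<rho> \<kappa> by (intro divide_left_mono) auto
    then show "r \<le> l" using \<rho> by (simp add: r_def)
  qed
  have "real (card (p ` (X \<times> {..K}))) * r ^ DIM('a) \<le> (2 * l + r) ^ DIM('a)"
  proof (rule card_packing_le)
    show "finite (p ` (X \<times> {..K}))" using X by simp
    show "p ` (X \<times> {..K}) \<subseteq> cball z (2 * l)"
    proof
      fix q assume "q \<in> p ` (X \<times> {..K})"
      then obtain x k where xk: "x \<in> X" "k \<le> K" "q = x + (real k * \<rho>) *\<^sub>R e" by (auto simp: p_def)
      have "real k * \<rho> \<le> real K * \<rho>" using xk \<rho> by (intro mult_right_mono) auto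
      then have "real k * \<rho> \<le> l" using Kl by linarith
      then have "dist x q \<le> l" using xk \<rho> e by (simp add: dist_norm)
      moreover have "dist z x \<le> l" using xk X by auto
      ultimately show "q \<in> cball z (2 * l)" using dist_triangle[of z q x] by simp
    qed
    fix a b assume ab: "a \<in> p ` (X \<times> {..K})" "b \<in> p ` (X \<times> {..K})" "a \<noteq> b"
    then have "\<rho> \<le> \<kappa> * dist a b" using psep by auto
    then show "2 * r \<le> dist a b" using \<kappa> by (simp add: r_def field_simps)
  qed (use r \<rho> in auto)
  moreover have "card (p ` (X \<times> {..K})) = card X * (K + 1)"
    using inj by (simp add: card_image card_cartesian_product)
  moreover have "(2 * l + r) ^ DIM('a) \<le> (3 * l) ^ DIM('a)" using r \<rho> by (intro power_mono) auto
  ultimately have "real (card X * (K + 1)) * r ^ DIM('a) \<le> (3 * l) ^ DIM('a)" by simp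
  then have "(2 * \<kappa>) ^ DIM('a) * (real (card X * (K + 1)) * r ^ DIM('a)) \<le> (2 * \<kappa>) ^ DIM('a) * (3 * l) ^ DIM('a)"
    using \<kappa> by (intro mult_left_mono) auto
  moreover have "(2 * \<kappa>) ^ DIM('a) * (real (card X * (K + 1)) * r ^ DIM('a)) =
      real (card X * (K + 1)) * \<rho> ^ DIM('a)"
  proof -
    have e: "\<rho> ^ DIM('a) = (2 * \<kappa>) ^ DIM('a) * r ^ DIM('a)"
      unfolding power_mult_distrib[symmetric] using \<kappa> by (simp add: r_def)
    show ?thesis unfolding e by (rule mult.left_commute)
  qed
  moreover have "(2 * \<kappa>) ^ DIM('a) * (3 * l) ^ DIM('a) = (6 * \<kappa>) ^ DIM('a) * l ^ DIM('a)"
    unfolding power_mult_distrib[symmetric] by (rule arg_cong[where f = "\<lambda>y. y ^ DIM('a)"]) simp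
  ultimately have N: "real (card X * (K + 1)) * \<rho> ^ DIM('a) \<le> (6 * \<kappa>) ^ DIM('a) * l ^ DIM('a)" by linarith
  obtain m where m: "DIM('a) = Suc m" using DIM_positive[where 'a = 'a] gr0_implies_Suc by blast
  have "(real (card X) * \<rho> ^ m) * l \<le> (real (card X) * \<rho> ^ m) * (real (K + 1) * \<rho>)"
    using Ku \<rho> by (intro mult_left_mono) auto
  also have "\<dots> = real (card X * (K + 1)) * \<rho> ^ DIM('a)"
    unfolding m of_nat_mult power_Suc by (simp only: mult_ac)
  also have "\<dots> \<le> (6 * \<kappa>) ^ DIM('a) * l ^ DIM('a)" by (rule N)
  also have "\<dots> = ((6 * \<kappa>) ^ DIM('a) * l ^ m) * l" unfolding m power_Suc by (simp only: mult_ac)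
  finally have "real (card X) * \<rho> ^ m \<le> (6 * \<kappa>) ^ DIM('a) * l ^ m" using \<rho> by simp
  then show ?thesis by (simp add: m)
qed

text \<open>A maximal \<open>\<rho>\<close>-separated subset is the centre set of a cover by balls of radius \<open>\<rho>\<close>. Its
  cardinality times \<open>\<rho>\<^sup>d\<^sup>-\<^sup>1\<close> is bounded independently of \<open>\<rho>\<close>.\<close>

lemma hausdorff_graph_ball_le:
  fixes G :: "'a::euclidean_space set"
  assumes G: "graph_like \<kappa> e G" and l: "0 < l"
  shows "emeasure (hausdorff_measure (DIM('a) - 1)) (G \<inter> cball z l) \<le>
    ennreal (unit_ball_vol (real (DIM('a) - 1)) * (6 * \<kappa>) ^ DIM('a) * l ^ (DIM('a) - 1))"
proof -
  let ?\<omega> = "unit_ball_vol (real (DIM('a) - 1))"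
  have "hausdorff_pre (DIM('a) - 1) \<delta> (G \<inter> cball z l) \<le> ennreal (?\<omega> * (6 * \<kappa>) ^ DIM('a) * l ^ (DIM('a) - 1))"
    if \<delta>: "\<delta> > 0" for \<delta>
  proof -
    define \<rho> where "\<rho> = min l (\<delta> / 2)"
    have \<rho>: "0 < \<rho>" "\<rho> \<le> l" "2 * \<rho> \<le> \<delta>" using l \<delta> by (auto simp: \<rho>_def)
    define S where "S X \<longleftrightarrow> finite X \<and> X \<subseteq> G \<inter> cball z l \<and> (\<forall>x\<in>X. \<forall>y\<in>X. x \<noteq> y \<longrightarrow> \<rho> \<le> dist x y)" for X
    \<comment> \<open>The number \<open>B\<close> bounds the size of all separated sets, so a largest one exists.\<close>
    define B where "B = nat \<lceil>(6 * \<kappa>) ^ DIM('a) * l ^ (DIM('a) - 1) / \<rho> ^ (DIM('a) - 1)\<rceil>"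
    have bound: "real (card X) * \<rho> ^ (DIM('a) - 1) \<le> (6 * \<kappa>) ^ DIM('a) * l ^ (DIM('a) - 1)" if "S X" for X
      using card_separated_graph_le[OF G, of X z l \<rho>] that \<rho> by (auto simp: S_def)
    have "\<forall>X. S X \<longrightarrow> card X < B + 1"
    proof (intro allI impI)
      fix X assume "S X"
      then have "real (card X) \<le> (6 * \<kappa>) ^ DIM('a) * l ^ (DIM('a) - 1) / \<rho> ^ (DIM('a) - 1)"
        using bound[of X] \<rho> by (simp add: field_simps)
      then have "card X \<le> B" unfolding B_def by linarith
      then show "card X < B + 1" by simp
    qed
    moreover have "S {}" by (simp add: S_def)
    ultimately obtain X where X: "S X" "\<And>Y. S Y \<Longrightarrow> card Y \<le> card X"
      using ex_has_greatest_nat[of S "{}" card "B + 1"] by blast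
    \<comment> \<open>A point not covered could be added to the largest set.\<close>
    have "G \<inter> cball z l \<subseteq> (\<Union>x\<in>X. cball x \<rho>)"
    proof (rule ccontr)
      assume "\<not> ?thesis"
      then obtain a where a1: "a \<in> G \<inter> cball z l" "a \<notin> (\<Union>x\<in>X. cball x \<rho>)" by blast
      have a: "a \<in> G \<inter> cball z l" "\<And>x. x \<in> X \<Longrightarrow> \<rho> < dist x a" using a1 by (auto simp: not_le[symmetric])
      then have "a \<notin> X" using \<rho> by force
      moreover have "S (insert a X)"
        using X(1) a by (auto simp: S_def dist_commute less_imp_le)
      ultimately show False using X(2)[of "insert a X"] X(1) by (simp add: S_def)
    qed
    then have "hausdorff_pre (DIM('a) - 1) \<delta> (G \<inter> cball z l) \<le> ennreal (real (card X) * (?\<omega> * \<rho> ^ (DIM('a) - 1)))"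
      using X(1) \<rho> by (intro hausdorff_pre_finite_cover) (auto simp: S_def)
    also have "\<dots> \<le> ennreal (?\<omega> * (6 * \<kappa>) ^ DIM('a) * l ^ (DIM('a) - 1))"
      using mult_left_mono[OF bound[OF X(1)], of ?\<omega>] by (intro ennreal_leI) (simp add: algebra_simps)
    finally show ?thesis .
  qed
  then have "hausdorff_outer (DIM('a) - 1) (G \<inter> cball z l) \<le> ennreal (?\<omega> * (6 * \<kappa>) ^ DIM('a) * l ^ (DIM('a) - 1))"
    unfolding hausdorff_outer_def by (intro SUP_least) auto
  then show ?thesis using emeasure_hausdorff_le_outer order_trans by blast
qed

section \<open>Measures dominated by Lebesgue measure\<close>

text \<open>Bounded Borel sets are covered, up to arbitrarily small excess volume, by
  non-overlapping cubes; the interiors of these are disjoint, so their volumes add up. Exhaustion by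
  large cubes gives the unbounded case.\<close>

lemma emeasure_le_lborel_if_cubes:
  fixes \<nu> :: "'a::euclidean_space measure"
  assumes sets: "sets \<nu> = sets borel" and C: "0 \<le> C"
    and cube: "\<And>u v l. 0 < l \<Longrightarrow> (\<And>i. i \<in> Basis \<Longrightarrow> v \<bullet> i - u \<bullet> i = l) \<Longrightarrow> emeasure \<nu> (cbox u v) \<le> ennreal (C * l ^ DIM('a))"
    and A: "A \<in> sets borel"
  shows "emeasure \<nu> A \<le> ennreal C * emeasure lborel A"
proof -
  have bdd: "emeasure \<nu> A \<le> ennreal C * emeasure lborel A"
    if A: "A \<in> sets borel" "A \<subseteq> cbox a b" and ab: "\<And>i. i \<in> Basis \<Longrightarrow> b \<bullet> i - a \<bullet> i = L" "0 < L" for A and a b :: 'a and L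
  proof -
    have eps: "emeasure \<nu> A \<le> ennreal (C * measure lborel A + d)" if d: "d > 0" for d
    proof -
      define \<epsilon> where "\<epsilon> = d / (C + 1)"
      have \<epsilon>: "\<epsilon> > 0" "C * \<epsilon> \<le> d" using d C by (auto simp: \<epsilon>_def field_simps)
      have "A \<in> lmeasurable"
      proof -
        have "emeasure lebesgue A \<le> emeasure lebesgue (cbox a b)" using A by (intro emeasure_mono) auto
        also have "\<dots> < \<infinity>" using emeasure_bounded_finite[OF bounded_cbox, of a b] by simp
        finally show ?thesis using A by (simp add: fmeasurable_def)
      qed
      from measurable_outer_intervals_bounded[OF this A(2) \<epsilon>(1)] obtain \<D> where
        cnt: "countable \<D>"
        and D1: "\<And>K. K \<in> \<D> \<Longrightarrow> K \<subseteq> cbox a b \<and> K \<noteq> {} \<and> (\<exists>c d. K = cbox c d)"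
        and D2: "pairwise (\<lambda>A B. interior A \<inter> interior B = {}) \<D>"
        and D3: "\<And>u v. cbox u v \<in> \<D> \<Longrightarrow> \<exists>n. \<forall>i \<in> Basis. v \<bullet> i - u \<bullet> i = (b \<bullet> i - a \<bullet> i)/2^n"
        and D4: "A \<subseteq> \<Union>\<D>" "\<Union>\<D> \<in> lmeasurable" "measure lebesgue (\<Union>\<D>) \<le> measure lebesgue A + \<epsilon>"
        by metis
      \<comment> \<open>An enumeration of the countable family of cubes, with empty sets in unused places.\<close>
      define X where "X n = (if n \<in> to_nat_on \<D> ` \<D> then from_nat_into \<D> n else {})" for n
      have XD: "X n = {} \<or> X n \<in> \<D>" for n
        using cnt by (auto simp: X_def)
      have UX: "(\<Union>n. X n) = \<Union>\<D>"
      proof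
        show "(\<Union>n. X n) \<subseteq> \<Union>\<D>" using XD by blast
        show "\<Union>\<D> \<subseteq> (\<Union>n. X n)"
        proof
          fix x assume "x \<in> \<Union>\<D>"
          then obtain K where "K \<in> \<D>" "x \<in> K" by blast
          then have "x \<in> X (to_nat_on \<D> K)" using cnt by (simp add: X_def)
          then show "x \<in> (\<Union>n. X n)" by blast
        qed
      qed
      have disj: "disjoint_family (\<lambda>n. interior (X n))"
        unfolding disjoint_family_on_def
      proof (intro ballI impI)
        fix m n :: nat assume mn: "m \<noteq> n"
        show "interior (X m) \<inter> interior (X n) = {}"
        proof (cases "X m = {} \<or> X n = {}")
          case False
          then have i: "m \<in> to_nat_on \<D> ` \<D>" "n \<in> to_nat_on \<D> ` \<D>" by (auto simp: X_def split: if_splits)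
          then have "X m \<noteq> X n" using mn cnt by (auto simp: X_def)
          moreover have "X m \<in> \<D>" "X n \<in> \<D>" using XD False by blast+
          ultimately show ?thesis using D2 by (auto simp: pairwise_def)
        qed auto
      qed
      have Xm: "X n \<in> sets borel" for n
        using XD[of n] D1 by (metis borel_closed closed_cbox sets.empty_sets)
      have each: "emeasure \<nu> (X n) \<le> ennreal C * emeasure lborel (interior (X n))" for n
      proof (cases "X n = {}")
        case False
        then obtain c d where K: "X n = cbox c d" "cbox c d \<in> \<D>" using XD[of n] D1 by metis
        then obtain k where k: "\<And>i. i \<in> Basis \<Longrightarrow> d \<bullet> i - c \<bullet> i = L / 2 ^ k" using D3[of c d] ab by metis
        have l: "0 < L / 2 ^ k" using ab by simp
        have "emeasure \<nu> (X n) \<le> ennreal (C * (L / 2 ^ k) ^ DIM('a))" unfolding K by (rule cube[OF l k])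
        also have "\<dots> = ennreal C * emeasure lborel (box c d)"
        proof -
          have "c \<bullet> i \<le> d \<bullet> i" if "i \<in> Basis" for i using k[OF that] l by linarith
          then have "emeasure lborel (box c d) = ennreal (\<Prod>i\<in>Basis. (d - c) \<bullet> i)" by (simp add: emeasure_lborel_box_eq)
          also have "(\<Prod>i\<in>Basis. (d - c) \<bullet> i) = (L / 2 ^ k) ^ DIM('a)" using k by (simp add: inner_diff_left)
          finally show ?thesis using C l by (simp add: ennreal_mult)
        qed
        finally show ?thesis by (simp add: K interior_cbox)
      qed simp
      have "A \<subseteq> (\<Union>n. X n)" unfolding UX by (rule D4)
      then have "emeasure \<nu> A \<le> emeasure \<nu> (\<Union>n. X n)"
        by (rule emeasure_mono) (unfold sets, intro sets.countable_UN, use Xm in blast)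
      also have "\<dots> \<le> (\<Sum>n. emeasure \<nu> (X n))"
        using Xm sets by (intro emeasure_subadditive_countably) auto
      also have "\<dots> \<le> (\<Sum>n. ennreal C * emeasure lborel (interior (X n)))"
        by (intro suminf_le each) auto
      also have "\<dots> = ennreal C * (\<Sum>n. emeasure lborel (interior (X n)))" by simp
      also have "(\<Sum>n. emeasure lborel (interior (X n))) = emeasure lborel (\<Union>n. interior (X n))"
        by (rule suminf_emeasure[OF _ disj]) auto
      also have "\<dots> = emeasure lebesgue (\<Union>n. interior (X n))" by (subst emeasure_completion) auto
      also have "\<dots> \<le> emeasure lebesgue (\<Union>\<D>)"
      proof (rule emeasure_mono)
        show "(\<Union>n. interior (X n)) \<subseteq> \<Union>\<D>" unfolding UX[symmetric] using interior_subset by blast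
        show "\<Union>\<D> \<in> sets lebesgue" using D4 by (simp add: fmeasurable_def)
      qed
      also have "\<dots> = ennreal (measure lebesgue (\<Union>\<D>))" using D4 by (intro emeasure_eq_measure2)
      also have "ennreal C * \<dots> \<le> ennreal C * ennreal (measure lebesgue A + \<epsilon>)"
        using D4 by (intro mult_left_mono ennreal_leI) auto
      also have "\<dots> = ennreal (C * (measure lebesgue A + \<epsilon>))" using C \<epsilon> by (simp add: ennreal_mult)
      also have "measure lebesgue A = measure lborel A" using A by (simp add: measure_completion)
      also have "ennreal (C * (measure lborel A + \<epsilon>)) \<le> ennreal (C * measure lborel A + d)"
        using \<epsilon> by (intro ennreal_leI) (simp add: distrib_left)
      finally show ?thesis by (simp add: mult_left_mono)
    qed
    have "emeasure \<nu> A \<le> ennreal (C * measure lborel A)"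
    proof (rule ennreal_le_epsilon)
      fix d :: real assume "0 < d"
      then show "emeasure \<nu> A \<le> ennreal (C * measure lborel A) + ennreal d"
        using eps[of d] C by (subst ennreal_plus[symmetric]) auto
    qed
    also have "\<dots> = ennreal C * emeasure lborel A"
    proof -
      have "emeasure lborel A \<le> emeasure lborel (cbox a b)" using A by (intro emeasure_mono) auto
      also have "\<dots> < \<infinity>" by (rule emeasure_bounded_finite) simp
      finally show ?thesis using C by (simp add: ennreal_mult emeasure_eq_ennreal_measure less_top)
    qed
    finally show ?thesis .
  qed
  define Q where "Q n = cbox (- real (Suc n) *\<^sub>R One) (real (Suc n) *\<^sub>R (One :: 'a))" for n
  have inc: "incseq (\<lambda>n. A \<inter> Q n)"
    unfolding incseq_Suc_iff Q_def by (force simp: mem_box)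
  have U: "(\<Union>n. A \<inter> Q n) = A"
  proof (intro equalityI subsetI)
    fix x assume x: "x \<in> A"
    obtain n where n: "norm x \<le> real n" using real_arch_simple by blast
    have "- real (Suc n) \<le> x \<bullet> i \<and> x \<bullet> i \<le> real (Suc n)" if "i \<in> Basis" for i
      using Basis_le_norm[OF that, of x] n by auto
    then have "x \<in> Q n" unfolding Q_def by (simp add: mem_box del: of_nat_Suc)
    with x show "x \<in> (\<Union>n. A \<inter> Q n)" by blast
  qed auto
  have "emeasure \<nu> A = (SUP n. emeasure \<nu> (A \<inter> Q n))"
  proof -
    have "A \<inter> Q n \<in> sets \<nu>" for n
      unfolding sets Q_def by (rule sets.Int[OF A]) simp
    then have "range (\<lambda>n. A \<inter> Q n) \<subseteq> sets \<nu>" by blast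
    from SUP_emeasure_incseq[OF this inc] show ?thesis unfolding U by (rule sym)
  qed
  also have "\<dots> \<le> ennreal C * emeasure lborel A"
  proof (rule SUP_least)
    fix n
    have "emeasure \<nu> (A \<inter> Q n) \<le> ennreal C * emeasure lborel (A \<inter> Q n)"
    proof (rule bdd)
      show "A \<inter> Q n \<in> sets borel" using A by (simp add: Q_def)
      show "A \<inter> Q n \<subseteq> cbox (- real (Suc n) *\<^sub>R One) (real (Suc n) *\<^sub>R One)" by (simp add: Q_def)
      show "(real (Suc n) *\<^sub>R One) \<bullet> i - (- real (Suc n) *\<^sub>R One) \<bullet> i = 2 * real (Suc n)"
        if "i \<in> Basis" for i :: 'a
        using that by simp
      show "0 < 2 * real (Suc n)" by simp
    qed
    also have "\<dots> \<le> ennreal C * emeasure lborel A"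
      using A by (intro mult_left_mono emeasure_mono) auto
    finally show "emeasure \<nu> (A \<inter> Q n) \<le> ennreal C * emeasure lborel A" .
  qed
  finally show ?thesis .
qed

section \<open>Boundary charts and transport off the boundary\<close>

lemma has_derivative_cgrad:
  assumes "smooth f" shows "(f has_derivative (\<lambda>h. cgrad f x \<bullet> h)) (at x within S)"
proof -
  have d: "(f has_derivative frechet_derivative f (at x)) (at x)" by (rule smooth_has_derivative[OF assms])
  have lin: "linear (frechet_derivative f (at x))"
    using d by (simp add: has_derivative_def bounded_linear.linear)
  have "frechet_derivative f (at x) h = cgrad f x \<bullet> h" for h
  proof -
    have "frechet_derivative f (at x) h = frechet_derivative f (at x) (\<Sum>b\<in>Basis. (h \<bullet> b) *\<^sub>R b)"
      by (simp add: euclidean_representation)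
    also have "\<dots> = (\<Sum>b\<in>Basis. (h \<bullet> b) * frechet_derivative f (at x) b)"
      by (simp add: linear_sum[OF lin] linear_cmul[OF lin])
    also have "\<dots> = cgrad f x \<bullet> h"
      by (simp add: cgrad_def inner_sum_right inner_commute[of _ h] mult.commute)
    finally show ?thesis .
  qed
  then have "frechet_derivative f (at x) = (\<lambda>h. cgrad f x \<bullet> h)" by auto
  with d show ?thesis by (simp add: has_derivative_at_withinI)
qed

lemma smooth_lipschitz_on_cball:
  fixes f :: "'a::euclidean_space \<Rightarrow> real"
  assumes "smooth f"
  obtains L where "0 \<le> L" "\<And>x y. x \<in> cball p R \<Longrightarrow> y \<in> cball p R \<Longrightarrow> \<bar>f x - f y\<bar> \<le> L * dist x y"
proof -
  have "compact (cgrad f ` cball p R)"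
    by (intro compact_continuous_image cgrad_continuous_on assms compact_cball)
  then obtain L where L: "\<And>x. x \<in> cball p R \<Longrightarrow> norm (cgrad f x) \<le> L"
    using compact_imp_bounded bounded_iff by (metis imageI)
  have "\<bar>f x - f y\<bar> \<le> max L 0 * dist x y" if "x \<in> cball p R" "y \<in> cball p R" for x y
  proof -
    have "norm (f x - f y) \<le> max L 0 * norm (x - y)"
    proof (rule differentiable_bound[of "cball p R" f "\<lambda>x h. cgrad f x \<bullet> h"])
      fix z assume "z \<in> cball p R"
      show "(f has_derivative (\<lambda>h. cgrad f z \<bullet> h)) (at z within cball p R)"
        by (rule has_derivative_cgrad[OF assms])
      show "onorm (\<lambda>h. cgrad f z \<bullet> h) \<le> max L 0"
      proof (rule onorm_bound)
        fix h
        have "norm (cgrad f z \<bullet> h) \<le> norm (cgrad f z) * norm h" by (simp add: Cauchy_Schwarz_ineq2)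
        also have "\<dots> \<le> max L 0 * norm h" using L[OF \<open>z \<in> cball p R\<close>] by (intro mult_right_mono) auto
        finally show "norm (cgrad f z \<bullet> h) \<le> max L 0 * norm h" .
      qed simp
    qed (use that in auto)
    then show ?thesis by (simp add: dist_norm)
  qed
  then show ?thesis using that[of "max L 0"] by simp
qed

text \<open>The boundary inside the chart is the graph of \<open>\<gamma>\<close>, and \<open>\<gamma>\<close> is Lipschitz on a ball. Since
  \<open>\<gamma>\<close> is constant along \<open>e\<close>, its values at two points may be compared after projecting the points to a
  hyperplane; the distance of the projections is at most that of any translates along \<open>e\<close>.\<close>

lemma smooth_boundary_chart:
  fixes \<Omega> :: "'a::euclidean_space set"
  assumes \<Omega>: "smooth_boundary \<Omega>" "open \<Omega>" and p: "p \<in> frontier \<Omega>"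
  obtains r e \<kappa> where "0 < r" "graph_like \<kappa> e (frontier \<Omega> \<inter> ball p r)"
    "\<And>x s. x \<in> frontier \<Omega> \<inter> ball p r \<Longrightarrow> 0 < s \<Longrightarrow> s < r \<Longrightarrow> x + s *\<^sub>R e \<in> \<Omega>"
proof -
  from bspec[OF \<Omega>(1)[unfolded smooth_boundary_def] p]
  obtain R e \<gamma> where R: "R > 0" "norm e = 1" "smooth \<gamma>" "\<forall>x s. \<gamma> (x + s *\<^sub>R e) = \<gamma> x"
    and chart: "\<Omega> \<inter> ball p R = {x \<in> ball p R. \<gamma> x < x \<bullet> e}"
    by (elim exE conjE) (rule that)
  have chart_iff: "x \<in> \<Omega> \<longleftrightarrow> \<gamma> x < x \<bullet> e" if "x \<in> ball p R" for x
    using chart that by blast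
  have ee: "e \<bullet> e = 1" using R(2) by (simp add: dot_square_norm)
  obtain L where L: "0 \<le> L" "\<And>x y. x \<in> cball p R \<Longrightarrow> y \<in> cball p R \<Longrightarrow> \<bar>\<gamma> x - \<gamma> y\<bar> \<le> L * dist x y"
    using smooth_lipschitz_on_cball[OF R(3), of p R] by blast
  have on_graph: "\<gamma> x = x \<bullet> e" if x: "x \<in> frontier \<Omega>" "x \<in> ball p R" for x
  proof (rule antisym)
    have "x \<notin> \<Omega>" using x(1) \<Omega>(2) by (auto simp: frontier_def interior_open)
    then show "x \<bullet> e \<le> \<gamma> x" using chart_iff[OF x(2)] by linarith
    show "\<gamma> x \<le> x \<bullet> e"
    proof (rule ccontr)
      assume "\<not> ?thesis"
      then have gt: "x \<bullet> e < \<gamma> x" by simp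
      have op: "open {y. y \<bullet> e < \<gamma> y}"
        by (rule open_Collect_less[OF _ smooth_imp_continuous_on[OF R(3)]]) (intro continuous_intros)
      have "x \<in> closure \<Omega>" using x(1) unfolding frontier_def by (rule DiffD1)
      then have "(ball p R \<inter> {y. y \<bullet> e < \<gamma> y}) \<inter> closure \<Omega> \<noteq> {}" using gt x(2) by blast
      then have "(ball p R \<inter> {y. y \<bullet> e < \<gamma> y}) \<inter> \<Omega> \<noteq> {}"
        using open_Int_closure_eq_empty[OF open_Int[OF open_ball op]] by blast
      then obtain y where y: "y \<in> \<Omega> \<inter> ball p R" "y \<bullet> e < \<gamma> y" by blast
      then show False using chart_iff[of y] by simp
    qed
  qed
  \<comment> \<open>Half the radius of the chart leaves room for segments of length \<open>r\<close> inside the chart.\<close>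
  define r where "r = R / 2"
  have r: "0 < r" using R by (simp add: r_def)
  have inside: "x + s *\<^sub>R e \<in> \<Omega>" if x: "x \<in> frontier \<Omega> \<inter> ball p r" and s: "0 < s" "s < r" for x s
  proof -
    have "dist p (x + s *\<^sub>R e) \<le> dist p x + dist x (x + s *\<^sub>R e)" by (rule dist_triangle)
    also have "\<dots> < r + r" using x s R by (intro add_strict_mono) (auto simp: dist_norm)
    finally have b: "x + s *\<^sub>R e \<in> ball p R" by (simp add: r_def)
    have "x \<in> ball p R" using x R by (simp add: r_def)
    then have "\<gamma> (x + s *\<^sub>R e) < (x + s *\<^sub>R e) \<bullet> e"
      using on_graph[of x] x s ee R(4) by (simp add: inner_left_distrib)
    then show ?thesis using chart_iff[OF b] by blast
  qed
  have "graph_like (2 + L) e (frontier \<Omega> \<inter> ball p r)"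
    unfolding graph_like_def
  proof (intro conjI ballI allI)
    show "1 \<le> 2 + L" using L by simp
    show "norm e = 1" by (rule R)
    fix x y s t assume x: "x \<in> frontier \<Omega> \<inter> ball p r" and y: "y \<in> frontier \<Omega> \<inter> ball p r"
    define D where "D = dist (x + s *\<^sub>R e) (y + t *\<^sub>R e)"
    define w where "w = (x + s *\<^sub>R e) - (y + t *\<^sub>R e)"
    have Dw: "D = norm w" by (simp add: D_def w_def dist_norm)
    have xR: "x \<in> ball p R" "y \<in> ball p R" using x y R by (auto simp: r_def)
    \<comment> \<open>The projection along \<open>e\<close> to the hyperplane through \<open>p\<close>. It leaves \<open>\<gamma>\<close> unchanged and maps the
        ball around \<open>p\<close> into itself, where the Lipschitz bound holds.\<close>
    define \<pi> where "\<pi> z = z + ((p - z) \<bullet> e) *\<^sub>R e" for z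
    have \<pi>\<gamma>: "\<gamma> (\<pi> z) = \<gamma> z" for z unfolding \<pi>_def using R(4) by blast
    have proj: "norm (v - (v \<bullet> e) *\<^sub>R e) \<le> norm v" for v :: 'a
    proof -
      have "(norm (v - (v \<bullet> e) *\<^sub>R e))\<^sup>2 = (norm v)\<^sup>2 - (v \<bullet> e)\<^sup>2"
        unfolding power2_norm_eq_inner
        by (simp add: inner_diff_left inner_diff_right ee inner_commute power2_eq_square algebra_simps)
      also have "\<dots> \<le> (norm v)\<^sup>2" by simp
      finally show ?thesis by (rule power2_le_imp_le) simp
    qed
    have \<pi>p: "\<pi> z - p = (z - p) - ((z - p) \<bullet> e) *\<^sub>R e" for z
      unfolding \<pi>_def by (simp add: inner_diff_left algebra_simps)
    have "dist p (\<pi> z) \<le> dist p z" for z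
      unfolding dist_norm norm_minus_commute[of p] \<pi>p by (rule proj)
    then have \<pi>c: "\<pi> x \<in> cball p R" "\<pi> y \<in> cball p R" using xR 
      using order_trans[OF _ less_imp_le] by (auto simp: mem_ball mem_cball)
    have "\<pi> x - \<pi> y = w - (w \<bullet> e) *\<^sub>R e"
      unfolding \<pi>_def w_def by (simp add: inner_diff_left inner_add_left ee algebra_simps)
    then have "dist (\<pi> x) (\<pi> y) \<le> D" using proj[of w] by (simp add: dist_norm Dw)
    then have "\<bar>\<gamma> x - \<gamma> y\<bar> \<le> L * D"
      using L(2)[OF \<pi>c] L(1) mult_left_mono[of "dist (\<pi> x) (\<pi> y)" D L] unfolding \<pi>\<gamma> by linarith
    moreover have "w \<bullet> e = (\<gamma> x - \<gamma> y) + (s - t)"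
      using on_graph x y xR by (simp add: w_def inner_diff_left inner_add_left ee)
    moreover have "\<bar>w \<bullet> e\<bar> \<le> D" using Cauchy_Schwarz_ineq2[of w e] R(2) by (simp add: Dw)
    ultimately have st: "\<bar>s - t\<bar> \<le> D + L * D" by linarith
    have D0: "0 \<le> D" by (simp add: D_def)
    show "\<bar>s - t\<bar> \<le> (2 + L) * dist (x + s *\<^sub>R e) (y + t *\<^sub>R e)"
      using st D0 unfolding D_def[symmetric] by (simp add: distrib_right)
    have "x - y = w - (s - t) *\<^sub>R e" by (simp add: w_def algebra_simps)
    then have "dist x y \<le> norm w + norm ((s - t) *\<^sub>R e)"
      unfolding dist_norm by (metis norm_triangle_ineq4)
    also have "\<dots> = D + \<bar>s - t\<bar>" by (simp add: Dw R(2))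
    finally show "dist x y \<le> (2 + L) * dist (x + s *\<^sub>R e) (y + t *\<^sub>R e)"
      using st unfolding D_def[symmetric] by (simp add: distrib_right)
  qed
  with r inside that show ?thesis by blast
qed

text \<open>The integrand of the square of the \<open>H1\<close> norm.\<close>

definition sq_density :: "('a::euclidean_space \<Rightarrow> real) \<Rightarrow> 'a \<Rightarrow> real" where
  "sq_density f y = (f y)\<^sup>2 + (norm (cgrad f y))\<^sup>2"

lemma sq_density_nonneg: "0 \<le> sq_density f y"
  by (simp add: sq_density_def)

lemma continuous_on_sq_density: "smooth f \<Longrightarrow> continuous_on S (sq_density f)"
  unfolding sq_density_def by (intro continuous_intros smooth_imp_continuous_on cgrad_continuous_on)

text \<open>Write \<open>f(x)\<^sup>2\<close> as minus the integral of the derivative of \<open>(1 - s/s0) f(x + s e)\<^sup>2\<close> over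
  \<open>[0, s0]\<close>. The weight is 1 at the boundary point and 0 at the other end.\<close>

lemma endpoint_le_line_integral:
  fixes f :: "'a::euclidean_space \<Rightarrow> real"
  assumes f: "smooth f" and e: "norm e = 1" and s0: "0 < s0"
  shows "ennreal ((f x)\<^sup>2) \<le> ennreal (1 + 1 / s0) *
    (\<integral>\<^sup>+s. ennreal (sq_density f (x + s *\<^sub>R e)) * indicator {0<..<s0} s \<partial>lborel)"
proof -
  let ?l = "\<lambda>s. f (x + s *\<^sub>R e)" and ?l' = "\<lambda>s. cgrad f (x + s *\<^sub>R e) \<bullet> e"
  let ?F = "\<lambda>s. sq_density f (x + s *\<^sub>R e)"
  let ?g' = "\<lambda>s. - (?l s)\<^sup>2 / s0 + (1 - s / s0) * (2 * ?l s * ?l' s)"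
  have dl: "(?l has_real_derivative ?l' s) (at s)" for s
    by (rule has_derivative_along_line[OF has_derivative_cgrad[OF f]])
  have "((\<lambda>s. (1 - s / s0) * (?l s)\<^sup>2) has_real_derivative ?g' s) (at s)" for s
    using dl[of s] s0 by (auto intro!: derivative_eq_intros simp: field_simps)
  then have "(?g' has_integral ((1 - s0 / s0) * (?l s0)\<^sup>2 - (1 - 0 / s0) * (?l 0)\<^sup>2)) {0..s0}"
    using s0 by (intro fundamental_theorem_of_calculus)
      (auto simp: has_real_derivative_iff_has_vector_derivative[symmetric] intro: has_field_derivative_at_within)
  then have hi: "(?g' has_integral - (f x)\<^sup>2) {0..s0}" using s0 by simp
  have cF: "continuous_on {0..s0} ?F"
    by (rule continuous_on_compose2[OF continuous_on_sq_density[OF f, of UNIV]]) (auto intro!: continuous_intros)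
  have iF: "?F integrable_on {0..s0}" using cF by (rule integrable_continuous_real)
  have le: "- ?g' s \<le> (1 + 1 / s0) * ?F s" if s: "s \<in> {0..s0}" for s
  proof -
    have a: "0 \<le> 1 - s / s0" "1 - s / s0 \<le> 1" using s s0 by (auto simp: field_simps)
    have l': "\<bar>?l' s\<bar> \<le> norm (cgrad f (x + s *\<^sub>R e))"
      using Cauchy_Schwarz_ineq2[of "cgrad f (x + s *\<^sub>R e)" e] e by simp
    have "\<bar>(1 - s / s0) * (2 * ?l s * ?l' s)\<bar> \<le> \<bar>2 * ?l s * ?l' s\<bar>"
      using a by (simp add: abs_mult mult_left_le_one_le)
    also have "\<dots> \<le> 2 * \<bar>?l s\<bar> * norm (cgrad f (x + s *\<^sub>R e))"
      using l' by (simp add: abs_mult mult_left_mono)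
    also have "\<dots> \<le> ?F s"
      using sum_squares_bound[of "\<bar>?l s\<bar>" "norm (cgrad f (x + s *\<^sub>R e))"] by (simp add: sq_density_def)
    finally have 1: "- ((1 - s / s0) * (2 * ?l s * ?l' s)) \<le> ?F s" by linarith
    have "(?l s)\<^sup>2 / s0 \<le> ?F s / s0" using s0 by (intro divide_right_mono) (auto simp: sq_density_def)
    with 1 show ?thesis by (simp add: distrib_right)
  qed
  have "(f x)\<^sup>2 = integral {0..s0} (\<lambda>s. - ?g' s)"
    using has_integral_neg[OF hi] by (simp add: integral_unique)
  also have "\<dots> \<le> integral {0..s0} (\<lambda>s. (1 + 1 / s0) * ?F s)"
    using has_integral_neg[OF hi] iF le
    by (intro integral_le integrable_on_mult_right) (auto simp: has_integral_integrable)
  also have "\<dots> = (1 + 1 / s0) * integral {0..s0} ?F" by simp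
  finally have fx: "(f x)\<^sup>2 \<le> (1 + 1 / s0) * integral {0..s0} ?F" .
  have si: "set_integrable lborel {0..s0} ?F" by (rule borel_integrable_atLeastAtMost'[OF cF])
  have "(\<integral>\<^sup>+s. ennreal (?F s) * indicator {0<..<s0} s \<partial>lborel) = (\<integral>\<^sup>+s. ennreal (indicator {0..s0} s *\<^sub>R ?F s) \<partial>lborel)"
  proof (rule nn_integral_cong_AE)
    have "AE s in lborel. s \<noteq> 0 \<and> s \<noteq> s0" using AE_lborel_singleton[of 0] AE_lborel_singleton[of s0] by eventually_elim simp
    then show "AE s in lborel. ennreal (?F s) * indicator {0<..<s0} s = ennreal (indicator {0..s0} s *\<^sub>R ?F s)"
      by eventually_elim (auto simp: indicator_def)
  qed
  also have "\<dots> = ennreal (LINT s:{0..s0}|lborel. ?F s)"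
    unfolding set_lebesgue_integral_def
    by (rule nn_integral_eq_integral) (use si in \<open>auto simp: set_integrable_def sq_density_nonneg\<close>)
  also have "(LINT s:{0..s0}|lborel. ?F s) = integral {0..s0} ?F" by (rule set_borel_integral_eq_integral(2)[OF si])
  finally have eq: "(\<integral>\<^sup>+s. ennreal (?F s) * indicator {0<..<s0} s \<partial>lborel) = ennreal (integral {0..s0} ?F)" .
  have m: "ennreal (1 + 1 / s0) * ennreal (integral {0..s0} ?F) = ennreal ((1 + 1 / s0) * integral {0..s0} ?F)"
    by (rule ennreal_mult'[symmetric]) (use s0 in simp)
  show ?thesis unfolding eq m by (rule ennreal_leI[OF fx])
qed

text \<open>Points of the preimage of a cube of side \<open>l\<close> under \<open>(x, s) \<mapsto> x + s e\<close> differ by at most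
  \<open>\<kappa> d l\<close> in both components. Hence the preimage lies in the product of a part of the graph of
  radius \<open>\<kappa> d l\<close> with an interval of that size, whose measure is a multiple of \<open>l\<^sup>d\<^sup>-\<^sup>1 l\<close>.\<close>

lemma graph_transport:
  fixes G :: "'a::euclidean_space set"
  assumes Gm: "G \<in> sets borel" and G: "graph_like \<kappa> e G"
  obtains C where "0 \<le> C" "\<And>F. F \<in> borel_measurable borel \<Longrightarrow>
    (\<integral>\<^sup>+x. \<integral>\<^sup>+s. F (x + s *\<^sub>R e) \<partial>lborel \<partial>restrict_space (hausdorff_measure (DIM('a) - 1)) G) \<le>
      ennreal C * (\<integral>\<^sup>+y. F y \<partial>lborel)"
proof -
  have \<kappa>: "1 \<le> \<kappa>" using G by (simp add: graph_like_def)
  let ?d = "DIM('a)"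
  let ?\<omega> = "unit_ball_vol (real (?d - 1))"
  define M where "M = restrict_space (hausdorff_measure (?d - 1)) G"
  have spM: "space M = G" by (simp add: M_def space_restrict_space)
  have setsM: "sets M = sets (restrict_space borel G)" 
    unfolding M_def by (rule sets_restrict_space_cong[OF sets_hausdorff_measure])
  let ?N = "M \<Otimes>\<^sub>M (lborel :: real measure)"
  let ?T = "\<lambda>z. fst z + snd z *\<^sub>R e"
  have idm: "(\<lambda>x. x) \<in> measurable M borel"
    by (subst measurable_cong_sets[OF setsM refl]) (rule measurable_restrict_space1, simp)
  have Tm: "?T \<in> borel_measurable ?N"
  proof -
    have "(\<lambda>z. fst z) \<in> borel_measurable ?N" using measurable_compose[OF measurable_fst idm] .
    moreover have "(\<lambda>z. snd z) \<in> borel_measurable ?N" by simp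
    ultimately show ?thesis by (intro borel_measurable_add borel_measurable_scaleR) auto
  qed
  define \<nu> where "\<nu> = distr ?N borel ?T"
  define C where "C = 2 * ?\<omega> * (6 * \<kappa>) ^ ?d * (\<kappa> * real ?d) ^ ?d"
  have C: "0 \<le> C" using \<kappa> by (simp add: C_def)
  have cube: "emeasure \<nu> (cbox u v) \<le> ennreal (C * l ^ ?d)"
    if l: "0 < l" and uv: "\<And>i. i \<in> Basis \<Longrightarrow> v \<bullet> i - u \<bullet> i = l" for u v :: 'a and l
  proof -
    define D where "D = real ?d * l"
    have D: "D > 0" using l by (simp add: D_def)
    have diam: "dist a b \<le> D" if "a \<in> cbox u v" "b \<in> cbox u v" for a b
    proof -
      have "dist a b \<le> (\<Sum>i\<in>Basis. \<bar>(a - b) \<bullet> i\<bar>)" unfolding dist_norm by (rule norm_le_l1)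
      also have "\<dots> \<le> (\<Sum>i\<in>(Basis::'a set). l)"
      proof (rule sum_mono)
        fix i :: 'a assume i: "i \<in> Basis"
        then have "u \<bullet> i \<le> a \<bullet> i" "a \<bullet> i \<le> v \<bullet> i" "u \<bullet> i \<le> b \<bullet> i" "b \<bullet> i \<le> v \<bullet> i"
          using that by (auto simp: mem_box)
        then show "\<bar>(a - b) \<bullet> i\<bar> \<le> l" using uv[OF i] by (simp add: inner_diff_left abs_le_iff)
      qed
      finally show ?thesis by (simp add: D_def)
    qed
    let ?P = "?T -` cbox u v \<inter> space ?N"
    have em: "emeasure \<nu> (cbox u v) = emeasure ?N ?P"
      unfolding \<nu>_def by (rule emeasure_distr[OF Tm]) simp
    show ?thesis
    proof (cases "?P = {}")
      case True then show ?thesis unfolding em by simp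
    next
      case False
      then obtain x0 t0 where x0: "x0 \<in> G" "x0 + t0 *\<^sub>R e \<in> cbox u v"
        by (auto simp: space_pair_measure spM)
      \<comment> \<open>A box around one point of the preimage, of the size that transversality allows.\<close>
      let ?A = "G \<inter> cball x0 (\<kappa> * D)" and ?B = "{t0 - \<kappa> * D .. t0 + \<kappa> * D}"
      have Am: "?A \<in> sets M" unfolding setsM by (auto simp: sets_restrict_space)
      have "?P \<subseteq> ?A \<times> ?B"
      proof
        fix z assume "z \<in> ?P"
        then obtain x t where z: "z = (x, t)" "x \<in> G" "x + t *\<^sub>R e \<in> cbox u v"
          by (auto simp: space_pair_measure spM)
        have "dist (x0 + t0 *\<^sub>R e) (x + t *\<^sub>R e) \<le> D" using diam x0 z by blast
        then have "\<kappa> * dist (x0 + t0 *\<^sub>R e) (x + t *\<^sub>R e) \<le> \<kappa> * D" using \<kappa> by (intro mult_left_mono) auto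
        moreover have "dist x0 x \<le> \<kappa> * dist (x0 + t0 *\<^sub>R e) (x + t *\<^sub>R e)"
          "\<bar>t0 - t\<bar> \<le> \<kappa> * dist (x0 + t0 *\<^sub>R e) (x + t *\<^sub>R e)"
          using G x0 z unfolding graph_like_def by blast+
        ultimately have "dist x0 x \<le> \<kappa> * D" "\<bar>t0 - t\<bar> \<le> \<kappa> * D" by linarith+
        then show "z \<in> ?A \<times> ?B" using z by auto
      qed
      then have "emeasure ?N ?P \<le> emeasure ?N (?A \<times> ?B)"
        using Am by (intro emeasure_mono) auto
      also have "\<dots> = emeasure M ?A * emeasure lborel ?B"
        using Am by (intro lborel.emeasure_pair_measure_Times) auto
      also have "emeasure M ?A = emeasure (hausdorff_measure (?d - 1)) ?A"
        unfolding M_def using Gm by (intro emeasure_restrict_space) auto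
      also have "emeasure lborel ?B = ennreal (2 * (\<kappa> * D))" using \<kappa> D by simp
      also have "emeasure (hausdorff_measure (?d - 1)) ?A * ennreal (2 * (\<kappa> * D)) \<le>
          ennreal (?\<omega> * (6 * \<kappa>) ^ ?d * (\<kappa> * D) ^ (?d - 1)) * ennreal (2 * (\<kappa> * D))"
        using \<kappa> D by (intro mult_right_mono hausdorff_graph_ball_le[OF G]) auto
      also have "\<dots> = ennreal (?\<omega> * (6 * \<kappa>) ^ ?d * (\<kappa> * D) ^ (?d - 1) * (2 * (\<kappa> * D)))"
        using \<kappa> D by (subst ennreal_mult) auto
      also have "?\<omega> * (6 * \<kappa>) ^ ?d * (\<kappa> * D) ^ (?d - 1) * (2 * (\<kappa> * D)) = C * l ^ ?d"
      proof -
        have "(\<kappa> * D) ^ (?d - 1) * (\<kappa> * D) = (\<kappa> * D) ^ ?d" by (rule power_minus_mult) simp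
        also have "\<dots> = (\<kappa> * real ?d) ^ ?d * l ^ ?d" by (simp add: D_def power_mult_distrib[symmetric] mult.assoc)
        finally have "(2 * ?\<omega> * (6 * \<kappa>) ^ ?d) * ((\<kappa> * D) ^ (?d - 1) * (\<kappa> * D)) = C * l ^ ?d"
          by (simp only: C_def mult.assoc)
        then show ?thesis by (simp only: mult_ac)
      qed
      finally show ?thesis unfolding em .
    qed
  qed
  have le: "\<nu> \<le> scale_measure (ennreal C) lborel"
  proof (subst le_measure)
    show "sets \<nu> = sets (scale_measure (ennreal C) lborel)" by (simp add: \<nu>_def)
    show "\<forall>A\<in>sets \<nu>. emeasure \<nu> A \<le> emeasure (scale_measure (ennreal C) lborel) A"
    proof
    fix A :: "'a set" assume "A \<in> sets \<nu>"
    then have A: "A \<in> sets borel" by (simp add: \<nu>_def)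
    show "emeasure \<nu> A \<le> emeasure (scale_measure (ennreal C) lborel) A"
      unfolding emeasure_scale_measure
      by (rule emeasure_le_lborel_if_cubes[OF _ C cube A]) (simp_all add: \<nu>_def)
    qed
  qed
  have "(\<integral>\<^sup>+x. \<integral>\<^sup>+s. F (x + s *\<^sub>R e) \<partial>lborel \<partial>M) \<le> ennreal C * (\<integral>\<^sup>+y. F y \<partial>lborel)"
    if F: "F \<in> borel_measurable borel" for F :: "'a \<Rightarrow> ennreal"
  proof -
    have "(\<integral>\<^sup>+x. \<integral>\<^sup>+s. F (x + s *\<^sub>R e) \<partial>lborel \<partial>M) = (\<integral>\<^sup>+z. F (?T z) \<partial>?N)"
      using lborel.nn_integral_fst[OF measurable_compose[OF Tm F]] by simp
    also have "\<dots> = (\<integral>\<^sup>+y. F y \<partial>\<nu>)"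
      unfolding \<nu>_def using Tm F by (subst nn_integral_distr) auto
    also have "\<dots> \<le> (\<integral>\<^sup>+y. F y \<partial>scale_measure (ennreal C) lborel)"
      by (rule nn_integral_mono_measure[OF _ le]) (simp add: \<nu>_def)
    also have "\<dots> = ennreal C * (\<integral>\<^sup>+y. F y \<partial>lborel)"
      using F by (intro nn_integral_scale_measure) simp
    finally show ?thesis .
  qed
  then show ?thesis using that C unfolding M_def by blast
qed

section \<open>The Sobolev space\<close>

lemma integrable_lebesgue_on_subset:
  fixes f :: "'a::euclidean_space \<Rightarrow> real"
  assumes "integrable (lebesgue_on S) f" "T \<subseteq> S" "S \<in> sets lebesgue" "T \<in> sets lebesgue"
  shows "integrable (lebesgue_on T) f"
proof -
  have "integrable lebesgue (\<lambda>x. indicator S x *\<^sub>R f x)"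
    using assms by (simp add: integrable_restrict_space)
  from integrable_mult_indicator[OF _ this, of T]
  have "integrable lebesgue (\<lambda>x. indicator T x *\<^sub>R (indicator S x *\<^sub>R f x))" using assms by simp
  moreover have "(\<lambda>x. indicator T x *\<^sub>R (indicator S x *\<^sub>R f x)) = (\<lambda>x. indicator T x *\<^sub>R f x)"
    using assms(2) by (auto simp: fun_eq_iff indicator_def)
  ultimately have "integrable lebesgue (\<lambda>x. indicator T x *\<^sub>R f x)" by (simp only:)
  then show ?thesis using assms(4) by (subst integrable_restrict_space) simp_all
qed

lemma continuous_integrable_lebesgue_on_bounded:
  fixes f :: "'a::euclidean_space \<Rightarrow> real"
  assumes "continuous_on UNIV f" "bounded S" "open S"
  shows "integrable (lebesgue_on S) f"
proof (rule integrable_lebesgue_on_subset[OF _ closure_subset])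
  show "integrable (lebesgue_on (closure S)) f"
    by (rule continuous_imp_integrable_on_compact[OF assms(1)]) (use assms(2) in simp)
qed (use assms(3) in simp_all)

lemma continuous_L2_lebesgue_on_bounded:
  fixes f :: "'a::euclidean_space \<Rightarrow> 'b::euclidean_space"
  assumes "continuous_on UNIV f" "bounded S" "open S"
  shows "f \<in> L2 (lebesgue_on S)"
  unfolding L2_iff
proof
  show "f \<in> borel_measurable (lebesgue_on S)"
    by (rule continuous_imp_borel_measurable_lebesgue_on[OF assms(1)])
  show "integrable (lebesgue_on S) (\<lambda>x. (norm (f x))\<^sup>2)"
    using assms by (intro continuous_integrable_lebesgue_on_bounded continuous_intros) auto
qed

lemma wgrad_props:
  assumes "f \<in> H1 \<Omega>"
  shows "wgrad \<Omega> f \<in> L2 (lebesgue_on \<Omega>)" "has_weak_grad \<Omega> f (wgrad \<Omega> f)"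
proof -
  have "\<exists>g. g \<in> L2 (lebesgue_on \<Omega>) \<and> has_weak_grad \<Omega> f g" using assms by (auto simp: H1_def)
  from someI_ex[OF this] show "wgrad \<Omega> f \<in> L2 (lebesgue_on \<Omega>)" "has_weak_grad \<Omega> f (wgrad \<Omega> f)"
    by (auto simp: wgrad_def)
qed

lemma H1_imp_L2: "f \<in> H1 \<Omega> \<Longrightarrow> f \<in> L2 (lebesgue_on \<Omega>)"
  by (simp add: H1_def)

text \<open>The weak gradient is selected by a choice operator; uniqueness identifies the selected one
  with any weak gradient that is known explicitly.\<close>

lemma wgrad_AE_eq:
  assumes "open \<Omega>" "f \<in> H1 \<Omega>" "has_weak_grad \<Omega> f g"
  shows "AE x in lebesgue_on \<Omega>. wgrad \<Omega> f x = g x"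
  using has_weak_grad_unique[OF assms(1) wgrad_props(2)[OF assms(2)] assms(3)] .

lemma H1_lincomb:
  assumes \<Omega>: "open \<Omega>" and f: "f \<in> H1 \<Omega>" and g: "g \<in> H1 \<Omega>"
  shows "(\<lambda>x. f x + c * g x) \<in> H1 \<Omega>"
    "AE x in lebesgue_on \<Omega>. wgrad \<Omega> (\<lambda>x. f x + c * g x) x = wgrad \<Omega> f x + c *\<^sub>R wgrad \<Omega> g x"
proof -
  have w: "has_weak_grad \<Omega> (\<lambda>x. f x + c * g x) (\<lambda>x. wgrad \<Omega> f x + c *\<^sub>R wgrad \<Omega> g x)"
    by (rule has_weak_grad_lincomb[OF wgrad_props(2)[OF f] wgrad_props(2)[OF g]]) (use \<Omega> in simp)
  have "(\<lambda>x. wgrad \<Omega> f x + c *\<^sub>R wgrad \<Omega> g x) \<in> L2 (lebesgue_on \<Omega>)"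
    by (rule L2_lincomb[OF wgrad_props(1)[OF f] wgrad_props(1)[OF g]])
  moreover have "(\<lambda>x. f x + c * g x) \<in> L2 (lebesgue_on \<Omega>)"
    using L2_lincomb[OF H1_imp_L2[OF f] H1_imp_L2[OF g], of c] by simp
  ultimately show h: "(\<lambda>x. f x + c * g x) \<in> H1 \<Omega>"
    unfolding H1_def using w by blast
  show "AE x in lebesgue_on \<Omega>. wgrad \<Omega> (\<lambda>x. f x + c * g x) x = wgrad \<Omega> f x + c *\<^sub>R wgrad \<Omega> g x"
    by (rule wgrad_AE_eq[OF \<Omega> h w])
qed

lemma H1_norm_nonneg [simp]: "0 \<le> H1_norm \<Omega> f"
  by (simp add: H1_norm_def)

lemma H1_norm_power2: "(H1_norm \<Omega> f)\<^sup>2 = (L2_norm (lebesgue_on \<Omega>) f)\<^sup>2 + (L2_norm (lebesgue_on \<Omega>) (wgrad \<Omega> f))\<^sup>2"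
  by (simp add: H1_norm_def)

lemma L2_norm_wgrad_lincomb:
  assumes "open \<Omega>" "f \<in> H1 \<Omega>" "g \<in> H1 \<Omega>"
  shows "L2_norm (lebesgue_on \<Omega>) (wgrad \<Omega> (\<lambda>x. f x + c * g x)) =
    L2_norm (lebesgue_on \<Omega>) (\<lambda>x. wgrad \<Omega> f x + c *\<^sub>R wgrad \<Omega> g x)"
  by (rule L2_norm_cong_AE[OF L2_measurable[OF wgrad_props(1)[OF H1_lincomb(1)[OF assms]]]
        L2_measurable[OF L2_lincomb[OF wgrad_props(1)[OF assms(2)] wgrad_props(1)[OF assms(3)]]]
        H1_lincomb(2)[OF assms]])

text \<open>The norm is a Euclidean norm of two seminorms, so the triangle inequality in the plane
  applies.\<close>

lemma H1_norm_lincomb_le: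
  assumes \<Omega>: "open \<Omega>" and f: "f \<in> H1 \<Omega>" and g: "g \<in> H1 \<Omega>"
  shows "H1_norm \<Omega> (\<lambda>x. f x + c * g x) \<le> H1_norm \<Omega> f + \<bar>c\<bar> * H1_norm \<Omega> g"
proof -
  let ?N = "\<lambda>f. L2_norm (lebesgue_on \<Omega>) f" and ?G = "\<lambda>f. L2_norm (lebesgue_on \<Omega>) (wgrad \<Omega> f)"
  have 1: "?N (\<lambda>x. f x + c * g x) \<le> ?N f + \<bar>c\<bar> * ?N g"
    using L2_norm_triangle[OF H1_imp_L2[OF f] L2_cmult[OF H1_imp_L2[OF g], of c]]
      L2_norm_scale[of "lebesgue_on \<Omega>" c g] by simp
  have "(\<lambda>x. c *\<^sub>R wgrad \<Omega> g x) \<in> L2 (lebesgue_on \<Omega>)"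
    using L2_lincomb[OF L2_diff[OF wgrad_props(1)[OF g] wgrad_props(1)[OF g]] wgrad_props(1)[OF g], of c] by simp
  then have 2: "?G (\<lambda>x. f x + c * g x) \<le> ?G f + \<bar>c\<bar> * ?G g"
    unfolding L2_norm_wgrad_lincomb[OF \<Omega> f g]
    using L2_norm_triangle[OF wgrad_props(1)[OF f], of "\<lambda>x. c *\<^sub>R wgrad \<Omega> g x"]
      L2_norm_scale[of "lebesgue_on \<Omega>" c "wgrad \<Omega> g"] by simp
  have "H1_norm \<Omega> (\<lambda>x. f x + c * g x) \<le> sqrt ((?N f + \<bar>c\<bar> * ?N g)\<^sup>2 + (?G f + \<bar>c\<bar> * ?G g)\<^sup>2)"
    unfolding H1_norm_def using 1 2 by (intro real_sqrt_le_mono add_mono power_mono) auto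
  also have "\<dots> \<le> sqrt ((?N f)\<^sup>2 + (?G f)\<^sup>2) + sqrt ((\<bar>c\<bar> * ?N g)\<^sup>2 + (\<bar>c\<bar> * ?G g)\<^sup>2)"
    by (rule real_sqrt_sum_squares_triangle_ineq)
  also have "sqrt ((\<bar>c\<bar> * ?N g)\<^sup>2 + (\<bar>c\<bar> * ?G g)\<^sup>2) = \<bar>c\<bar> * H1_norm \<Omega> g"
    unfolding H1_norm_def power_mult_distrib distrib_left[symmetric] by (simp add: real_sqrt_mult)
  finally show ?thesis by (simp add: H1_norm_def)
qed

lemma smooth_in_H1:
  assumes "open \<Omega>" "bounded \<Omega>" "smooth \<phi>" shows "\<phi> \<in> H1 \<Omega>"
proof -
  have "has_weak_grad \<Omega> \<phi> (cgrad \<phi>)" using assms by (intro smooth_has_weak_grad) auto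
  moreover have "cgrad \<phi> \<in> L2 (lebesgue_on \<Omega>)"
    by (rule continuous_L2_lebesgue_on_bounded[OF cgrad_continuous_on[OF assms(3)] assms(2,1)])
  moreover have "\<phi> \<in> L2 (lebesgue_on \<Omega>)"
    by (rule continuous_L2_lebesgue_on_bounded[OF smooth_imp_continuous_on[OF assms(3)] assms(2,1)])
  ultimately show ?thesis by (auto simp: H1_def)
qed

lemma H1_norm_smooth:
  assumes \<Omega>: "open \<Omega>" "bounded \<Omega>" and \<phi>: "smooth \<phi>"
  shows "integrable (lebesgue_on \<Omega>) (sq_density \<phi>)"
    "(H1_norm \<Omega> \<phi>)\<^sup>2 = (\<integral>x. sq_density \<phi> x \<partial>lebesgue_on \<Omega>)"
proof -
  have h: "\<phi> \<in> H1 \<Omega>" by (rule smooth_in_H1[OF \<Omega> \<phi>])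
  have c: "cgrad \<phi> \<in> L2 (lebesgue_on \<Omega>)"
    by (rule continuous_L2_lebesgue_on_bounded[OF cgrad_continuous_on[OF \<phi>] \<Omega>(2,1)])
  have "has_weak_grad \<Omega> \<phi> (cgrad \<phi>)" using \<Omega> \<phi> by (intro smooth_has_weak_grad) auto
  then have "AE x in lebesgue_on \<Omega>. wgrad \<Omega> \<phi> x = cgrad \<phi> x" by (rule wgrad_AE_eq[OF \<Omega>(1) h])
  then have e: "L2_norm (lebesgue_on \<Omega>) (wgrad \<Omega> \<phi>) = L2_norm (lebesgue_on \<Omega>) (cgrad \<phi>)"
    by (rule L2_norm_cong_AE[OF L2_measurable[OF wgrad_props(1)[OF h]] L2_measurable[OF c]])
  have i: "integrable (lebesgue_on \<Omega>) (\<lambda>x. (norm (\<phi> x))\<^sup>2)" "integrable (lebesgue_on \<Omega>) (\<lambda>x. (norm (cgrad \<phi> x))\<^sup>2)"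
    using H1_imp_L2[OF h] c by (auto simp: L2_iff)
  show "integrable (lebesgue_on \<Omega>) (sq_density \<phi>)"
    using Bochner_Integration.integrable_add[OF i] by (simp add: sq_density_def[abs_def])
  have "(H1_norm \<Omega> \<phi>)\<^sup>2 = (\<integral>x. (norm (\<phi> x))\<^sup>2 \<partial>lebesgue_on \<Omega>) + (\<integral>x. (norm (cgrad \<phi> x))\<^sup>2 \<partial>lebesgue_on \<Omega>)"
    unfolding H1_norm_power2 e by (simp add: L2_norm_def)
  also have "\<dots> = (\<integral>x. sq_density \<phi> x \<partial>lebesgue_on \<Omega>)"
    using Bochner_Integration.integral_add[OF i] by (simp add: sq_density_def[abs_def])
  finally show "(H1_norm \<Omega> \<phi>)\<^sup>2 = (\<integral>x. sq_density \<phi> x \<partial>lebesgue_on \<Omega>)" .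
qed

section \<open>Traces\<close>

text \<open>Bound the boundary values by integrals along segments in direction \<open>e\<close>, which run inside
  the domain, and transport the double integral to the domain.\<close>

lemma local_trace_inequality:
  fixes \<Omega> :: "'a::euclidean_space set"
  assumes \<Omega>: "smooth_boundary \<Omega>" "open \<Omega>" and p: "p \<in> frontier \<Omega>"
  shows "\<exists>r>0. \<exists>C\<ge>0. \<forall>\<phi>. smooth \<phi> \<longrightarrow>
    (\<integral>\<^sup>+x. ennreal ((\<phi> x)\<^sup>2) * indicator (frontier \<Omega> \<inter> ball p r) x \<partial>hausdorff_measure (DIM('a) - 1)) \<le>
      ennreal C * (\<integral>\<^sup>+x. ennreal (sq_density \<phi> x) \<partial>lebesgue_on \<Omega>)"
proof -
  obtain r e \<kappa> where r: "0 < r" and G: "graph_like \<kappa> e (frontier \<Omega> \<inter> ball p r)"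
    and ins: "\<And>x s. x \<in> frontier \<Omega> \<inter> ball p r \<Longrightarrow> 0 < s \<Longrightarrow> s < r \<Longrightarrow> x + s *\<^sub>R e \<in> \<Omega>"
    by (rule smooth_boundary_chart[OF \<Omega> p]) (rule that)
  let ?G = "frontier \<Omega> \<inter> ball p r" and ?\<sigma> = "hausdorff_measure (DIM('a) - 1) :: 'a measure"
  have Gm: "?G \<in> sets borel" by auto
  obtain C where C: "0 \<le> C" and tr: "\<And>F. F \<in> borel_measurable borel \<Longrightarrow>
      (\<integral>\<^sup>+x. \<integral>\<^sup>+s. F (x + s *\<^sub>R e) \<partial>lborel \<partial>restrict_space ?\<sigma> ?G) \<le> ennreal C * (\<integral>\<^sup>+y. F y \<partial>lborel)"
    by (rule graph_transport[OF Gm G]) (rule that)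
  have e: "norm e = 1" using G by (simp add: graph_like_def)
  define c0 where "c0 = 1 + 1 / r"
  have c0: "0 \<le> c0" using r by (simp add: c0_def)
  have "(\<integral>\<^sup>+x. ennreal ((\<phi> x)\<^sup>2) * indicator ?G x \<partial>?\<sigma>) \<le>
      ennreal (C * c0) * (\<integral>\<^sup>+x. ennreal (sq_density \<phi> x) \<partial>lebesgue_on \<Omega>)" if \<phi>: "smooth \<phi>" for \<phi>
  proof -
    define F where "F y = ennreal c0 * (ennreal (sq_density \<phi> y) * indicator \<Omega> y)" for y
    have cq: "continuous_on UNIV (sq_density \<phi>)" by (rule continuous_on_sq_density[OF \<phi>])
    have qm: "(\<lambda>y. ennreal (sq_density \<phi> y)) \<in> borel_measurable borel"
      using borel_measurable_continuous_onI[OF cq] by measurable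
    have Fm: "F \<in> borel_measurable borel"
      unfolding F_def using qm \<Omega>(2) by (intro borel_measurable_times_ennreal borel_measurable_indicator) auto
    have "(\<integral>\<^sup>+x. ennreal ((\<phi> x)\<^sup>2) * indicator ?G x \<partial>?\<sigma>) = (\<integral>\<^sup>+x. ennreal ((\<phi> x)\<^sup>2) \<partial>restrict_space ?\<sigma> ?G)"
      using Gm by (subst nn_integral_restrict_space) auto
    also have "\<dots> \<le> (\<integral>\<^sup>+x. \<integral>\<^sup>+s. F (x + s *\<^sub>R e) \<partial>lborel \<partial>restrict_space ?\<sigma> ?G)"
    proof (rule nn_integral_mono)
      fix x assume "x \<in> space (restrict_space ?\<sigma> ?G)"
      then have x: "x \<in> ?G" by (simp add: space_restrict_space)
      have lm: "(\<lambda>s. x + s *\<^sub>R e) \<in> borel_measurable borel" by simp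
      have "ennreal ((\<phi> x)\<^sup>2) \<le> ennreal c0 * (\<integral>\<^sup>+s. ennreal (sq_density \<phi> (x + s *\<^sub>R e)) * indicator {0<..<r} s \<partial>lborel)"
        unfolding c0_def by (rule endpoint_le_line_integral[OF \<phi> e r])
      also have "\<dots> = (\<integral>\<^sup>+s. ennreal c0 * (ennreal (sq_density \<phi> (x + s *\<^sub>R e)) * indicator {0<..<r} s) \<partial>lborel)"
      proof (rule nn_integral_cmult[symmetric])
        show "(\<lambda>s. ennreal (sq_density \<phi> (x + s *\<^sub>R e)) * indicator {0<..<r} s) \<in> borel_measurable lborel"
          using measurable_compose[OF lm qm] by (intro borel_measurable_times_ennreal borel_measurable_indicator) auto
      qed
      also have "\<dots> \<le> (\<integral>\<^sup>+s. F (x + s *\<^sub>R e) \<partial>lborel)"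
      proof (rule nn_integral_mono)
        fix s :: real
        show "ennreal c0 * (ennreal (sq_density \<phi> (x + s *\<^sub>R e)) * indicator {0<..<r} s) \<le> F (x + s *\<^sub>R e)"
          using ins[OF x, of s] by (cases "0 < s \<and> s < r") (auto simp: F_def indicator_def)
      qed
      finally show "ennreal ((\<phi> x)\<^sup>2) \<le> (\<integral>\<^sup>+s. F (x + s *\<^sub>R e) \<partial>lborel)" .
    qed
    also have "\<dots> \<le> ennreal C * (\<integral>\<^sup>+y. F y \<partial>lborel)" by (rule tr[OF Fm])
    also have "(\<integral>\<^sup>+y. F y \<partial>lborel) = ennreal c0 * (\<integral>\<^sup>+y. ennreal (sq_density \<phi> y) * indicator \<Omega> y \<partial>lborel)"
      unfolding F_def using qm \<Omega>(2)
      by (intro nn_integral_cmult borel_measurable_times_ennreal borel_measurable_indicator) auto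
    also have "(\<integral>\<^sup>+y. ennreal (sq_density \<phi> y) * indicator \<Omega> y \<partial>lborel) = (\<integral>\<^sup>+x. ennreal (sq_density \<phi> x) \<partial>lebesgue_on \<Omega>)"
      using \<Omega>(2) by (subst nn_integral_restrict_space) (auto simp: nn_integral_completion)
    finally show ?thesis using C c0 by (simp add: ennreal_mult mult.assoc)
  qed
  moreover have "0 \<le> C * c0" using C c0 by simp
  ultimately show ?thesis using r by blast
qed

lemma trace_inequality_smooth:
  fixes \<Omega> :: "'a::euclidean_space set"
  assumes "smooth_bounded_domain \<Omega>"
  obtains C where "0 \<le> C" "\<And>\<phi>. smooth \<phi> \<Longrightarrow>
    (\<integral>\<^sup>+x. ennreal ((\<phi> x)\<^sup>2) \<partial>surface_on (frontier \<Omega>)) \<le> ennreal C * (\<integral>\<^sup>+x. ennreal (sq_density \<phi> x) \<partial>lebesgue_on \<Omega>)"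
proof -
  have \<Omega>: "open \<Omega>" "bounded \<Omega>" "smooth_boundary \<Omega>" using assms by (auto simp: smooth_bounded_domain_def)
  let ?\<sigma> = "hausdorff_measure (DIM('a) - 1) :: 'a measure"
  define good where "good p r C \<longleftrightarrow> (\<forall>\<phi>. smooth \<phi> \<longrightarrow>
    (\<integral>\<^sup>+x. ennreal ((\<phi> x)\<^sup>2) * indicator (frontier \<Omega> \<inter> ball p r) x \<partial>?\<sigma>) \<le>
      ennreal C * (\<integral>\<^sup>+x. ennreal (sq_density \<phi> x) \<partial>lebesgue_on \<Omega>))" for p r C
  have "\<exists>r>0. \<exists>C\<ge>0. good p r C" if "p \<in> frontier \<Omega>" for p
    unfolding good_def by (rule local_trace_inequality[OF \<Omega>(3,1) that])
  then obtain r C where rC: "\<And>p. p \<in> frontier \<Omega> \<Longrightarrow> 0 < r p" "\<And>p. p \<in> frontier \<Omega> \<Longrightarrow> 0 \<le> C p"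
    "\<And>p. p \<in> frontier \<Omega> \<Longrightarrow> good p (r p) (C p)"
    by metis
  have "compact (frontier \<Omega>)" using \<Omega>(2) by (rule compact_frontier_bounded)
  then obtain P where P: "P \<subseteq> frontier \<Omega>" "finite P" "frontier \<Omega> \<subseteq> (\<Union>p\<in>P. ball p (r p))"
  proof (rule compactE_image)
    show "frontier \<Omega> \<subseteq> (\<Union>p\<in>frontier \<Omega>. ball p (r p))" using rC(1) by force
  qed (use that in auto)
  have "(\<integral>\<^sup>+x. ennreal ((\<phi> x)\<^sup>2) \<partial>surface_on (frontier \<Omega>)) \<le> ennreal (\<Sum>p\<in>P. C p) * (\<integral>\<^sup>+x. ennreal (sq_density \<phi> x) \<partial>lebesgue_on \<Omega>)"
    if \<phi>: "smooth \<phi>" for \<phi>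
  proof -
    have \<phi>m: "(\<lambda>x. ennreal ((\<phi> x)\<^sup>2)) \<in> borel_measurable borel"
      using borel_measurable_continuous_onI[OF smooth_imp_continuous_on[OF \<phi>]] by measurable
    have "(\<integral>\<^sup>+x. ennreal ((\<phi> x)\<^sup>2) \<partial>surface_on (frontier \<Omega>)) = (\<integral>\<^sup>+x. ennreal ((\<phi> x)\<^sup>2) * indicator (frontier \<Omega>) x \<partial>?\<sigma>)"
      unfolding surface_on_def by (subst nn_integral_restrict_space) auto
    also have "\<dots> \<le> (\<integral>\<^sup>+x. (\<Sum>p\<in>P. ennreal ((\<phi> x)\<^sup>2) * indicator (frontier \<Omega> \<inter> ball p (r p)) x) \<partial>?\<sigma>)"
    proof (rule nn_integral_mono)
      fix x
      show "ennreal ((\<phi> x)\<^sup>2) * indicator (frontier \<Omega>) x \<le> (\<Sum>p\<in>P. ennreal ((\<phi> x)\<^sup>2) * indicator (frontier \<Omega> \<inter> ball p (r p)) x)"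
      proof (cases "x \<in> frontier \<Omega>")
        case True
        then obtain p where p: "p \<in> P" "x \<in> ball p (r p)" using P(3) by blast
        have "ennreal ((\<phi> x)\<^sup>2) * indicator (frontier \<Omega>) x = ennreal ((\<phi> x)\<^sup>2) * indicator (frontier \<Omega> \<inter> ball p (r p)) x"
          using True p by (simp add: indicator_def)
        also have "\<dots> \<le> (\<Sum>p\<in>P. ennreal ((\<phi> x)\<^sup>2) * indicator (frontier \<Omega> \<inter> ball p (r p)) x)"
          by (rule member_le_sum[OF p(1) _ P(2)]) simp
        finally show ?thesis .
      qed simp
    qed
    also have "\<dots> = (\<Sum>p\<in>P. \<integral>\<^sup>+x. ennreal ((\<phi> x)\<^sup>2) * indicator (frontier \<Omega> \<inter> ball p (r p)) x \<partial>?\<sigma>)"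
    proof (rule nn_integral_sum)
      fix p
      have "frontier \<Omega> \<inter> ball p (r p) \<in> sets ?\<sigma>" by auto
      moreover have "(\<lambda>x. ennreal ((\<phi> x)\<^sup>2)) \<in> borel_measurable ?\<sigma>"
        using \<phi>m measurable_cong_sets[OF sets_hausdorff_measure refl] by blast
      ultimately show "(\<lambda>x. ennreal ((\<phi> x)\<^sup>2) * indicator (frontier \<Omega> \<inter> ball p (r p)) x) \<in> borel_measurable ?\<sigma>"
        by (intro borel_measurable_times_ennreal borel_measurable_indicator)
    qed
    also have "\<dots> \<le> (\<Sum>p\<in>P. ennreal (C p) * (\<integral>\<^sup>+x. ennreal (sq_density \<phi> x) \<partial>lebesgue_on \<Omega>))"
    proof (rule sum_mono)
      fix p assume "p \<in> P"
      then have "good p (r p) (C p)" using rC(3) P(1) by blast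
      then show "(\<integral>\<^sup>+x. ennreal ((\<phi> x)\<^sup>2) * indicator (frontier \<Omega> \<inter> ball p (r p)) x \<partial>?\<sigma>) \<le>
          ennreal (C p) * (\<integral>\<^sup>+x. ennreal (sq_density \<phi> x) \<partial>lebesgue_on \<Omega>)"
        unfolding good_def using \<phi> by blast
    qed
    also have "\<dots> = (\<Sum>p\<in>P. ennreal (C p)) * (\<integral>\<^sup>+x. ennreal (sq_density \<phi> x) \<partial>lebesgue_on \<Omega>)"
      by (rule sum_distrib_right[symmetric])
    also have "(\<Sum>p\<in>P. ennreal (C p)) = ennreal (\<Sum>p\<in>P. C p)"
      using rC(2) P(1) by (intro sum_ennreal) blast
    finally show ?thesis .
  qed
  moreover have "0 \<le> (\<Sum>p\<in>P. C p)" using rC(2) P(1) by (intro sum_nonneg) blast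
  ultimately show ?thesis using that by blast
qed

text \<open>In particular smooth functions are square integrable over the boundary, a fact that the
  linearity of traces below rests on.\<close>

lemma smooth_boundary_values_L2:
  fixes \<Omega> :: "'a::euclidean_space set"
  assumes dom: "smooth_bounded_domain \<Omega>"
  obtains C where "0 \<le> C" "\<And>\<phi>. smooth \<phi> \<Longrightarrow> \<phi> \<in> L2 (surface_on (frontier \<Omega>)) \<and>
    L2_norm (surface_on (frontier \<Omega>)) \<phi> \<le> C * H1_norm \<Omega> \<phi>"
proof -
  have \<Omega>: "open \<Omega>" "bounded \<Omega>" using dom by (auto simp: smooth_bounded_domain_def)
  let ?S = "surface_on (frontier \<Omega>)"
  obtain C where C: "0 \<le> C" and tr: "\<And>\<phi>. smooth \<phi> \<Longrightarrow>
    (\<integral>\<^sup>+x. ennreal ((\<phi> x)\<^sup>2) \<partial>?S) \<le> ennreal C * (\<integral>\<^sup>+x. ennreal (sq_density \<phi> x) \<partial>lebesgue_on \<Omega>)"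
    by (rule trace_inequality_smooth[OF dom]) (rule that)
  have sm: "\<phi> \<in> L2 ?S \<and> L2_norm ?S \<phi> \<le> sqrt C * H1_norm \<Omega> \<phi>" if \<phi>: "smooth \<phi>" for \<phi>
  proof -
    have "(\<integral>\<^sup>+x. ennreal (sq_density \<phi> x) \<partial>lebesgue_on \<Omega>) = ennreal ((H1_norm \<Omega> \<phi>)\<^sup>2)"
      unfolding H1_norm_smooth(2)[OF \<Omega> \<phi>]
      by (rule nn_integral_eq_integral[OF H1_norm_smooth(1)[OF \<Omega> \<phi>]]) (simp add: sq_density_nonneg)
    then have le: "(\<integral>\<^sup>+x. ennreal ((\<phi> x)\<^sup>2) \<partial>?S) \<le> ennreal (C * (H1_norm \<Omega> \<phi>)\<^sup>2)"
      using tr[OF \<phi>] C by (simp add: ennreal_mult)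
    have m: "\<phi> \<in> borel_measurable ?S"
      unfolding surface_on_def
      using borel_measurable_continuous_onI[OF smooth_imp_continuous_on[OF \<phi>]]
      by (intro measurable_restrict_space1) (simp add: measurable_cong_sets[OF sets_hausdorff_measure refl])
    have i: "integrable ?S (\<lambda>x. (\<phi> x)\<^sup>2)"
    proof (rule integrableI_bounded)
      show "(\<integral>\<^sup>+x. ennreal (norm ((\<phi> x)\<^sup>2)) \<partial>?S) < \<infinity>"
        using le by (simp add: order_le_less_trans)
    qed (use m in simp)
    then have L: "\<phi> \<in> L2 ?S" using m by (simp add: L2_iff)
    have "ennreal (\<integral>x. (\<phi> x)\<^sup>2 \<partial>?S) = (\<integral>\<^sup>+x. ennreal ((\<phi> x)\<^sup>2) \<partial>?S)"
      by (rule nn_integral_eq_integral[OF i, symmetric]) simp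
    then have "ennreal (\<integral>x. (\<phi> x)\<^sup>2 \<partial>?S) \<le> ennreal (C * (H1_norm \<Omega> \<phi>)\<^sup>2)" using le by (simp only:)
    then have "(\<integral>x. (\<phi> x)\<^sup>2 \<partial>?S) \<le> C * (H1_norm \<Omega> \<phi>)\<^sup>2"
      by (subst (asm) ennreal_le_iff) (use C in simp_all)
    then have "L2_norm ?S \<phi> \<le> sqrt (C * (H1_norm \<Omega> \<phi>)\<^sup>2)" by (simp add: L2_norm_def)
    then show ?thesis using L by (simp add: real_sqrt_mult)
  qed
  then show ?thesis using that[of "sqrt C"] C by simp
qed

text \<open>Pass to the limit in the inequality for the smooth functions that define the trace.\<close>

lemma trace_inequality:
  fixes \<Omega> :: "'a::euclidean_space set"
  assumes dom: "smooth_bounded_domain \<Omega>"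
  obtains C where "0 \<le> C" "\<And>f g. is_trace \<Omega> f g \<Longrightarrow> L2_norm (surface_on (frontier \<Omega>)) g \<le> C * H1_norm \<Omega> f"
proof -
  have \<Omega>: "open \<Omega>" "bounded \<Omega>" using dom by (auto simp: smooth_bounded_domain_def)
  let ?S = "surface_on (frontier \<Omega>)"
  obtain C where C: "0 \<le> C" and sm: "\<And>\<phi>. smooth \<phi> \<Longrightarrow> \<phi> \<in> L2 ?S \<and> L2_norm ?S \<phi> \<le> C * H1_norm \<Omega> \<phi>"
    by (rule smooth_boundary_values_L2[OF dom]) (rule that)
  have "L2_norm ?S g \<le> C * H1_norm \<Omega> f" if t: "is_trace \<Omega> f g" for f g
  proof -
    obtain \<phi> :: "nat \<Rightarrow> 'a \<Rightarrow> real" where \<phi>: "\<And>k. smooth (\<phi> k)" and f: "f \<in> H1 \<Omega>" and g: "g \<in> L2 ?S"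
      and l1: "(\<lambda>k. H1_norm \<Omega> (\<lambda>x. \<phi> k x - f x)) \<longlonglongrightarrow> 0"
      and l2: "(\<lambda>k. L2_norm ?S (\<lambda>x. \<phi> k x - g x)) \<longlonglongrightarrow> 0"
      using t unfolding is_trace_def by blast
    have le: "L2_norm ?S g \<le> L2_norm ?S (\<lambda>x. \<phi> k x - g x) + C * (H1_norm \<Omega> (\<lambda>x. \<phi> k x - f x) + H1_norm \<Omega> f)" for k
    proof -
      have h: "\<phi> k \<in> H1 \<Omega>" by (rule smooth_in_H1[OF \<Omega> \<phi>])
      have "H1_norm \<Omega> (\<phi> k) \<le> H1_norm \<Omega> (\<lambda>x. \<phi> k x - f x) + H1_norm \<Omega> f"
        using H1_norm_lincomb_le[OF \<Omega>(1) H1_lincomb(1)[OF \<Omega>(1) h f, of "-1"] f, of 1] by simp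
      then have "C * H1_norm \<Omega> (\<phi> k) \<le> C * (H1_norm \<Omega> (\<lambda>x. \<phi> k x - f x) + H1_norm \<Omega> f)"
        using C by (intro mult_left_mono) auto
      moreover have "L2_norm ?S g \<le> L2_norm ?S (\<lambda>x. \<phi> k x - g x) + L2_norm ?S (\<phi> k)"
        using L2_norm_diff_bound[OF _ g, of "\<phi> k"] sm[OF \<phi>, of k] by linarith
      ultimately show ?thesis using sm[OF \<phi>, of k] by linarith
    qed
    have "(\<lambda>k. L2_norm ?S (\<lambda>x. \<phi> k x - g x) + C * (H1_norm \<Omega> (\<lambda>x. \<phi> k x - f x) + H1_norm \<Omega> f))
        \<longlonglongrightarrow> 0 + C * (0 + H1_norm \<Omega> f)"
      by (intro tendsto_intros l1 l2)
    from LIMSEQ_le_const[OF this, of "L2_norm ?S g"] le show ?thesis by auto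
  qed
  then show ?thesis using that[of C] C by simp
qed

lemma is_trace_lincomb:
  fixes \<Omega> :: "'a::euclidean_space set"
  assumes dom: "smooth_bounded_domain \<Omega>" and f: "is_trace \<Omega> f f'" and g: "is_trace \<Omega> g g'"
  shows "is_trace \<Omega> (\<lambda>x. f x + c * g x) (\<lambda>x. f' x + c * g' x)"
proof -
  have \<Omega>: "open \<Omega>" "bounded \<Omega>" using dom by (auto simp: smooth_bounded_domain_def)
  let ?S = "surface_on (frontier \<Omega>)"
  have smL: "\<phi> \<in> L2 ?S" if "smooth \<phi>" for \<phi>
    by (rule smooth_boundary_values_L2[OF dom]) (use that in blast)
  obtain \<phi> :: "nat \<Rightarrow> 'a \<Rightarrow> real" where \<phi>: "\<And>k. smooth (\<phi> k)" and fH: "f \<in> H1 \<Omega>" and f': "f' \<in> L2 ?S"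
    and l1: "(\<lambda>k. H1_norm \<Omega> (\<lambda>x. \<phi> k x - f x)) \<longlonglongrightarrow> 0"
    and l2: "(\<lambda>k. L2_norm ?S (\<lambda>x. \<phi> k x - f' x)) \<longlonglongrightarrow> 0"
    using f unfolding is_trace_def by blast
  obtain \<psi> :: "nat \<Rightarrow> 'a \<Rightarrow> real" where \<psi>: "\<And>k. smooth (\<psi> k)" and gH: "g \<in> H1 \<Omega>" and g': "g' \<in> L2 ?S"
    and m1: "(\<lambda>k. H1_norm \<Omega> (\<lambda>x. \<psi> k x - g x)) \<longlonglongrightarrow> 0"
    and m2: "(\<lambda>k. L2_norm ?S (\<lambda>x. \<psi> k x - g' x)) \<longlonglongrightarrow> 0"
    using g unfolding is_trace_def by blast
  have d1: "(\<lambda>x. \<phi> k x - f x) \<in> H1 \<Omega>" for k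
    using H1_lincomb(1)[OF \<Omega>(1) smooth_in_H1[OF \<Omega> \<phi>, of k] fH, of "-1"] by simp
  have e1: "(\<lambda>x. \<psi> k x - g x) \<in> H1 \<Omega>" for k
    using H1_lincomb(1)[OF \<Omega>(1) smooth_in_H1[OF \<Omega> \<psi>, of k] gH, of "-1"] by simp
  have eq: "(\<phi> k x + c * \<psi> k x) - (u x + c * v x) = (\<phi> k x - u x) + c * (\<psi> k x - v x)" for k x u v
    by (simp add: algebra_simps)
  have "(\<lambda>k. H1_norm \<Omega> (\<lambda>x. (\<phi> k x + c * \<psi> k x) - (f x + c * g x))) \<longlonglongrightarrow> 0"
  proof (rule Lim_null_comparison)
    show "\<forall>\<^sub>F k in sequentially. norm (H1_norm \<Omega> (\<lambda>x. (\<phi> k x + c * \<psi> k x) - (f x + c * g x)))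
        \<le> H1_norm \<Omega> (\<lambda>x. \<phi> k x - f x) + \<bar>c\<bar> * H1_norm \<Omega> (\<lambda>x. \<psi> k x - g x)"
      unfolding eq using H1_norm_lincomb_le[OF \<Omega>(1) d1 e1] by simp
    show "(\<lambda>k. H1_norm \<Omega> (\<lambda>x. \<phi> k x - f x) + \<bar>c\<bar> * H1_norm \<Omega> (\<lambda>x. \<psi> k x - g x)) \<longlonglongrightarrow> 0"
      using tendsto_add[OF l1 tendsto_mult_left[OF m1, of "\<bar>c\<bar>"]] by simp
  qed
  moreover have "(\<lambda>k. L2_norm ?S (\<lambda>x. (\<phi> k x + c * \<psi> k x) - (f' x + c * g' x))) \<longlonglongrightarrow> 0"
  proof (rule Lim_null_comparison)
    have "L2_norm ?S (\<lambda>x. (\<phi> k x - f' x) + c * (\<psi> k x - g' x))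
        \<le> L2_norm ?S (\<lambda>x. \<phi> k x - f' x) + \<bar>c\<bar> * L2_norm ?S (\<lambda>x. \<psi> k x - g' x)" for k
      using L2_norm_triangle[OF L2_diff[OF smL[OF \<phi>, of k] f'] L2_cmult[OF L2_diff[OF smL[OF \<psi>, of k] g'], of c]]
        L2_norm_scale[of ?S c "\<lambda>x. \<psi> k x - g' x"] by simp
    then show "\<forall>\<^sub>F k in sequentially. norm (L2_norm ?S (\<lambda>x. (\<phi> k x + c * \<psi> k x) - (f' x + c * g' x)))
        \<le> L2_norm ?S (\<lambda>x. \<phi> k x - f' x) + \<bar>c\<bar> * L2_norm ?S (\<lambda>x. \<psi> k x - g' x)"
      unfolding eq by simp
    show "(\<lambda>k. L2_norm ?S (\<lambda>x. \<phi> k x - f' x) + \<bar>c\<bar> * L2_norm ?S (\<lambda>x. \<psi> k x - g' x)) \<longlonglongrightarrow> 0"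
      using tendsto_add[OF l2 tendsto_mult_left[OF m2, of "\<bar>c\<bar>"]] by simp
  qed
  moreover have "smooth (\<lambda>x. \<phi> k x + c * \<psi> k x)" for k
    by (intro smooth_add smooth_cmult \<phi> \<psi>)
  moreover have "(\<lambda>x. f' x + c * g' x) \<in> L2 ?S" using L2_lincomb[OF f' g', of c] by simp
  moreover have "(\<lambda>x. f x + c * g x) \<in> H1 \<Omega>" by (rule H1_lincomb(1)[OF \<Omega>(1) fH gH])
  ultimately show ?thesis unfolding is_trace_def
    by (intro conjI exI[of _ "\<lambda>k x. \<phi> k x + c * \<psi> k x"] allI)
qed

lemma H1_zero_lincomb:
  assumes dom: "smooth_bounded_domain \<Omega>" and f: "f \<in> H1_zero \<Omega> \<Gamma>" and g: "g \<in> H1_zero \<Omega> \<Gamma>"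
  shows "(\<lambda>x. f x + c * g x) \<in> H1_zero \<Omega> \<Gamma>"
proof -
  obtain f' where f': "is_trace \<Omega> f f'" "AE x in surface_on (frontier \<Omega>). x \<in> \<Gamma> \<longrightarrow> f' x = 0"
    using f by (auto simp: H1_zero_def)
  obtain g' where g': "is_trace \<Omega> g g'" "AE x in surface_on (frontier \<Omega>). x \<in> \<Gamma> \<longrightarrow> g' x = 0"
    using g by (auto simp: H1_zero_def)
  have "AE x in surface_on (frontier \<Omega>). x \<in> \<Gamma> \<longrightarrow> f' x + c * g' x = 0"
    using f'(2) g'(2) by eventually_elim simp
  with is_trace_lincomb[OF dom f'(1) g'(1)] show ?thesis unfolding H1_zero_def by blast
qed

lemma H1_zero_imp_H1: "f \<in> H1_zero \<Omega> \<Gamma> \<Longrightarrow> f \<in> H1 \<Omega>"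
  by (auto simp: H1_zero_def is_trace_def)

section \<open>The energy identity for a scalar kernel\<close>

text \<open>Uniform continuity on a compact square around the segment \<open>[t1, t2]\<close> of the diagonal.\<close>

lemma uniform_near_diagonal:
  fixes F :: "real \<Rightarrow> real \<Rightarrow> real"
  assumes F: "continuous_on ({0<..<T} \<times> {0<..<T}) (\<lambda>p. F (fst p) (snd p))"
    and t: "0 < t1" "t2 < T" and \<eta>: "0 < \<eta>"
  shows "\<exists>\<epsilon>>0. \<forall>t\<in>{t1..t2}. \<forall>x y. \<bar>x - t\<bar> \<le> \<epsilon> \<longrightarrow> \<bar>y - t\<bar> \<le> \<epsilon> \<longrightarrow> \<bar>F x y - F t t\<bar> \<le> \<eta>"
proof -
  define \<delta> where "\<delta> = min t1 (T - t2) / 2"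
  have \<delta>: "0 < \<delta>" "\<delta> < t1" "\<delta> < T - t2" using t by (auto simp: \<delta>_def)
  let ?J = "{t1 - \<delta>..t2 + \<delta>}"
  have sub: "?J \<times> ?J \<subseteq> {0<..<T} \<times> {0<..<T}" using \<delta> by auto
  have "uniformly_continuous_on (?J \<times> ?J) (\<lambda>p. F (fst p) (snd p))"
    by (rule compact_uniformly_continuous[OF continuous_on_subset[OF F sub] compact_Times[OF compact_Icc compact_Icc]])
  then obtain d where d: "d > 0" "\<And>p q. p \<in> ?J \<times> ?J \<Longrightarrow> q \<in> ?J \<times> ?J \<Longrightarrow> dist q p < d \<Longrightarrow>
      dist (F (fst q) (snd q)) (F (fst p) (snd p)) < \<eta>"
    unfolding uniformly_continuous_on_def using \<eta> by metis
  define \<epsilon> where "\<epsilon> = min \<delta> (d / 4)"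
  have \<epsilon>: "\<epsilon> > 0" "\<epsilon> \<le> \<delta>" "\<epsilon> \<le> d / 4" using \<delta> d by (auto simp: \<epsilon>_def)
  have "\<bar>F x y - F t t\<bar> \<le> \<eta>" if "t \<in> {t1..t2}" "\<bar>x - t\<bar> \<le> \<epsilon>" "\<bar>y - t\<bar> \<le> \<epsilon>" for t x y
  proof -
    have "(t, t) \<in> ?J \<times> ?J" "(x, y) \<in> ?J \<times> ?J" using that \<epsilon> by auto
    moreover have "dist (x, y) (t, t) < d"
    proof -
      have "dist (x, y) (t, t) \<le> dist x t + dist y t"
        unfolding dist_prod_def fst_conv snd_conv by (rule sqrt_sum_squares_le_sum) auto
      also have "\<dots> < d" using that \<epsilon> d(1) by (simp add: dist_real_def)
      finally show ?thesis .
    qed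
    ultimately have "dist (F x y) (F t t) < \<eta>" using d(2)[of "(t, t)" "(x, y)"] by simp
    then show ?thesis by (simp add: dist_real_def)
  qed
  with \<epsilon>(1) show ?thesis by blast
qed

text \<open>Continuity of one of the two partial derivatives suffices for total differentiability;
  here it is the derivative in the second argument.\<close>

lemma has_real_derivative_along_curve:
  fixes k kt ks :: "real \<Rightarrow> real \<Rightarrow> real"
  assumes kt: "\<And>t s. t \<in> I \<Longrightarrow> s \<in> I \<Longrightarrow> ((\<lambda>t. k t s) has_real_derivative kt t s) (at t)"
    and ks: "\<And>t s. t \<in> I \<Longrightarrow> s \<in> I \<Longrightarrow> ((\<lambda>s. k t s) has_real_derivative ks t s) (at s)"
    and cks: "continuous_on (I \<times> I) (\<lambda>p. ks (fst p) (snd p))"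
    and I: "open I" "convex I" and ts: "t + \<alpha> * r \<in> I" "s + \<beta> * r \<in> I"
  shows "((\<lambda>r. k (t + \<alpha> * r) (s + \<beta> * r)) has_real_derivative
    (\<alpha> * kt (t + \<alpha> * r) (s + \<beta> * r) + \<beta> * ks (t + \<alpha> * r) (s + \<beta> * r))) (at r)"
proof -
  let ?t = "t + \<alpha> * r" and ?s = "s + \<beta> * r"
  have "((\<lambda>(x, y). k x y) has_derivative
      (\<lambda>(tx, ty). kt ?t ?s * tx + blinfun_scaleR_left (ks ?t ?s) ty)) (at (?t, ?s) within I \<times> I)"
  proof (rule has_derivative_partialsI)
    show "((\<lambda>x. k x ?s) has_derivative (*) (kt ?t ?s)) (at ?t within I)"
      using kt[OF ts] by (auto simp: has_field_derivative_def intro: has_derivative_at_withinI)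
    show "((\<lambda>y. k x y) has_derivative blinfun_apply (blinfun_scaleR_left (ks x y))) (at y within I)"
      if "x \<in> I" "y \<in> I" for x y
      using ks[OF that] by (auto simp: has_field_derivative_def mult_commute_abs intro: has_derivative_at_withinI)
    have "continuous_on (I \<times> I) (\<lambda>p. blinfun_scaleR_left (ks (fst p) (snd p)))"
      by (rule bounded_linear.continuous_on[OF bounded_linear_blinfun_scaleR_left cks])
    then show "continuous (at (?t, ?s) within I \<times> I) (\<lambda>(x, y). blinfun_scaleR_left (ks x y))"
      using ts unfolding continuous_on_eq_continuous_within split_def by simp
  qed (use ts I in auto)
  moreover have "at (?t, ?s) within I \<times> I = at (?t, ?s)"
    by (rule at_within_open) (use ts I in \<open>auto simp: open_Times\<close>)
  ultimately have d: "((\<lambda>(x, y). k x y) has_derivative (\<lambda>(tx, ty). kt ?t ?s * tx + ty * ks ?t ?s)) (at (?t, ?s))"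
    by simp
  have c: "((\<lambda>r. (t + \<alpha> * r, s + \<beta> * r)) has_derivative (\<lambda>h. (\<alpha> * h, \<beta> * h))) (at r)"
    by (auto intro!: derivative_eq_intros)
  have "((\<lambda>r. k (t + \<alpha> * r) (s + \<beta> * r)) has_derivative (\<lambda>h. kt ?t ?s * (\<alpha> * h) + (\<beta> * h) * ks ?t ?s)) (at r)"
    using has_derivative_compose[OF c d] by simp
  then show ?thesis
    unfolding has_field_derivative_def by (rule has_derivative_eq_rhs) (simp add: fun_eq_iff algebra_simps)
qed

text \<open>The function may be unbounded near the ends of the interval, so the primitive is
  anchored at the midpoint.\<close>

lemma continuous_antiderivative_open_interval:
  fixes g :: "real \<Rightarrow> real"
  assumes "continuous_on {0<..<T} g"
  obtains G where "\<And>t. t \<in> {0<..<T} \<Longrightarrow> (G has_real_derivative g t) (at t)"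
proof (cases "0 < T")
  case True
  define c where "c = T / 2"
  define G where "G t = (if c \<le> t then integral {c..t} g else - integral {t..c} g)" for t
  have "(G has_real_derivative g t) (at t)" if t: "t \<in> {0<..<T}" for t
  proof -
    define a b where "a = min t c / 2" and "b = (max t c + T) / 2"
    have ab: "0 < a" "a < t" "t < b" "a < c" "c < b" "b < T" using t True by (auto simp: a_def b_def c_def min_def max_def)
    have cg: "continuous_on {a..b} g" by (rule continuous_on_subset[OF assms]) (use ab in auto)
    have i: "g integrable_on {a..b}" by (rule integrable_continuous_real[OF cg])
    have eq: "G x = integral {a..x} g - integral {a..c} g" if "x \<in> {a<..<b}" for x
    proof (cases "c \<le> x")
      case True
      have "integral {a..c} g + integral {c..x} g = integral {a..x} g"
        by (rule Henstock_Kurzweil_Integration.integral_combine) (use True ab that in \<open>auto intro: integrable_on_subinterval[OF i]\<close>)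
      then show ?thesis using True by (simp add: G_def)
    next
      case False
      have "integral {a..x} g + integral {x..c} g = integral {a..c} g"
        by (rule Henstock_Kurzweil_Integration.integral_combine) (use False ab that in \<open>auto intro: integrable_on_subinterval[OF i]\<close>)
      then show ?thesis using False by (simp add: G_def)
    qed
    have "((\<lambda>x. integral {a..x} g) has_real_derivative g t) (at t within {a..b})"
      by (rule integral_has_real_derivative[OF cg]) (use ab in auto)
    then have "((\<lambda>x. integral {a..x} g) has_real_derivative g t) (at t)"
      using ab by (simp add: at_within_Icc_at)
    then have "((\<lambda>x. integral {a..x} g - integral {a..c} g) has_real_derivative g t) (at t)"
      by (auto intro!: derivative_eq_intros)
    then show ?thesis
      by (rule has_field_derivative_transform_within_open[of _ _ _ "{a<..<b}"]) (use ab eq in auto)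
  qed
  then show ?thesis using that by blast
qed (use that in auto)

text \<open>The abstract form of the energy identity. In the application \<open>k(t, s) = (u\<^sub>t(t), u(s))\<close>,
  \<open>P\<close> is the inner product of the velocities and \<open>A\<close> that of the gradients, \<open>D\<close> is the damping term,
  \<open>b\<close> the boundary term, and second derivatives of \<open>k\<close> need not exist.
  
  Consider \<open>S(t) = (k(t - \<epsilon>, t + \<epsilon>) - k(t + \<epsilon>, t - \<epsilon>)) / 2\<epsilon> - m(t)\<close>, where \<open>m\<close> is the mean of \<open>b + D\<close> on
  the diagonal over \<open>[t - \<epsilon>, t + \<epsilon>]\<close>. By the mean value theorem along the antidiagonal, the first part is
  near \<open>P + A + D - b\<close>, so \<open>S\<close> is near \<open>N = P + A - 2b\<close>. In \<open>S'\<close> the contributions of \<open>P\<close> and \<open>A\<close> at the two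
  mirrored points cancel by symmetry. The remaining values of \<open>b\<close> and \<open>D\<close> at the four corners of a square
  of side \<open>2\<epsilon>\<close> combine to differences of \<open>b\<close> in the first and of \<open>D\<close> in the second argument, the directions
  in which these functions are differentiable, and \<open>S'\<close> is near \<open>- 2b' - 2D'\<close>. For \<open>\<epsilon>\<close> tending to 0 this
  identifies the increments of \<open>N\<close>.\<close>

lemma scalar_energy_identity:
  fixes k P A D D' b b' :: "real \<Rightarrow> real \<Rightarrow> real" and T :: real
  defines "I \<equiv> {0<..<T}"
  assumes kt: "\<And>t s. t \<in> I \<Longrightarrow> s \<in> I \<Longrightarrow> ((\<lambda>t. k t s) has_real_derivative (b t s - A t s - D t s)) (at t)"
    and ks: "\<And>t s. t \<in> I \<Longrightarrow> s \<in> I \<Longrightarrow> ((\<lambda>s. k t s) has_real_derivative P t s) (at s)"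
    and Ds: "\<And>t s. t \<in> I \<Longrightarrow> s \<in> I \<Longrightarrow> ((\<lambda>s. D t s) has_real_derivative D' t s) (at s)"
    and bt: "\<And>t s. t \<in> I \<Longrightarrow> s \<in> I \<Longrightarrow> ((\<lambda>t. b t s) has_real_derivative b' t s) (at t)"
    and cont: "\<And>F. F \<in> {P, A, D, D', b, b'} \<Longrightarrow> continuous_on (I \<times> I) (\<lambda>p. F (fst p) (snd p))"
    and symP: "\<And>t s. P t s = P s t" and symA: "\<And>t s. A t s = A s t"
    and t: "t \<in> I"
  shows "((\<lambda>t. (P t t + A t t) / 2 - b t t) has_real_derivative (- D' t t - b' t t)) (at t)"
proof -
  have diag: "continuous_on I (\<lambda>t. F t t)" if "F \<in> {P, A, D, D', b, b'}" for F
  proof -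
    have "continuous_on I (\<lambda>t. (\<lambda>p. F (fst p) (snd p)) (t, t))"
      by (rule continuous_on_compose2[OF cont[OF that]]) (auto intro!: continuous_intros)
    then show ?thesis by simp
  qed
  define N where "N t = P t t + A t t - 2 * b t t" for t
  define q where "q t = - 2 * b' t t - 2 * D' t t" for t
  have "continuous_on I q" unfolding q_def by (intro continuous_intros diag) auto
  then obtain Q where Q: "\<And>t. t \<in> I \<Longrightarrow> (Q has_real_derivative q t) (at t)"
    using continuous_antiderivative_open_interval[of T q] unfolding I_def by blast
  have "continuous_on I (\<lambda>t. b t t + D t t)" by (intro continuous_intros diag) auto
  then obtain G where G: "\<And>t. t \<in> I \<Longrightarrow> (G has_real_derivative (b t t + D t t)) (at t)"
    using continuous_antiderivative_open_interval[of T "\<lambda>t. b t t + D t t"] unfolding I_def by blast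
  have oI: "open I" "convex I" by (auto simp: I_def)
  have cP: "continuous_on (I \<times> I) (\<lambda>p. P (fst p) (snd p))" by (rule cont) simp
  have curve: "((\<lambda>r. k (t + \<alpha> * r) (s + \<beta> * r)) has_real_derivative
      (\<alpha> * (b (t + \<alpha> * r) (s + \<beta> * r) - A (t + \<alpha> * r) (s + \<beta> * r) - D (t + \<alpha> * r) (s + \<beta> * r)) +
       \<beta> * P (t + \<alpha> * r) (s + \<beta> * r))) (at r)"
    if "t + \<alpha> * r \<in> I" "s + \<beta> * r \<in> I" for t s \<alpha> \<beta> r
    by (rule has_real_derivative_along_curve[where kt = "\<lambda>t s. b t s - A t s - D t s" and ks = P,
          OF kt ks cP oI that])
  \<comment> \<open>The increments of \<open>N\<close> agree with those of a primitive of the claimed derivative. All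
      approximations are made up to \<open>\<eta>\<close>, with one \<open>\<epsilon>\<close> for all \<open>t\<close> in \<open>[t1, t2]\<close>.\<close>
  have incr: "N t2 - N t1 = Q t2 - Q t1" if t12: "0 < t1" "t1 < t2" "t2 < T" for t1 t2
  proof -
    have bound: "\<bar>(N t2 - N t1) - (Q t2 - Q t1)\<bar> \<le> (12 + 4 * (t2 - t1)) * \<eta>" if \<eta>: "0 < \<eta>" for \<eta>
    proof -
      define near where "near F \<epsilon> \<longleftrightarrow> (\<forall>t\<in>{t1..t2}. \<forall>x y. \<bar>x - t\<bar> \<le> \<epsilon> \<longrightarrow> \<bar>y - t\<bar> \<le> \<epsilon> \<longrightarrow> \<bar>F x y - F t t\<bar> \<le> \<eta>)"
        for F :: "real \<Rightarrow> real \<Rightarrow> real" and \<epsilon>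
      have "\<forall>F\<in>{P, A, D, D', b, b'}. \<exists>\<epsilon>>0. near F \<epsilon>"
      proof
        fix F assume "F \<in> {P, A, D, D', b, b'}"
        from cont[OF this, unfolded I_def] show "\<exists>\<epsilon>>0. near F \<epsilon>"
          unfolding near_def using t12(1,3) \<eta> by (rule uniform_near_diagonal)
      qed
      then obtain e where e: "\<And>F. F \<in> {P, A, D, D', b, b'} \<Longrightarrow> 0 < e F \<and> near F (e F)" by metis
      \<comment> \<open>The first two entries keep \<open>t \<plusminus> \<epsilon>\<close> inside the open interval.\<close>
      define \<epsilon> where "\<epsilon> = Min (insert (t1 / 2) (insert ((T - t2) / 2) (e ` {P, A, D, D', b, b'})))"
      have \<epsilon>0: "0 < \<epsilon>" unfolding \<epsilon>_def using e t12 by (subst Min_gr_iff) auto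
      have \<epsilon>t: "\<epsilon> \<le> t1 / 2" "\<epsilon> \<le> (T - t2) / 2" unfolding \<epsilon>_def by (rule Min_le; simp)+
      have "\<epsilon> \<le> e F" if "F \<in> {P, A, D, D', b, b'}" for F
        unfolding \<epsilon>_def using that by (intro Min_le) auto
      then have near: "\<bar>F x y - F t t\<bar> \<le> \<eta>"
        if "F \<in> {P, A, D, D', b, b'}" "t \<in> {t1..t2}" "\<bar>x - t\<bar> \<le> \<epsilon>" "\<bar>y - t\<bar> \<le> \<epsilon>" for F x y t
        using e[OF that(1)] that unfolding near_def by (meson order_trans)
      have inI: "x \<in> I" if "t \<in> {t1..t2}" "\<bar>x - t\<bar> \<le> \<epsilon>" for x t
        using that \<epsilon>t t12 by (auto simp: I_def)
      define S where "S t = (k (t - \<epsilon>) (t + \<epsilon>) - k (t + \<epsilon>) (t - \<epsilon>)) / (2 * \<epsilon>) - (G (t + \<epsilon>) - G (t - \<epsilon>)) / (2 * \<epsilon>)" for t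
      \<comment> \<open>Six values enter: \<open>P\<close>, \<open>A\<close>, \<open>D\<close>, \<open>b\<close> at one point of the antidiagonal, and \<open>b\<close>, \<open>D\<close> at a point
          of the diagonal that realises the mean.\<close>
      have SN: "\<bar>S t - N t\<bar> \<le> 6 * \<eta>" if tt: "t \<in> {t1..t2}" for t
      proof -
        have "\<exists>r>-\<epsilon>. r < \<epsilon> \<and> k (t + 1 * \<epsilon>) (t + (-1) * \<epsilon>) - k (t + 1 * (- \<epsilon>)) (t + (-1) * (- \<epsilon>)) =
            (\<epsilon> - - \<epsilon>) * (1 * (b (t + 1 * r) (t + (-1) * r) - A (t + 1 * r) (t + (-1) * r) - D (t + 1 * r) (t + (-1) * r)) + (-1) * P (t + 1 * r) (t + (-1) * r))"
        proof (rule MVT2[of "- \<epsilon>" \<epsilon> "\<lambda>r. k (t + 1 * r) (t + (-1) * r)"])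
          show "- \<epsilon> < \<epsilon>" using \<epsilon>0 by simp
          fix r assume "- \<epsilon> \<le> r" "r \<le> \<epsilon>"
          then show "((\<lambda>r. k (t + 1 * r) (t + (-1) * r)) has_real_derivative
              1 * (b (t + 1 * r) (t + (-1) * r) - A (t + 1 * r) (t + (-1) * r) - D (t + 1 * r) (t + (-1) * r)) + (-1) * P (t + 1 * r) (t + (-1) * r)) (at r)"
            by (intro curve inI[OF tt]) auto
        qed
        then obtain r where r1: "- \<epsilon> < r" "r < \<epsilon>" and kr1: "k (t + 1 * \<epsilon>) (t + (-1) * \<epsilon>) - k (t + 1 * (- \<epsilon>)) (t + (-1) * (- \<epsilon>)) =
            (\<epsilon> - - \<epsilon>) * (1 * (b (t + 1 * r) (t + (-1) * r) - A (t + 1 * r) (t + (-1) * r) - D (t + 1 * r) (t + (-1) * r)) + (-1) * P (t + 1 * r) (t + (-1) * r))"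
          by blast
        have r: "\<bar>r\<bar> \<le> \<epsilon>" using r1 by simp
        have kr: "k (t + \<epsilon>) (t - \<epsilon>) - k (t - \<epsilon>) (t + \<epsilon>) = 2 * \<epsilon> * (b (t + r) (t - r) - A (t + r) (t - r) - D (t + r) (t - r) - P (t + r) (t - r))"
          using kr1 by simp
        have "\<exists>z>t - \<epsilon>. z < t + \<epsilon> \<and> G (t + \<epsilon>) - G (t - \<epsilon>) = ((t + \<epsilon>) - (t - \<epsilon>)) * (b z z + D z z)"
          by (rule MVT2) (use \<epsilon>0 in \<open>auto intro!: G inI[OF tt]\<close>)
        then obtain z where z1: "t - \<epsilon> < z" "z < t + \<epsilon>" and Gz1: "G (t + \<epsilon>) - G (t - \<epsilon>) = ((t + \<epsilon>) - (t - \<epsilon>)) * (b z z + D z z)"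
          by blast
        have z: "\<bar>z - t\<bar> \<le> \<epsilon>" using z1 by simp
        have Gz: "G (t + \<epsilon>) - G (t - \<epsilon>) = 2 * \<epsilon> * (b z z + D z z)" using Gz1 by simp
        have "k (t - \<epsilon>) (t + \<epsilon>) - k (t + \<epsilon>) (t - \<epsilon>) = 2 * \<epsilon> * (P (t + r) (t - r) + A (t + r) (t - r) + D (t + r) (t - r) - b (t + r) (t - r))"
          using kr by (simp add: algebra_simps)
        then have "S t = (P (t + r) (t - r) + A (t + r) (t - r) + D (t + r) (t - r) - b (t + r) (t - r)) - (b z z + D z z)"
          unfolding S_def Gz using \<epsilon>0 by simp
        moreover have "\<bar>F (t + r) (t - r) - F t t\<bar> \<le> \<eta>" if "F \<in> {P, A, D, b}" for F
          by (rule near) (use that tt r in auto)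
        note this[of P] this[of A] this[of D] this[of b]
        moreover have "\<bar>F z z - F t t\<bar> \<le> \<eta>" if "F \<in> {b, D}" for F
          by (rule near) (use that tt z in auto)
        note this[of b] this[of D]
        ultimately show ?thesis unfolding N_def by (simp add: abs_le_iff)
      qed
      have Sd: "\<exists>S'. (S has_real_derivative S') (at t) \<and> \<bar>S' - q t\<bar> \<le> 4 * \<eta>" if tt: "t \<in> {t1..t2}" for t
      proof -
        have m: "t - \<epsilon> \<in> I" "t + \<epsilon> \<in> I" by (rule inI[OF tt]; use \<epsilon>0 in simp)+
        have c1: "((\<lambda>t. k (t - \<epsilon>) (t + \<epsilon>)) has_real_derivative
            (b (t - \<epsilon>) (t + \<epsilon>) - A (t - \<epsilon>) (t + \<epsilon>) - D (t - \<epsilon>) (t + \<epsilon>)) + P (t - \<epsilon>) (t + \<epsilon>)) (at t)"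
          using curve[of "- \<epsilon>" 1 t \<epsilon> 1] m by (simp add: add.commute)
        have c2: "((\<lambda>t. k (t + \<epsilon>) (t - \<epsilon>)) has_real_derivative
            (b (t + \<epsilon>) (t - \<epsilon>) - A (t + \<epsilon>) (t - \<epsilon>) - D (t + \<epsilon>) (t - \<epsilon>)) + P (t + \<epsilon>) (t - \<epsilon>)) (at t)"
          using curve[of \<epsilon> 1 t "- \<epsilon>" 1] m by (simp add: add.commute)
        have g1: "((\<lambda>t. G (t + \<epsilon>)) has_real_derivative (b (t + \<epsilon>) (t + \<epsilon>) + D (t + \<epsilon>) (t + \<epsilon>))) (at t)"
          using G[OF m(2)] by (simp add: DERIV_shift)
        have g2: "((\<lambda>t. G (t - \<epsilon>)) has_real_derivative (b (t - \<epsilon>) (t - \<epsilon>) + D (t - \<epsilon>) (t - \<epsilon>))) (at t)"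
          using G[OF m(1)] DERIV_shift[of G _ t "- \<epsilon>"] by simp
        \<comment> \<open>The terms are grouped so that \<open>b\<close> varies in its first and \<open>D\<close> in its second argument.\<close>
        define S' where "S' = - ((b (t + \<epsilon>) (t + \<epsilon>) - b (t - \<epsilon>) (t + \<epsilon>)) + (b (t + \<epsilon>) (t - \<epsilon>) - b (t - \<epsilon>) (t - \<epsilon>)) +
          (D (t - \<epsilon>) (t + \<epsilon>) - D (t - \<epsilon>) (t - \<epsilon>)) + (D (t + \<epsilon>) (t + \<epsilon>) - D (t + \<epsilon>) (t - \<epsilon>))) / (2 * \<epsilon>)"
        have "(S has_real_derivative S') (at t)"
          unfolding S_def[abs_def] S'_def
          by (rule DERIV_cong[OF DERIV_diff[OF DERIV_cdivide[OF DERIV_diff[OF c1 c2]] DERIV_cdivide[OF DERIV_diff[OF g1 g2]]]])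
             (simp add: diff_divide_distrib[symmetric] symP[of "t + \<epsilon>" "t - \<epsilon>"] symA[of "t + \<epsilon>" "t - \<epsilon>"])
        moreover have "\<bar>S' - q t\<bar> \<le> 4 * \<eta>"
        proof -
          have bm: "\<exists>z. \<bar>z - t\<bar> \<le> \<epsilon> \<and> b (t + \<epsilon>) s - b (t - \<epsilon>) s = 2 * \<epsilon> * b' z s" if "s \<in> I" for s
          proof -
            have "\<exists>z>t - \<epsilon>. z < t + \<epsilon> \<and> b (t + \<epsilon>) s - b (t - \<epsilon>) s = ((t + \<epsilon>) - (t - \<epsilon>)) * b' z s"
              by (rule MVT2) (use \<epsilon>0 that in \<open>auto intro!: bt inI[OF tt]\<close>)
            then obtain z where "t - \<epsilon> < z" "z < t + \<epsilon>" "b (t + \<epsilon>) s - b (t - \<epsilon>) s = ((t + \<epsilon>) - (t - \<epsilon>)) * b' z s" by blast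
            then show ?thesis by (intro exI[of _ z]) simp
          qed
          have Dm: "\<exists>z. \<bar>z - t\<bar> \<le> \<epsilon> \<and> D s (t + \<epsilon>) - D s (t - \<epsilon>) = 2 * \<epsilon> * D' s z" if "s \<in> I" for s
          proof -
            have "\<exists>z>t - \<epsilon>. z < t + \<epsilon> \<and> D s (t + \<epsilon>) - D s (t - \<epsilon>) = ((t + \<epsilon>) - (t - \<epsilon>)) * D' s z"
              by (rule MVT2) (use \<epsilon>0 that in \<open>auto intro!: Ds inI[OF tt]\<close>)
            then obtain z where "t - \<epsilon> < z" "z < t + \<epsilon>" "D s (t + \<epsilon>) - D s (t - \<epsilon>) = ((t + \<epsilon>) - (t - \<epsilon>)) * D' s z" by blast
            then show ?thesis by (intro exI[of _ z]) simp
          qed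
          obtain z1 where z1: "\<bar>z1 - t\<bar> \<le> \<epsilon>" "b (t + \<epsilon>) (t + \<epsilon>) - b (t - \<epsilon>) (t + \<epsilon>) = 2 * \<epsilon> * b' z1 (t + \<epsilon>)" using bm[OF m(2)] by blast
          obtain z2 where z2: "\<bar>z2 - t\<bar> \<le> \<epsilon>" "b (t + \<epsilon>) (t - \<epsilon>) - b (t - \<epsilon>) (t - \<epsilon>) = 2 * \<epsilon> * b' z2 (t - \<epsilon>)" using bm[OF m(1)] by blast
          obtain z3 where z3: "\<bar>z3 - t\<bar> \<le> \<epsilon>" "D (t - \<epsilon>) (t + \<epsilon>) - D (t - \<epsilon>) (t - \<epsilon>) = 2 * \<epsilon> * D' (t - \<epsilon>) z3" using Dm[OF m(1)] by blast
          obtain z4 where z4: "\<bar>z4 - t\<bar> \<le> \<epsilon>" "D (t + \<epsilon>) (t + \<epsilon>) - D (t + \<epsilon>) (t - \<epsilon>) = 2 * \<epsilon> * D' (t + \<epsilon>) z4" using Dm[OF m(2)] by blast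
          have "S' = - (b' z1 (t + \<epsilon>) + b' z2 (t - \<epsilon>) + D' (t - \<epsilon>) z3 + D' (t + \<epsilon>) z4)"
            unfolding S'_def z1 z2 z3 z4 distrib_left[symmetric] using \<epsilon>0 by simp
          moreover have "\<bar>b' z1 (t + \<epsilon>) - b' t t\<bar> \<le> \<eta>" "\<bar>b' z2 (t - \<epsilon>) - b' t t\<bar> \<le> \<eta>"
            "\<bar>D' (t - \<epsilon>) z3 - D' t t\<bar> \<le> \<eta>" "\<bar>D' (t + \<epsilon>) z4 - D' t t\<bar> \<le> \<eta>"
            by (rule near; use tt \<epsilon>0 z1 z2 z3 z4 in simp)+
          ultimately show ?thesis unfolding q_def by (simp add: abs_le_iff)
        qed
        ultimately show ?thesis by blast
      qed
      obtain S' where S': "\<And>t. t \<in> {t1..t2} \<Longrightarrow> (S has_real_derivative S' t) (at t)"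
        "\<And>t. t \<in> {t1..t2} \<Longrightarrow> \<bar>S' t - q t\<bar> \<le> 4 * \<eta>"
        using Sd by metis
      have "\<exists>z>t1. z < t2 \<and> (S t2 - Q t2) - (S t1 - Q t1) = (t2 - t1) * (S' z - q z)"
        by (rule MVT2[of t1 t2 "\<lambda>t. S t - Q t"])
           (use t12 in \<open>auto intro!: DERIV_diff S' Q simp: I_def\<close>)
      then obtain z where z0: "t1 < z" "z < t2" and z1: "(S t2 - Q t2) - (S t1 - Q t1) = (t2 - t1) * (S' z - q z)" by blast
      have z: "z \<in> {t1..t2}" "(S t2 - Q t2) - (S t1 - Q t1) = (t2 - t1) * (S' z - q z)" using z0 z1 by auto
      have "\<bar>(S t2 - Q t2) - (S t1 - Q t1)\<bar> \<le> (t2 - t1) * (4 * \<eta>)"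
        unfolding z(2) abs_mult using t12 S'(2)[OF z(1)] by (simp add: mult_left_mono)
      moreover have "\<bar>S t1 - N t1\<bar> \<le> 6 * \<eta>" "\<bar>S t2 - N t2\<bar> \<le> 6 * \<eta>" using SN t12 by auto
      moreover have "(12 + 4 * (t2 - t1)) * \<eta> = 12 * \<eta> + (t2 - t1) * (4 * \<eta>)" by (simp add: algebra_simps)
      ultimately show ?thesis by linarith
    qed
    have "\<bar>(N t2 - N t1) - (Q t2 - Q t1)\<bar> \<le> 0 + x" if x: "0 < x" for x
    proof -
      have p: "0 < 12 + 4 * (t2 - t1)" using t12 by simp
      show ?thesis using bound[of "x / (12 + 4 * (t2 - t1))"] x p by simp
    qed
    then have "\<bar>(N t2 - N t1) - (Q t2 - Q t1)\<bar> \<le> 0" by (rule field_le_epsilon)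
    then show ?thesis by simp
  qed
  have NQ: "N x = Q x + (N t - Q t)" if x: "x \<in> I" for x
  proof (cases x t rule: linorder_cases)
    case less then show ?thesis using incr[of x t] x t by (simp add: I_def)
  next
    case greater then show ?thesis using incr[of t x] x t by (simp add: I_def)
  qed simp
  have "((\<lambda>x. Q x + (N t - Q t)) has_real_derivative q t) (at t)"
    using Q[OF t] by (auto intro!: derivative_eq_intros)
  then have "(N has_real_derivative q t) (at t)"
    by (rule has_field_derivative_transform_within_open[OF _ oI(1) t]) (simp add: NQ[symmetric])
  from DERIV_cdivide[OF this, of 2] have "((\<lambda>t. N t / 2) has_real_derivative q t / 2) (at t)" .
  moreover have "(\<lambda>t. N t / 2) = (\<lambda>t. (P t t + A t t) / 2 - b t t)" by (simp add: N_def fun_eq_iff field_simps)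
  moreover have "q t / 2 = - D' t t - b' t t" by (simp add: q_def)
  ultimately show ?thesis by (simp only:)
qed

section \<open>Weak derivatives in time\<close>

text \<open>The function vanishes near the left end, so the primitive vanishes for all arguments up
  to \<open>a\<close> and is smooth across 0, where the integral changes its meaning.\<close>

lemma smooth_antiderivative:
  fixes \<theta> :: "real \<Rightarrow> real"
  assumes \<theta>: "smooth \<theta>" and a: "0 < a" "\<And>x. x \<le> a \<Longrightarrow> \<theta> x = 0"
  defines "\<psi> \<equiv> \<lambda>x. integral {0..x} \<theta>"
  shows "(\<psi> has_real_derivative \<theta> x) (at x)" "smooth \<psi>"
proof -
  show d: "(\<psi> has_real_derivative \<theta> x) (at x)" for x
  proof (cases "0 < x")
    case True
    have "(\<psi> has_real_derivative \<theta> x) (at x within {0..x + 1})"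
      unfolding \<psi>_def
      by (rule integral_has_real_derivative[OF smooth_imp_continuous_on[OF \<theta>]]) (use True in auto)
    then show ?thesis using True by (simp add: at_within_Icc_at)
  next
    case False
    have z: "\<psi> y = 0" if "y \<in> {..<a}" for y
    proof -
      have "\<psi> y = integral {0..y} (\<lambda>_. 0)" unfolding \<psi>_def by (rule integral_cong) (use that a in auto)
      then show ?thesis by simp
    qed
    have "((\<lambda>_. 0) has_real_derivative \<theta> x) (at x)" using False a by simp
    then show ?thesis
      by (rule has_field_derivative_transform_within_open[of _ _ _ "{..<a}"]) (use False a z in auto)
  qed
  have "Ck (Suc k) \<psi>" for k
  proof (rule Ck_SucI)
    show "(\<psi> has_derivative (*) (\<theta> x)) (at x)" for x
      using d by (simp add: has_field_derivative_def)
    show "Ck k (\<lambda>x. \<theta> x * b)" for b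
      using \<theta> by (intro Ck_mult Ck_const) (simp add: smooth_def)
  qed
  then show "smooth \<psi>" unfolding smooth_def using Ck_Suc_imp_Ck by blast
qed

text \<open>Test with the primitive \<open>\<psi>\<close> of the difference \<open>\<theta>\<close> of two bumps of integral 1 around \<open>s\<close>
  and \<open>t\<close>. If \<open>w s < c < w t\<close> and the bumps are narrow, then \<open>(c - w) \<theta>\<close> is nonnegative and positive at
  \<open>s\<close>, although its integral vanishes. Exchanging \<open>s\<close> and \<open>t\<close> shows that \<open>w\<close> is constant.\<close>

lemma weak_deriv_zero_imp_le:
  fixes w :: "real \<Rightarrow> real"
  assumes T: "0 < T" and w: "continuous_on {0..T} w"
    and 0: "\<And>\<psi>. test_function {0<..<T} \<psi> \<Longrightarrow> integral {0..T} (\<lambda>x. w x * frechet_derivative \<psi> (at x) 1) = 0"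
    and s: "s \<in> {0<..<T}" and t: "t \<in> {0<..<T}"
  shows "w t \<le> w s"
proof (rule ccontr)
  assume "\<not> ?thesis"
  then have st: "w s < w t" by simp
  define c where "c = (w s + w t) / 2"
  have c: "w s < c" "c < w t" using st by (auto simp: c_def)
  have ws: "isCont w s" "isCont w t"
    by (rule continuous_on_interior[OF w]; use s t in simp)+
  obtain e1 where e1: "e1 > 0" "\<And>x. \<bar>x - s\<bar> < e1 \<Longrightarrow> w x < c"
  proof -
    have "\<forall>\<^sub>F x in at s. w x < c" using ws(1) c(1) by (simp add: isCont_def order_tendsto_iff)
    then obtain d where d: "d > 0" "\<forall>x. x \<noteq> s \<and> dist x s < d \<longrightarrow> w x < c" by (auto simp: eventually_at)
    have "w x < c" if "\<bar>x - s\<bar> < d" for x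
      using d(2) that c(1) by (cases "x = s") (auto simp: dist_real_def)
    with d(1) show thesis by (rule that)
  qed
  obtain e2 where e2: "e2 > 0" "\<And>x. \<bar>x - t\<bar> < e2 \<Longrightarrow> c < w x"
  proof -
    have "\<forall>\<^sub>F x in at t. c < w x" using ws(2) c(2) by (simp add: isCont_def order_tendsto_iff)
    then obtain d where d: "d > 0" "\<forall>x. x \<noteq> t \<and> dist x t < d \<longrightarrow> c < w x" by (auto simp: eventually_at)
    have "c < w x" if "\<bar>x - t\<bar> < d" for x
      using d(2) that c(2) by (cases "x = t") (auto simp: dist_real_def)
    with d(1) show thesis by (rule that)
  qed
  define \<epsilon> where "\<epsilon> = min (min e1 e2) (min (min (s / 2) (t / 2)) (min ((T - s) / 2) ((T - t) / 2)))"
  have \<epsilon>0: "0 < \<epsilon>" using e1(1) e2(1) s t by (simp add: \<epsilon>_def)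
  have \<epsilon>: "\<epsilon> \<le> e1" "\<epsilon> \<le> e2" "\<epsilon> \<le> s / 2" "\<epsilon> \<le> t / 2" "\<epsilon> \<le> (T - s) / 2" "\<epsilon> \<le> (T - t) / 2"
    unfolding \<epsilon>_def min_le_iff_disj by (simp_all del: min_less_iff_conj)
  define B where "B r x = box_bump 1 (r - \<epsilon>) (r + \<epsilon>) x" for r x :: real
  have B0: "B r x = 0" if "\<bar>x - r\<bar> \<ge> \<epsilon>" for r x
  proof -
    have "\<not> (r - \<epsilon> < x \<and> x < r + \<epsilon>)" using that by linarith
    then show ?thesis unfolding B_def by (intro box_bump_eq_0) (simp add: box_real)
  qed
  have Bp: "0 < B r r" for r
    unfolding B_def by (rule box_bump_pos) (use \<epsilon>0 in \<open>simp_all add: box_real\<close>)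
  have Bn: "0 \<le> B r x" for r x unfolding B_def by (rule box_bump_bounds)
  have Bs: "smooth (B r)" for r unfolding B_def[abs_def] by (rule smooth_box_bump)
  have Bc: "continuous_on S (B r)" for r S by (rule smooth_imp_continuous_on[OF Bs])
  define m where "m r = integral {0..T} (B r)" for r
  have Bi: "B r integrable_on {u..v}" for r u v by (rule integrable_continuous_real[OF Bc])
  have m: "m r > 0" if r: "r \<in> {0<..<T}" for r
  proof -
    have "m r \<ge> 0" unfolding m_def by (rule integral_nonneg[OF Bi]) (simp add: Bn)
    moreover have "m r \<noteq> 0"
    proof
      assume "m r = 0"
      then have "\<forall>x\<in>{0..T}. B r x = 0" unfolding m_def using integral_eq_0_iff[OF Bc T Bn] by blast
      then have "B r r = 0" using r by simp
      then show False using Bp[of r] by simp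
    qed
    ultimately show ?thesis by simp
  qed
  \<comment> \<open>Normalisation of the bumps makes the integral of \<open>\<theta>\<close> vanish, so that its primitive has
      compact support.\<close>
  define \<theta> where "\<theta> x = inverse (m s) * B s x + (- inverse (m t)) * B t x" for x
  have \<theta>s: "smooth \<theta>" unfolding \<theta>_def[abs_def] by (intro smooth_add smooth_cmult Bs)
  have \<theta>c: "continuous_on S \<theta>" for S by (rule smooth_imp_continuous_on[OF \<theta>s])
  have \<theta>i: "\<theta> integrable_on {u..v}" for u v by (rule integrable_continuous_real[OF \<theta>c])
  define a b where "a = min s t - \<epsilon>" and "b = max s t + \<epsilon>"
  have ab: "0 < a" "a < b" "b < T" using \<epsilon> \<epsilon>0 s t by (auto simp: a_def b_def min_def max_def)
  have \<theta>0: "\<theta> x = 0" if "x \<le> a \<or> b \<le> x" for x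
  proof -
    have "a \<le> s - \<epsilon>" "a \<le> t - \<epsilon>" "s + \<epsilon> \<le> b" "t + \<epsilon> \<le> b" by (simp_all add: a_def b_def)
    then have "\<epsilon> \<le> \<bar>x - s\<bar>" "\<epsilon> \<le> \<bar>x - t\<bar>" using that by linarith+
    then show ?thesis by (simp add: \<theta>_def B0)
  qed
  have \<theta>T: "integral {0..T} \<theta> = 0"
  proof -
    have i: "(\<lambda>x. y * B r x) integrable_on {0..T}" for y r by (rule integrable_on_mult_right[OF Bi])
    have "integral {0..T} \<theta> = inverse (m s) * m s + (- inverse (m t)) * m t"
      unfolding \<theta>_def
      unfolding integral_add[OF i i] integral_mult_right m_def ..
    then show ?thesis using m[OF s] m[OF t] by simp
  qed
  define \<psi> where "\<psi> = (\<lambda>x. integral {0..x} \<theta>)"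
  have \<theta>a: "\<theta> x = 0" if "x \<le> a" for x using \<theta>0 that by blast
  note \<psi> = smooth_antiderivative[OF \<theta>s ab(1) \<theta>a, folded \<psi>_def]
  have tf: "test_function {0<..<T} \<psi>"
    unfolding test_function_def
  proof (intro conjI exI[of _ "{a..b}"] allI impI)
    fix x assume x: "x \<notin> {a..b}"
    have z: "integral {u..v} \<theta> = 0" if "\<And>y. y \<in> {u..v} \<Longrightarrow> \<theta> y = 0" for u v
    proof -
      have "integral {u..v} \<theta> = integral {u..v} (\<lambda>_. 0)" by (rule integral_cong) (use that in auto)
      then show ?thesis by simp
    qed
    have "x < a \<or> (b < x \<and> x \<le> T) \<or> T < x" using x by auto
    then consider "x < a" | "b < x" "x \<le> T" | "T < x" by blast
    then show "\<psi> x = 0"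
    proof cases
      case 1 then show ?thesis unfolding \<psi>_def by (intro z \<theta>0) simp
    next
      case 2
      have "integral {0..x} \<theta> + integral {x..T} \<theta> = integral {0..T} \<theta>"
        by (rule Henstock_Kurzweil_Integration.integral_combine[OF _ _ \<theta>i]) (use 2 ab in auto)
      moreover have "integral {x..T} \<theta> = 0" by (intro z \<theta>0) (use 2 in simp)
      ultimately show ?thesis using \<theta>T by (simp add: \<psi>_def)
    next
      case 3
      have "integral {0..T} \<theta> + integral {T..x} \<theta> = integral {0..x} \<theta>"
        by (rule Henstock_Kurzweil_Integration.integral_combine[OF _ _ \<theta>i]) (use 3 T in auto)
      moreover have "integral {T..x} \<theta> = 0" by (intro z \<theta>0) (use 3 ab in simp)
      ultimately show ?thesis using \<theta>T by (simp add: \<psi>_def)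
    qed
  next
    show "smooth \<psi>" by (rule \<psi>(2))
    show "{a..b} \<subseteq> {0<..<T}" using ab by auto
  qed simp
  have fd: "frechet_derivative \<psi> (at x) 1 = \<theta> x" for x
  proof -
    have "(\<psi> has_derivative (*) (\<theta> x)) (at x)" using \<psi>(1) by (simp add: has_field_derivative_def)
    from frechet_derivative_at[OF this] have "frechet_derivative \<psi> (at x) = (*) (\<theta> x)" by simp
    then show ?thesis by simp
  qed
  have w\<theta>: "integral {0..T} (\<lambda>x. w x * \<theta> x) = 0" using 0[OF tf] by (simp add: fd)
  have wi: "(\<lambda>x. w x * \<theta> x) integrable_on {0..T}"
    by (intro integrable_continuous_real continuous_on_mult w \<theta>c)
  \<comment> \<open>The constant \<open>c\<close> contributes nothing to the integral, but makes the integrand nonnegative.\<close>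
  define h where "h x = c * \<theta> x - w x * \<theta> x" for x
  have h0: "integral {0..T} h = 0"
    unfolding h_def
    using integral_diff[OF integrable_on_mult_right[OF \<theta>i] wi, of c] w\<theta> \<theta>T by simp
  have hc: "continuous_on {0..T} h" unfolding h_def[abs_def] by (intro continuous_intros w \<theta>c)
  have hn: "0 \<le> h x" for x
  proof -
    have n1: "0 \<le> (c - w x) * B s x"
    proof (cases "\<bar>x - s\<bar> < \<epsilon>")
      case True then show ?thesis using e1(2)[of x] \<epsilon>(1) by (intro mult_nonneg_nonneg Bn) linarith
    qed (simp add: B0)
    have n2: "0 \<le> (w x - c) * B t x"
    proof (cases "\<bar>x - t\<bar> < \<epsilon>")
      case True then show ?thesis using e2(2)[of x] \<epsilon>(2) by (intro mult_nonneg_nonneg Bn) linarith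
    qed (simp add: B0)
    have "0 \<le> inverse (m s) * ((c - w x) * B s x) + inverse (m t) * ((w x - c) * B t x)"
      by (rule add_nonneg_nonneg[OF mult_nonneg_nonneg[OF _ n1] mult_nonneg_nonneg[OF _ n2]])
         (simp_all add: m[OF s, THEN less_imp_le] m[OF t, THEN less_imp_le])
    also have "\<dots> = h x" by (simp add: h_def \<theta>_def algebra_simps)
    finally show ?thesis .
  qed
  have "\<forall>x\<in>{0..T}. h x = 0" using integral_eq_0_iff[OF hc T hn] h0 by blast
  then have hs0: "h s = 0" using s by simp
  \<comment> \<open>The bump around \<open>t\<close> does not reach \<open>s\<close>, because \<open>w\<close> exceeds \<open>c\<close> on its support.\<close>
  have Bts: "B t s = 0"
  proof (rule B0, rule ccontr)
    assume "\<not> \<epsilon> \<le> \<bar>s - t\<bar>"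
    then have "\<bar>s - t\<bar> < e2" using \<epsilon>(2) by linarith
    then have "c < w s" by (rule e2(2))
    then show False using c by simp
  qed
  have "h s = (c - w s) * (inverse (m s) * B s s)"
    unfolding h_def \<theta>_def Bts by (simp add: left_diff_distrib)
  moreover have "0 < (c - w s) * (inverse (m s) * B s s)"
    by (intro mult_pos_pos Bp) (use c(1) m[OF s] in simp_all)
  ultimately show False using hs0 by linarith
qed

text \<open>The difference of \<open>f\<close> and a primitive of \<open>g\<close> has weak derivative 0.\<close>

lemma continuous_weak_deriv_imp_deriv:
  fixes f g :: "real \<Rightarrow> real"
  assumes T: "0 < T" and f: "continuous_on {0..T} f" and g: "continuous_on {0..T} g"
    and wd: "has_weak_deriv {0<..<T} 1 f g" and t: "t \<in> {0<..<T}"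
  shows "(f has_real_derivative g t) (at t)"
proof -
  define G where "G x = integral {0..x} g" for x
  have Gd: "(G has_real_derivative g x) (at x within {0..T})" if "x \<in> {0..T}" for x
    unfolding G_def by (rule integral_has_real_derivative[OF g that])
  have Gc: "continuous_on {0..T} G"
    by (rule DERIV_continuous_on[OF Gd])
  define w where "w x = f x - G x" for x
  have conv: "integral\<^sup>L (lebesgue_on {0<..<T}) F = integral {0..T} F" if F: "continuous_on {0..T} F" for F :: "real \<Rightarrow> real"
  proof -
    have "integrable (lebesgue_on {0<..<T}) F"
      by (rule integrable_lebesgue_on_subset[OF continuous_imp_integrable_real[OF F]]) auto
    then have "integral\<^sup>L (lebesgue_on {0<..<T}) F = integral {0<..<T} F"
      by (rule lebesgue_integral_eq_integral) simp
    then show ?thesis using integral_open_interval_real[of 0 T F] by simp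
  qed
  have w0: "integral {0..T} (\<lambda>x. w x * frechet_derivative \<psi> (at x) 1) = 0" if tf: "test_function {0<..<T} \<psi>" for \<psi>
  proof -
    let ?p = "\<lambda>x. frechet_derivative \<psi> (at x) 1"
    have sm: "smooth \<psi>" using tf by (rule test_function_smooth)
    have pc: "continuous_on {0..T} ?p" by (rule smooth_partial_continuous_on[OF sm]) simp
    have \<psi>c: "continuous_on {0..T} \<psi>" by (rule smooth_imp_continuous_on[OF sm])
    have \<psi>d: "(\<psi> has_real_derivative ?p x) (at x within S)" for x S
    proof -
      have d: "(\<psi> has_derivative frechet_derivative \<psi> (at x)) (at x within S)" by (rule smooth_has_derivative[OF sm])
      have "frechet_derivative \<psi> (at x) h = ?p x * h" for h
        using d linear_cmul[of "frechet_derivative \<psi> (at x)" h 1]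
        by (simp add: has_derivative_def bounded_linear.linear)
      then have "frechet_derivative \<psi> (at x) = (*) (?p x)" by (rule ext)
      with d show ?thesis by (simp add: has_field_derivative_def)
    qed
    have ends: "\<psi> 0 = 0" "\<psi> T = 0"
    proof -
      obtain K where "K \<subseteq> {0<..<T}" "\<And>x. x \<notin> K \<Longrightarrow> \<psi> x = 0" using tf by (auto simp: test_function_def)
      then show "\<psi> 0 = 0" "\<psi> T = 0" by (metis greaterThanLessThan_iff less_irrefl subsetD)+
    qed
    have fi: "(\<lambda>x. f x * ?p x) integrable_on {0..T}" "(\<lambda>x. g x * \<psi> x) integrable_on {0..T}"
      "(\<lambda>x. G x * ?p x) integrable_on {0..T}"
      by (intro integrable_continuous_real continuous_on_mult f g Gc pc \<psi>c)+
    have 1: "integral {0..T} (\<lambda>x. f x * ?p x) = - integral {0..T} (\<lambda>x. g x * \<psi> x)"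
    proof -
      have "integral\<^sup>L (lebesgue_on {0<..<T}) (\<lambda>x. f x * ?p x) = - integral\<^sup>L (lebesgue_on {0<..<T}) (\<lambda>x. g x * \<psi> x)"
        using wd tf unfolding has_weak_deriv_def by blast
      then show ?thesis
        by (simp only: conv[OF continuous_on_mult[OF f pc]] conv[OF continuous_on_mult[OF g \<psi>c]])
    qed
    have "((\<lambda>x. g x * \<psi> x + G x * ?p x) has_integral (G T * \<psi> T - G 0 * \<psi> 0)) {0..T}"
    proof (rule fundamental_theorem_of_calculus)
      show "((\<lambda>x. G x * \<psi> x) has_vector_derivative g x * \<psi> x + G x * ?p x) (at x within {0..T})" if "x \<in> {0..T}" for x
        unfolding has_real_derivative_iff_has_vector_derivative[symmetric]
        by (rule DERIV_cong[OF DERIV_mult[OF Gd[OF that] \<psi>d]]) (simp add: algebra_simps)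
    qed (use T in simp)
    then have "integral {0..T} (\<lambda>x. g x * \<psi> x + G x * ?p x) = 0" using ends by (simp add: integral_unique)
    then have 2: "integral {0..T} (\<lambda>x. g x * \<psi> x) + integral {0..T} (\<lambda>x. G x * ?p x) = 0"
      using integral_add[OF fi(2,3)] by simp
    have "integral {0..T} (\<lambda>x. w x * ?p x) = integral {0..T} (\<lambda>x. f x * ?p x) - integral {0..T} (\<lambda>x. G x * ?p x)"
      using integral_diff[OF fi(1,3)] by (simp add: w_def left_diff_distrib)
    then show ?thesis using 1 2 by simp
  qed
  have wc: "continuous_on {0..T} w" unfolding w_def[abs_def] by (intro continuous_intros f Gc)
  have eq: "w x = w t" if "x \<in> {0<..<T}" for x
    using weak_deriv_zero_imp_le[OF T wc w0 that t] weak_deriv_zero_imp_le[OF T wc w0 t that] by simp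
  have "(G has_real_derivative g t) (at t)"
    using Gd[of t] t by (simp add: at_within_Icc_at)
  then have "((\<lambda>x. w t + G x) has_real_derivative g t) (at t)" by (auto intro!: derivative_eq_intros)
  moreover have "w t + G x = f x" if "x \<in> {0<..<T}" for x
    using eq[OF that] unfolding w_def by linarith
  ultimately show ?thesis
    using has_field_derivative_transform_within_open[OF _ open_greaterThanLessThan t] by blast
qed

section \<open>Continuous curves of square integrable functions\<close>

text \<open>Continuity in the norm for functions with values in any Euclidean space, so that it
  applies to gradients as well.\<close>

definition L2_curve :: "'a measure \<Rightarrow> real set \<Rightarrow> (real \<Rightarrow> 'a \<Rightarrow> 'b::euclidean_space) \<Rightarrow> bool" where
  "L2_curve M I f \<longleftrightarrow> (\<forall>t\<in>I. f t \<in> L2 M) \<and>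
     (\<forall>t\<in>I. ((\<lambda>s. L2_norm M (\<lambda>x. f s x - f t x)) \<longlongrightarrow> 0) (at t within I))"

lemma L2_curve_L2: "L2_curve M I f \<Longrightarrow> t \<in> I \<Longrightarrow> f t \<in> L2 M"
  by (simp add: L2_curve_def)

lemma L2_curve_subset: "L2_curve M I f \<Longrightarrow> J \<subseteq> I \<Longrightarrow> L2_curve M J f"
  unfolding L2_curve_def by (meson subsetD tendsto_within_subset)

lemma L2_curve_dominated:
  assumes L2: "\<And>t. t \<in> I \<Longrightarrow> f t \<in> L2 M"
    and N: "\<And>t. t \<in> I \<Longrightarrow> ((\<lambda>s. N s t) \<longlongrightarrow> 0) (at t within I)"
    and le: "\<And>s t. s \<in> I \<Longrightarrow> t \<in> I \<Longrightarrow> L2_norm M (\<lambda>x. f s x - f t x) \<le> C * N s t"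
  shows "L2_curve M I f"
  unfolding L2_curve_def
proof (intro conjI ballI)
  fix t assume t: "t \<in> I"
  show "((\<lambda>s. L2_norm M (\<lambda>x. f s x - f t x)) \<longlongrightarrow> 0) (at t within I)"
  proof (rule Lim_null_comparison)
    show "\<forall>\<^sub>F s in at t within I. norm (L2_norm M (\<lambda>x. f s x - f t x)) \<le> C * N s t"
      unfolding eventually_at_filter by (rule always_eventually) (use le t in simp)
    show "((\<lambda>s. C * N s t) \<longlongrightarrow> 0) (at t within I)"
      using tendsto_mult_left[OF N[OF t], of C] by simp
  qed
qed (rule L2)

text \<open>Joint continuity of the inner product, stated for filters so that it can be
  used along curves with independent times.\<close>

lemma tendsto_L2_inner:
  assumes f: "\<forall>\<^sub>F x in F. f x \<in> L2 M" and g: "\<forall>\<^sub>F x in F. g x \<in> L2 M" and f0: "f0 \<in> L2 M" and g0: "g0 \<in> L2 M"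
    and lf: "((\<lambda>x. L2_norm M (\<lambda>y. f x y - f0 y)) \<longlongrightarrow> 0) F"
    and lg: "((\<lambda>x. L2_norm M (\<lambda>y. g x y - g0 y)) \<longlongrightarrow> 0) F"
  shows "((\<lambda>x. L2_inner M (f x) (g x)) \<longlongrightarrow> L2_inner M f0 g0) F"
proof (rule LIM_zero_cancel, rule Lim_null_comparison)
  let ?F = "\<lambda>x. L2_norm M (\<lambda>y. f x y - f0 y)" and ?G = "\<lambda>x. L2_norm M (\<lambda>y. g x y - g0 y)"
  show "\<forall>\<^sub>F x in F. norm (L2_inner M (f x) (g x) - L2_inner M f0 g0)
      \<le> ?F x * ?G x + ?F x * L2_norm M g0 + L2_norm M f0 * ?G x"
    using f g
  proof eventually_elim
    case (elim x)
    note df = L2_diff[OF elim(1) f0] and dg = L2_diff[OF elim(2) g0]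
    have "L2_inner M (f x) (g x) - L2_inner M f0 g0 =
        L2_inner M (\<lambda>y. f x y - f0 y) (\<lambda>y. g x y - g0 y) + L2_inner M (\<lambda>y. f x y - f0 y) g0 +
        L2_inner M f0 (\<lambda>y. g x y - g0 y)"
      by (simp add: L2_inner_diff_left L2_inner_diff_right elim f0 g0 df dg)
    then show ?case
      using L2_Cauchy_Schwarz[OF df dg] L2_Cauchy_Schwarz[OF df g0] L2_Cauchy_Schwarz[OF f0 dg]
      unfolding real_norm_def by linarith
  qed
  have "((\<lambda>x. ?F x * ?G x + ?F x * L2_norm M g0 + L2_norm M f0 * ?G x) \<longlongrightarrow>
      0 * 0 + 0 * L2_norm M g0 + L2_norm M f0 * 0) F"
    by (intro tendsto_intros lf lg)
  then show "((\<lambda>x. ?F x * ?G x + ?F x * L2_norm M g0 + L2_norm M f0 * ?G x) \<longlongrightarrow> 0) F" by simp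
qed

lemma tendsto_within_compose:
  fixes \<phi> :: "'a::metric_space \<Rightarrow> real" and h :: "'b::metric_space \<Rightarrow> 'a"
  assumes \<phi>: "(\<phi> \<longlongrightarrow> \<phi> (h p)) (at (h p) within I)" and h: "continuous (at p within S) h" "h ` S \<subseteq> I"
  shows "((\<lambda>q. \<phi> (h q)) \<longlongrightarrow> \<phi> (h p)) (at p within S)"
proof -
  have "continuous (at (h p) within h ` S) \<phi>"
    unfolding continuous_within using \<phi> h(2) by (rule tendsto_within_subset)
  from continuous_within_compose2[OF h(1) this] show ?thesis by (simp add: continuous_within)
qed

lemma L2_curve_inner_continuous_on:
  assumes f: "L2_curve M I f" and g: "L2_curve M J g"
  shows "continuous_on (I \<times> J) (\<lambda>p. L2_inner M (f (fst p)) (g (snd p)))"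
  unfolding continuous_on_def
proof
  fix p assume p: "p \<in> I \<times> J"
  then have ts: "fst p \<in> I" "snd p \<in> J" by auto
  have ev: "\<forall>\<^sub>F q in at p within I \<times> J. q \<in> I \<times> J" by (simp add: eventually_at_filter)
  show "((\<lambda>p. L2_inner M (f (fst p)) (g (snd p))) \<longlongrightarrow> L2_inner M (f (fst p)) (g (snd p))) (at p within I \<times> J)"
  proof (rule tendsto_L2_inner)
    show "\<forall>\<^sub>F q in at p within I \<times> J. f (fst q) \<in> L2 M"
      using ev by eventually_elim (use L2_curve_L2[OF f] in auto)
    show "\<forall>\<^sub>F q in at p within I \<times> J. g (snd q) \<in> L2 M"
      using ev by eventually_elim (use L2_curve_L2[OF g] in auto)
    show "f (fst p) \<in> L2 M" "g (snd p) \<in> L2 M" using L2_curve_L2[OF f ts(1)] L2_curve_L2[OF g ts(2)] by auto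
    have cf: "continuous (at p within I \<times> J) fst" and cs: "continuous (at p within I \<times> J) snd"
      unfolding continuous_within by (intro tendsto_fst tendsto_snd tendsto_ident_at)+
    have z: "L2_norm M (\<lambda>x. u x - u x) = 0" for u :: "'a \<Rightarrow> 'c::euclidean_space" by (simp add: L2_norm_def)
    have "((\<lambda>s. L2_norm M (\<lambda>x. f s x - f (fst p) x)) \<longlongrightarrow> L2_norm M (\<lambda>x. f (fst p) x - f (fst p) x)) (at (fst p) within I)"
      unfolding z using f ts by (simp add: L2_curve_def)
    from tendsto_within_compose[where \<phi> = "\<lambda>s. L2_norm M (\<lambda>x. f s x - f (fst p) x)" and h = fst and p = p, OF this cf]
    show "((\<lambda>q. L2_norm M (\<lambda>y. f (fst q) y - f (fst p) y)) \<longlongrightarrow> 0) (at p within I \<times> J)"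
      unfolding z by auto
    have "((\<lambda>s. L2_norm M (\<lambda>x. g s x - g (snd p) x)) \<longlongrightarrow> L2_norm M (\<lambda>x. g (snd p) x - g (snd p) x)) (at (snd p) within J)"
      unfolding z using g ts by (simp add: L2_curve_def)
    from tendsto_within_compose[where \<phi> = "\<lambda>s. L2_norm M (\<lambda>x. g s x - g (snd p) x)" and h = snd and p = p, OF this cs]
    show "((\<lambda>q. L2_norm M (\<lambda>y. g (snd q) y - g (snd p) y)) \<longlongrightarrow> 0) (at p within I \<times> J)"
      unfolding z by auto
  qed
qed

lemma L2_curve_inner_continuous_on_diag:
  assumes f: "L2_curve M I f" and g: "L2_curve M I g"
  shows "continuous_on I (\<lambda>t. L2_inner M (f t) (g t))"
proof -
  have "continuous_on I (\<lambda>t. (\<lambda>p. L2_inner M (f (fst p)) (g (snd p))) (t, t))"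
    by (rule continuous_on_compose2[OF L2_curve_inner_continuous_on[OF f g]]) (auto intro!: continuous_intros)
  then show ?thesis by simp
qed

lemma L2_curve_inner_continuous_on_left:
  assumes f: "L2_curve M I f" and p: "p \<in> L2 M"
  shows "continuous_on I (\<lambda>t. L2_inner M (f t) p)"
proof -
  have "L2_curve M I (\<lambda>_. p)" using p by (simp add: L2_curve_def L2_norm_def)
  from L2_curve_inner_continuous_on_diag[OF f this] show ?thesis .
qed

lemma L2_curve_add:
  assumes f: "L2_curve M I f" and g: "L2_curve M I g"
  shows "L2_curve M I (\<lambda>t x. f t x + g t x)"
proof (rule L2_curve_dominated[where C = 1])
  show "(\<lambda>x. f t x + g t x) \<in> L2 M" if "t \<in> I" for t
    by (rule L2_add[OF L2_curve_L2[OF f that] L2_curve_L2[OF g that]])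
  show "((\<lambda>s. L2_norm M (\<lambda>x. f s x - f t x) + L2_norm M (\<lambda>x. g s x - g t x)) \<longlongrightarrow> 0) (at t within I)"
    if "t \<in> I" for t
    using tendsto_add[of _ 0 _ _ 0] f g that by (fastforce simp: L2_curve_def)
  show "L2_norm M (\<lambda>x. (f s x + g s x) - (f t x + g t x)) \<le>
      1 * (L2_norm M (\<lambda>x. f s x - f t x) + L2_norm M (\<lambda>x. g s x - g t x))" if "s \<in> I" "t \<in> I" for s t
    using L2_norm_triangle[OF L2_diff[OF L2_curve_L2[OF f that(1)] L2_curve_L2[OF f that(2)]]
        L2_diff[OF L2_curve_L2[OF g that(1)] L2_curve_L2[OF g that(2)]]]
    by (simp add: algebra_simps)
qed

lemma L2_mult_bounded:
  fixes a f :: "'a \<Rightarrow> real"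
  assumes a: "a \<in> borel_measurable M" "AE x in M. \<bar>a x\<bar> \<le> B" and B: "0 \<le> B" and f: "f \<in> L2 M"
  shows "(\<lambda>x. a x * f x) \<in> L2 M" "L2_norm M (\<lambda>x. a x * f x) \<le> B * L2_norm M f"
proof -
  have fi: "integrable M (\<lambda>x. (f x)\<^sup>2)" and fm: "f \<in> borel_measurable M" using f by (auto simp: L2_iff)
  have m: "(\<lambda>x. a x * f x) \<in> borel_measurable M" using a(1) fm by (rule borel_measurable_times)
  have le: "AE x in M. (a x * f x)\<^sup>2 \<le> B\<^sup>2 * (f x)\<^sup>2"
    using a(2)
  proof eventually_elim
    case (elim x)
    have "\<bar>a x\<bar>\<^sup>2 \<le> B\<^sup>2" using elim by (intro power_mono) auto
    then show ?case by (simp add: power_mult_distrib mult_right_mono)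
  qed
  have Bi: "integrable M (\<lambda>x. B\<^sup>2 * (f x)\<^sup>2)" using fi by simp
  have i: "integrable M (\<lambda>x. (a x * f x)\<^sup>2)"
    by (rule Bochner_Integration.integrable_bound[OF Bi]) (use m le in auto)
  then show "(\<lambda>x. a x * f x) \<in> L2 M" using m by (simp add: L2_iff)
  have "(\<integral>x. (a x * f x)\<^sup>2 \<partial>M) \<le> (\<integral>x. B\<^sup>2 * (f x)\<^sup>2 \<partial>M)" by (rule integral_mono_AE[OF i Bi le])
  also have "\<dots> = B\<^sup>2 * (\<integral>x. (f x)\<^sup>2 \<partial>M)" by simp
  finally have "L2_norm M (\<lambda>x. a x * f x) \<le> sqrt (B\<^sup>2 * (\<integral>x. (f x)\<^sup>2 \<partial>M))" by (simp add: L2_norm_def)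
  then show "L2_norm M (\<lambda>x. a x * f x) \<le> B * L2_norm M f" using B by (simp add: L2_norm_def real_sqrt_mult)
qed

lemma L2_curve_mult_bounded:
  fixes a :: "'a \<Rightarrow> real"
  assumes a: "a \<in> borel_measurable M" "AE x in M. \<bar>a x\<bar> \<le> B" and B: "0 \<le> B" and f: "L2_curve M I f"
  shows "L2_curve M I (\<lambda>t x. a x * f t x)"
proof (rule L2_curve_dominated)
  show "(\<lambda>x. a x * f t x) \<in> L2 M" if "t \<in> I" for t
    by (rule L2_mult_bounded(1)[OF a B L2_curve_L2[OF f that]])
  show "((\<lambda>s. L2_norm M (\<lambda>x. f s x - f t x)) \<longlongrightarrow> 0) (at t within I)" if "t \<in> I" for t
    using f that by (simp add: L2_curve_def)
  show "L2_norm M (\<lambda>x. a x * f s x - a x * f t x) \<le> B * L2_norm M (\<lambda>x. f s x - f t x)" if "s \<in> I" "t \<in> I" for s t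
    using L2_mult_bounded(2)[OF a B L2_diff[OF L2_curve_L2[OF f that(1)] L2_curve_L2[OF f that(2)]]]
    by (simp add: right_diff_distrib)
qed

section \<open>Differentiable curves of square integrable functions\<close>

lemma has_L2_deriv_subset:
  "has_L2_deriv M I f t g \<Longrightarrow> J \<subseteq> I \<Longrightarrow> has_L2_deriv M J f t g"
  unfolding has_L2_deriv_def by (meson tendsto_within_subset)

lemma L2_difference_quotient:
  "f s \<in> L2 M \<Longrightarrow> f t \<in> L2 M \<Longrightarrow> (\<lambda>x. (f s x - f t x) / (s - t)) \<in> L2 M" for f :: "real \<Rightarrow> 'a \<Rightarrow> real"
  using L2_cmult[OF L2_diff[of "f s" M "f t"], of "inverse (s - t)"] by (simp add: divide_inverse mult.commute)

lemma has_L2_deriv_inner: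
  assumes p: "p \<in> L2 M" and d: "has_L2_deriv M I f t g" and f: "\<And>s. s \<in> I \<Longrightarrow> f s \<in> L2 M" and t: "t \<in> I"
  shows "((\<lambda>s. L2_inner M p (f s)) has_real_derivative L2_inner M p g) (at t within I)"
  unfolding has_field_derivative_iff
proof (rule LIM_zero_cancel, rule Lim_null_comparison)
  have g: "g \<in> L2 M" using d by (simp add: has_L2_deriv_def)
  let ?q = "\<lambda>s x. (f s x - f t x) / (s - t)"
  show "\<forall>\<^sub>F s in at t within I. norm ((L2_inner M p (f s) - L2_inner M p (f t)) / (s - t) - L2_inner M p g)
      \<le> L2_norm M p * L2_norm M (\<lambda>x. ?q s x - g x)"
    unfolding eventually_at_filter
  proof (intro always_eventually allI impI)
    fix s assume s: "s \<noteq> t" "s \<in> I"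
    note q = L2_difference_quotient[where f = f, OF f[OF s(2)] f[OF t]]
    have "L2_inner M p (?q s) = L2_inner M p (\<lambda>x. f s x - f t x) / (s - t)"
      by (simp add: L2_inner_def)
    also have "\<dots> = (L2_inner M p (f s) - L2_inner M p (f t)) / (s - t)"
      by (simp add: L2_inner_diff_right[OF f[OF s(2)] f[OF t] p])
    finally have "(L2_inner M p (f s) - L2_inner M p (f t)) / (s - t) - L2_inner M p g = L2_inner M p (\<lambda>x. ?q s x - g x)"
      by (simp add: L2_inner_diff_right[OF q g p])
    then show "norm ((L2_inner M p (f s) - L2_inner M p (f t)) / (s - t) - L2_inner M p g)
        \<le> L2_norm M p * L2_norm M (\<lambda>x. ?q s x - g x)"
      using L2_Cauchy_Schwarz[OF p L2_diff[OF q g]] by simp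
  qed
  show "((\<lambda>s. L2_norm M p * L2_norm M (\<lambda>x. ?q s x - g x)) \<longlongrightarrow> 0) (at t within I)"
    using d tendsto_mult_left[of _ 0 _ "L2_norm M p"] by (fastforce simp: has_L2_deriv_def)
qed

lemma has_L2_deriv_unique:
  assumes d: "has_L2_deriv M I f t g" "has_L2_deriv M I f t g'" and f: "\<And>s. s \<in> I \<Longrightarrow> f s \<in> L2 M" and t: "t \<in> I"
    and lim: "at t within I \<noteq> bot"
  shows "AE x in M. g x = g' x"
proof -
  have g: "g \<in> L2 M" "g' \<in> L2 M" using d by (simp_all add: has_L2_deriv_def)
  let ?q = "\<lambda>s x. (f s x - f t x) / (s - t)"
  have "((\<lambda>s. L2_norm M (\<lambda>x. ?q s x - g x) + L2_norm M (\<lambda>x. ?q s x - g' x)) \<longlongrightarrow> 0 + 0) (at t within I)"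
    using d unfolding has_L2_deriv_def by (intro tendsto_add) blast+
  moreover have "\<forall>\<^sub>F s in at t within I. L2_norm M (\<lambda>x. g x - g' x) \<le> L2_norm M (\<lambda>x. ?q s x - g x) + L2_norm M (\<lambda>x. ?q s x - g' x)"
    unfolding eventually_at_filter
  proof (intro always_eventually allI impI)
    fix s assume s: "s \<noteq> t" "s \<in> I"
    note q = L2_difference_quotient[where f = f, OF f[OF s(2)] f[OF t]]
    show "L2_norm M (\<lambda>x. g x - g' x) \<le> L2_norm M (\<lambda>x. ?q s x - g x) + L2_norm M (\<lambda>x. ?q s x - g' x)"
      using L2_norm_triangle_diff[OF g(1) q g(2)] unfolding L2_norm_minus_commute[of M g "?q s"] .
  qed
  ultimately have "L2_norm M (\<lambda>x. g x - g' x) \<le> 0 + 0" by (rule tendsto_lowerbound[OF _ _ lim])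
  then have "L2_norm M (\<lambda>x. g x - g' x) = 0" using L2_norm_nonneg[of M "\<lambda>x. g x - g' x"] by linarith
  then have "AE x in M. g x - g' x = 0" by (rule L2_norm_eq_0_imp_AE[OF L2_diff[OF g]])
  then show ?thesis by eventually_elim simp
qed

lemma has_L2_deriv_add:
  assumes d: "has_L2_deriv M I f t f'" "has_L2_deriv M I g t g'"
    and f: "\<And>s. s \<in> I \<Longrightarrow> f s \<in> L2 M" and g: "\<And>s. s \<in> I \<Longrightarrow> g s \<in> L2 M" and t: "t \<in> I"
  shows "has_L2_deriv M I (\<lambda>t x. f t x + g t x) t (\<lambda>x. f' x + g' x)"
  unfolding has_L2_deriv_def
proof
  have L: "f' \<in> L2 M" "g' \<in> L2 M" using d by (simp_all add: has_L2_deriv_def)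
  then show "(\<lambda>x. f' x + g' x) \<in> L2 M" by (rule L2_add)
  let ?q = "\<lambda>f s x. (f s x - f t x) / (s - t)"
  show "((\<lambda>s. L2_norm M (\<lambda>x. ((f s x + g s x) - (f t x + g t x)) / (s - t) - (f' x + g' x))) \<longlongrightarrow> 0) (at t within I)"
  proof (rule Lim_null_comparison)
    show "\<forall>\<^sub>F s in at t within I. norm (L2_norm M (\<lambda>x. ((f s x + g s x) - (f t x + g t x)) / (s - t) - (f' x + g' x)))
        \<le> L2_norm M (\<lambda>x. ?q f s x - f' x) + L2_norm M (\<lambda>x. ?q g s x - g' x)"
      unfolding eventually_at_filter
    proof (intro always_eventually allI impI)
      fix s assume s: "s \<noteq> t" "s \<in> I"
      note q = L2_difference_quotient[where f = f, OF f[OF s(2)] f[OF t]]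
        L2_difference_quotient[where f = g, OF g[OF s(2)] g[OF t]]
      have eq: "((f s x + g s x) - (f t x + g t x)) / (s - t) - (f' x + g' x) = (?q f s x - f' x) + (?q g s x - g' x)" for x
        by (simp add: add_divide_distrib diff_divide_distrib)
      show "norm (L2_norm M (\<lambda>x. ((f s x + g s x) - (f t x + g t x)) / (s - t) - (f' x + g' x)))
        \<le> L2_norm M (\<lambda>x. ?q f s x - f' x) + L2_norm M (\<lambda>x. ?q g s x - g' x)"
        unfolding eq real_norm_def abs_of_nonneg[OF L2_norm_nonneg]
        by (rule L2_norm_triangle[OF L2_diff[OF q(1) L(1)] L2_diff[OF q(2) L(2)]])
    qed
    have "((\<lambda>s. L2_norm M (\<lambda>x. ?q f s x - f' x) + L2_norm M (\<lambda>x. ?q g s x - g' x)) \<longlongrightarrow> 0 + 0) (at t within I)"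
      using d unfolding has_L2_deriv_def by (intro tendsto_add) blast+
    then show "((\<lambda>s. L2_norm M (\<lambda>x. ?q f s x - f' x) + L2_norm M (\<lambda>x. ?q g s x - g' x)) \<longlongrightarrow> 0) (at t within I)"
      by simp
  qed
qed

text \<open>The difference is \<open>s - t\<close> times a difference quotient of bounded norm.\<close>

lemma has_L2_deriv_imp_L2_curve:
  assumes d: "\<And>t. t \<in> I \<Longrightarrow> has_L2_deriv M I f t (f' t)" and f: "\<And>s. s \<in> I \<Longrightarrow> f s \<in> L2 M"
  shows "L2_curve M I f"
  unfolding L2_curve_def
proof (intro conjI ballI f)
  fix t assume t: "t \<in> I"
  have g: "f' t \<in> L2 M" using d[OF t] by (simp add: has_L2_deriv_def)
  let ?q = "\<lambda>s x. (f s x - f t x) / (s - t)"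
  show "((\<lambda>s. L2_norm M (\<lambda>x. f s x - f t x)) \<longlongrightarrow> 0) (at t within I)"
  proof (rule Lim_null_comparison)
    show "\<forall>\<^sub>F s in at t within I. norm (L2_norm M (\<lambda>x. f s x - f t x))
        \<le> \<bar>s - t\<bar> * (L2_norm M (\<lambda>x. ?q s x - f' t x) + L2_norm M (f' t))"
      unfolding eventually_at_filter
    proof (intro always_eventually allI impI)
      fix s assume s: "s \<noteq> t" "s \<in> I"
      note q = L2_difference_quotient[where f = f, OF f[OF s(2)] f[OF t]]
      have "L2_norm M (\<lambda>x. f s x - f t x) = \<bar>s - t\<bar> * L2_norm M (?q s)"
        using L2_norm_scale[of M "s - t" "?q s"] s by simp
      moreover have "L2_norm M (?q s) \<le> L2_norm M (\<lambda>x. ?q s x - f' t x) + L2_norm M (f' t)"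
        using L2_norm_triangle[OF L2_diff[OF q g] g] by simp
      ultimately show "norm (L2_norm M (\<lambda>x. f s x - f t x))
          \<le> \<bar>s - t\<bar> * (L2_norm M (\<lambda>x. ?q s x - f' t x) + L2_norm M (f' t))"
        by (simp add: mult_left_mono)
    qed
    have "((\<lambda>s. \<bar>s - t\<bar> * (L2_norm M (\<lambda>x. ?q s x - f' t x) + L2_norm M (f' t))) \<longlongrightarrow> \<bar>t - t\<bar> * (0 + L2_norm M (f' t))) (at t within I)"
      using d[OF t] unfolding has_L2_deriv_def by (intro tendsto_intros) blast
    then show "((\<lambda>s. \<bar>s - t\<bar> * (L2_norm M (\<lambda>x. ?q s x - f' t x) + L2_norm M (f' t))) \<longlongrightarrow> 0) (at t within I)"
      by simp
  qed
qed

lemma C1_L2_props: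
  assumes "C1_L2 M I f"
  shows "\<And>t. t \<in> I \<Longrightarrow> f t \<in> L2 M" "\<And>t. t \<in> I \<Longrightarrow> has_L2_deriv M I f t (L2_deriv M I f t)"
    "L2_curve M I (L2_deriv M I f)" "L2_curve M I f"
proof -
  show L: "f t \<in> L2 M" if "t \<in> I" for t using assms that by (simp add: C1_L2_def)
  show d: "has_L2_deriv M I f t (L2_deriv M I f t)" if "t \<in> I" for t
  proof -
    have "\<exists>g. has_L2_deriv M I f t g" using assms that by (simp add: C1_L2_def)
    then show ?thesis unfolding L2_deriv_def by (rule someI_ex)
  qed
  show "L2_curve M I (L2_deriv M I f)"
    unfolding L2_curve_def
  proof (intro conjI ballI)
    show "L2_deriv M I f t \<in> L2 M" if "t \<in> I" for t using d[OF that] by (simp add: has_L2_deriv_def)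
    show "((\<lambda>s. L2_norm M (\<lambda>x. L2_deriv M I f s x - L2_deriv M I f t x)) \<longlongrightarrow> 0) (at t within I)" if "t \<in> I" for t
      using assms that by (simp add: C1_L2_def norm_continuous_on_def)
  qed
  show "L2_curve M I f" by (rule has_L2_deriv_imp_L2_curve[OF d L])
qed

section \<open>The differential inequality for the perturbed energy\<close>

lemma young_scaled: "0 < d \<Longrightarrow> x * y \<le> d * x\<^sup>2 + y\<^sup>2 / (4 * d)" for x y d :: real
proof -
  assume d: "0 < d"
  have "0 \<le> (2 * d * x - y)\<^sup>2 / (4 * d)" using d by simp
  also have "\<dots> = d * x\<^sup>2 + y\<^sup>2 / (4 * d) - x * y" using d by (simp add: power2_eq_square field_simps)
  finally show ?thesis by simp
qed

text \<open>Here \<open>p\<close>, \<open>g\<close>, \<open>l\<close> stand for the norms of \<open>u\<^sub>t\<close>, \<open>\<nabla>u\<close>, \<open>u\<close>, and \<open>n'\<close> for that of \<open>h\<^sub>t\<close>; \<open>b\<close>, \<open>b'\<close>, \<open>D\<close>,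
  \<open>D'\<close>, \<open>k\<close> are the diagonal values of the terms in \<open>scalar_energy_identity\<close>. The left-hand side is
  \<open>E' + \<eta> E\<close>. The bound on \<open>\<eta>\<close> by \<open>a_min / 4\<close> lets the dissipation absorb \<open>3/2 \<eta> p\<^sup>2\<close>. The bound by
  \<open>a_min / (2 a_max\<^sup>2 c_p)\<close> lets it absorb the rest of the mixed term \<open>\<eta> (D - \<eta> k)\<close> once a third of
  \<open>\<eta> g\<^sup>2\<close> has been spent on it. The boundary term takes another sixth, and together these use up the
  gain \<open>\<eta> g\<^sup>2 / 2\<close> exactly.\<close>

lemma dissipation_bound:
  fixes \<eta> :: real
  assumes \<eta>: "0 < \<eta>" "\<eta> \<le> a_min / 4" "\<eta> * (a_max\<^sup>2 * c_p) \<le> a_min / 2" and c: "0 < c_p" "0 < a_max"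
    and nn: "0 \<le> p" "0 \<le> g" "0 \<le> l" and l: "l\<^sup>2 \<le> c_p * g\<^sup>2"
    and D': "a_min * p\<^sup>2 \<le> D'" and Dk: "\<bar>D - \<eta> * k\<bar> \<le> a_max * p * l" and b': "\<bar>b'\<bar> \<le> C * n' * g"
  shows "- D' - b' + \<eta> * (b - g\<^sup>2 - D + p\<^sup>2) + \<eta> * ((p\<^sup>2 + g\<^sup>2) / 2 - b + \<eta> * k) \<le> (3 * C\<^sup>2 / (2 * \<eta>)) * n'\<^sup>2"
proof -
  \<comment> \<open>The weight is such that the Poincare inequality turns the term with \<open>l\<close> into \<open>g\<^sup>2 / 3\<close>.\<close>
  have "(a_max * p) * l \<le> (3 / 4 * c_p) * (a_max * p)\<^sup>2 + l\<^sup>2 / (4 * (3 / 4 * c_p))"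
    by (rule young_scaled) (use c in simp)
  also have "\<dots> \<le> (3 / 4 * c_p) * (a_max * p)\<^sup>2 + g\<^sup>2 / 3"
    using l c by (simp add: field_simps)
  finally have "\<eta> * (a_max * p * l) \<le> \<eta> * ((3 / 4 * c_p) * (a_max * p)\<^sup>2 + g\<^sup>2 / 3)"
    using \<eta> by (intro mult_left_mono) auto
  also have "\<dots> = 3 / 4 * ((\<eta> * (a_max\<^sup>2 * c_p)) * p\<^sup>2) + \<eta> * g\<^sup>2 / 3"
    by (simp add: power2_eq_square algebra_simps)
  also have "\<dots> \<le> 3 / 4 * (a_min / 2 * p\<^sup>2) + \<eta> * g\<^sup>2 / 3"
    using mult_right_mono[OF \<eta>(3) zero_le_power2[of p]] by linarith
  finally have 1: "\<eta> * (a_max * p * l) \<le> 3 / 8 * (a_min * p\<^sup>2) + \<eta> * g\<^sup>2 / 3" by simp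
  have "\<eta> * - (D - \<eta> * k) \<le> \<eta> * (a_max * p * l)" using Dk \<eta> by (intro mult_left_mono) auto
  then have 2: "- \<eta> * D + \<eta> * (\<eta> * k) \<le> 3 / 8 * (a_min * p\<^sup>2) + \<eta> * g\<^sup>2 / 3" using 1 by (simp add: algebra_simps)
  \<comment> \<open>The weight \<open>\<eta> / 6\<close> is what is left of \<open>\<eta> / 2\<close> after \<open>\<eta> / 3\<close> has been used.\<close>
  have "g * (C * n') \<le> (\<eta> / 6) * g\<^sup>2 + (C * n')\<^sup>2 / (4 * (\<eta> / 6))" by (rule young_scaled) (use \<eta> in simp)
  also have "(C * n')\<^sup>2 / (4 * (\<eta> / 6)) = (3 * C\<^sup>2 / (2 * \<eta>)) * n'\<^sup>2"
    using \<eta> by (simp add: power_mult_distrib)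
  finally have 3: "- b' \<le> \<eta> * g\<^sup>2 / 6 + (3 * C\<^sup>2 / (2 * \<eta>)) * n'\<^sup>2"
    using b' by (simp add: algebra_simps abs_le_iff)
  have 4: "3 / 2 * (\<eta> * p\<^sup>2) \<le> 3 / 8 * (a_min * p\<^sup>2)" using mult_right_mono[OF \<eta>(2), of "p\<^sup>2"] by simp
  have "0 \<le> a_min * p\<^sup>2" using \<eta> by simp
  moreover have "- D' - b' + \<eta> * (b - g\<^sup>2 - D + p\<^sup>2) + \<eta> * ((p\<^sup>2 + g\<^sup>2) / 2 - b + \<eta> * k) =
      - D' - b' + (- \<eta> * D + \<eta> * (\<eta> * k)) + 3 / 2 * (\<eta> * p\<^sup>2) - \<eta> * g\<^sup>2 / 2"
    by (simp add: field_simps)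
  ultimately show ?thesis using 2 3 4 D' by linarith
qed

text \<open>Young's inequality with weights such that \<open>\<eta> k\<close> and \<open>b\<close> each cost at most \<open>g\<^sup>2 / 8\<close>,
  \<open>\<eta> k\<close> a further \<open>p\<^sup>2 / 4\<close>, and \<open>b\<close> a further multiple of the squared norm \<open>n\<^sup>2\<close> of the data.\<close>

lemma perturbed_energy_equivalent:
  fixes \<eta> :: real
  assumes \<eta>: "0 < \<eta>" "\<eta>\<^sup>2 * c_p \<le> 1 / 8" and nn: "0 \<le> p" "0 \<le> g" "0 \<le> l" and l: "l\<^sup>2 \<le> c_p * g\<^sup>2"
    and k: "\<bar>k\<bar> \<le> p * l" and b: "\<bar>b\<bar> \<le> C * n * g"
  shows "(p\<^sup>2 + g\<^sup>2) / 8 - 2 * C\<^sup>2 * n\<^sup>2 \<le> (p\<^sup>2 + g\<^sup>2) / 2 - b + \<eta> * k"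
    "(p\<^sup>2 + g\<^sup>2) / 2 - b + \<eta> * k \<le> (p\<^sup>2 + g\<^sup>2) + 2 * C\<^sup>2 * n\<^sup>2"
proof -
  have "p * (\<eta> * l) \<le> (1 / 4) * p\<^sup>2 + (\<eta> * l)\<^sup>2 / (4 * (1 / 4))" by (rule young_scaled) simp
  also have "(\<eta> * l)\<^sup>2 / (4 * (1 / 4)) = \<eta>\<^sup>2 * l\<^sup>2" by (simp add: power_mult_distrib)
  also have "\<eta>\<^sup>2 * l\<^sup>2 \<le> \<eta>\<^sup>2 * (c_p * g\<^sup>2)" using l by (intro mult_left_mono) auto
  also have "\<dots> \<le> 1 / 8 * g\<^sup>2" using mult_right_mono[OF \<eta>(2), of "g\<^sup>2"] by (simp add: mult.assoc)
  finally have 1: "\<eta> * (p * l) \<le> p\<^sup>2 / 4 + g\<^sup>2 / 8" by (simp add: algebra_simps)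
  have "\<bar>\<eta> * k\<bar> \<le> \<eta> * (p * l)" using k \<eta> by (simp add: abs_mult)
  with 1 have 2: "\<bar>\<eta> * k\<bar> \<le> p\<^sup>2 / 4 + g\<^sup>2 / 8" by linarith
  have "g * (C * n) \<le> (1 / 8) * g\<^sup>2 + (C * n)\<^sup>2 / (4 * (1 / 8))" by (rule young_scaled) simp
  then have 3: "\<bar>b\<bar> \<le> g\<^sup>2 / 8 + 2 * C\<^sup>2 * n\<^sup>2" using b by (simp add: power_mult_distrib algebra_simps)
  have "0 \<le> p\<^sup>2" "0 \<le> g\<^sup>2" by simp_all
  then show "(p\<^sup>2 + g\<^sup>2) / 8 - 2 * C\<^sup>2 * n\<^sup>2 \<le> (p\<^sup>2 + g\<^sup>2) / 2 - b + \<eta> * k"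
    "(p\<^sup>2 + g\<^sup>2) / 2 - b + \<eta> * k \<le> (p\<^sup>2 + g\<^sup>2) + 2 * C\<^sup>2 * n\<^sup>2"
    using 2 3 unfolding abs_le_iff add_divide_distrib by linarith+
qed

text \<open>The function \<open>exp (\<eta> x) E - \<integral> exp (\<eta> s) r\<close> is nonincreasing.\<close>

lemma gronwall_exponential:
  fixes E r :: "real \<Rightarrow> real"
  assumes t: "0 \<le> t" and E: "continuous_on {0..t} E" and r: "continuous_on {0..t} r"
    and d: "\<And>s. 0 < s \<Longrightarrow> s < t \<Longrightarrow> (E has_real_derivative E' s) (at s) \<and> E' s + \<eta> * E s \<le> r s"
  shows "exp (\<eta> * t) * E t \<le> E 0 + integral {0..t} (\<lambda>s. exp (\<eta> * s) * r s)"
proof -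
  let ?R = "\<lambda>x. integral {0..x} (\<lambda>s. exp (\<eta> * s) * r s)"
  have c: "continuous_on {0..t} (\<lambda>s. exp (\<eta> * s) * r s)" by (intro continuous_intros r)
  have Rd: "(?R has_real_derivative exp (\<eta> * x) * r x) (at x within {0..t})" if "x \<in> {0..t}" for x
    by (rule integral_has_real_derivative[OF c that])
  define \<Phi> where "\<Phi> x = exp (\<eta> * x) * E x - ?R x" for x
  have "\<Phi> t \<le> \<Phi> 0"
  proof (rule DERIV_nonpos_imp_decreasing_open[OF t])
    show "continuous_on {0..t} \<Phi>"
      unfolding \<Phi>_def[abs_def] by (intro continuous_intros E DERIV_continuous_on[OF Rd])
    fix x assume x: "0 < x" "x < t"
    have "(?R has_real_derivative exp (\<eta> * x) * r x) (at x)"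
      using Rd[of x] x by (simp add: at_within_Icc_at)
    moreover have "(E has_real_derivative E' x) (at x)" using d[OF x] by simp
    ultimately have "(\<Phi> has_real_derivative exp (\<eta> * x) * (E' x + \<eta> * E x - r x)) (at x)"
      unfolding \<Phi>_def[abs_def] by (auto intro!: derivative_eq_intros simp: algebra_simps)
    moreover have "exp (\<eta> * x) * (E' x + \<eta> * E x - r x) \<le> 0"
      using d[OF x] by (simp add: mult_le_0_iff)
    ultimately show "\<exists>y. (\<Phi> has_real_derivative y) (at x) \<and> y \<le> 0" by blast
  qed
  then show ?thesis by (simp add: \<Phi>_def)
qed

section \<open>Weak solutions\<close>

lemma L2_surface_on_subset:
  fixes f :: "'a::euclidean_space \<Rightarrow> real"
  assumes \<Gamma>: "\<Gamma> \<in> sets borel" "F \<in> sets borel" "\<Gamma> \<subseteq> F" and f: "f \<in> L2 (surface_on F)"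
  shows "f \<in> L2 (surface_on \<Gamma>)" "L2_norm (surface_on \<Gamma>) f \<le> L2_norm (surface_on F) f"
proof -
  let ?\<sigma> = "hausdorff_measure (DIM('a) - 1) :: 'a measure"
  have "restrict_space (restrict_space ?\<sigma> F) \<Gamma> = restrict_space ?\<sigma> (F \<inter> \<Gamma>)"
    by (rule restrict_restrict_space) (use \<Gamma> in simp_all)
  moreover have "F \<inter> \<Gamma> = \<Gamma>" using \<Gamma>(3) by blast
  ultimately have eq: "surface_on \<Gamma> = restrict_space (surface_on F) \<Gamma>" by (simp add: surface_on_def)
  have S: "\<Gamma> \<inter> space (surface_on F) \<in> sets (surface_on F)"
    unfolding surface_on_def by (auto simp: sets_restrict_space space_restrict_space \<Gamma>)
  have fi: "integrable (surface_on F) (\<lambda>x. (norm (f x))\<^sup>2)" and fm: "f \<in> borel_measurable (surface_on F)"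
    using f by (auto simp: L2_iff)
  have ii: "integrable (surface_on F) (\<lambda>x. indicator (\<Gamma> \<inter> space (surface_on F)) x *\<^sub>R (norm (f x))\<^sup>2)"
    by (rule integrable_mult_indicator[OF S fi])
  have ii': "integrable (surface_on F) (\<lambda>x. indicator \<Gamma> x *\<^sub>R (norm (f x))\<^sup>2)"
    by (rule Bochner_Integration.integrable_cong[THEN iffD1, OF refl _ ii]) (simp add: indicator_def)
  have i: "integrable (surface_on \<Gamma>) (\<lambda>x. (norm (f x))\<^sup>2)"
    unfolding eq by (rule integrable_restrict_space[THEN iffD2, OF S ii'])
  have m: "f \<in> borel_measurable (surface_on \<Gamma>)" unfolding eq by (rule measurable_restrict_space1[OF fm])
  show "f \<in> L2 (surface_on \<Gamma>)" using i m by (simp add: L2_iff)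
  have "(\<integral>x. (norm (f x))\<^sup>2 \<partial>surface_on \<Gamma>) = (\<integral>x. indicator \<Gamma> x *\<^sub>R (norm (f x))\<^sup>2 \<partial>surface_on F)"
    unfolding eq by (rule integral_restrict_space[OF S])
  also have "\<dots> \<le> (\<integral>x. (norm (f x))\<^sup>2 \<partial>surface_on F)"
    by (rule integral_mono[OF ii' fi]) (simp add: indicator_def)
  finally show "L2_norm (surface_on \<Gamma>) f \<le> L2_norm (surface_on F) f"
    unfolding L2_norm_def by (rule real_sqrt_le_mono)
qed

lemma L2_norm_le_H1_norm: "L2_norm (lebesgue_on \<Omega>) f \<le> H1_norm \<Omega> f"
  unfolding H1_norm_def by (rule real_le_rsqrt) simp

lemma L2_norm_wgrad_le_H1_norm: "L2_norm (lebesgue_on \<Omega>) (wgrad \<Omega> f) \<le> H1_norm \<Omega> f"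
  unfolding H1_norm_def by (rule real_le_rsqrt) simp

text \<open>Both the values and the gradients are dominated by the \<open>H1\<close> norm.\<close>

lemma H1_curve_L2_curves:
  assumes dom: "smooth_bounded_domain \<Omega>" and U: "\<And>t. t \<in> I \<Longrightarrow> U t \<in> H1 \<Omega>"
    and c: "norm_continuous_on (H1_norm \<Omega>) I U"
  shows "L2_curve (lebesgue_on \<Omega>) I U" "L2_curve (lebesgue_on \<Omega>) I (\<lambda>t. wgrad \<Omega> (U t))"
proof -
  have \<Omega>: "open \<Omega>" using dom by (simp add: smooth_bounded_domain_def)
  have lim: "((\<lambda>s. H1_norm \<Omega> (\<lambda>x. U s x - U t x)) \<longlongrightarrow> 0) (at t within I)" if "t \<in> I" for t
    using c that by (simp add: norm_continuous_on_def)
  show "L2_curve (lebesgue_on \<Omega>) I U"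
  proof (rule L2_curve_dominated[where C = 1, OF H1_imp_L2[OF U] lim])
    fix s t
    show "L2_norm (lebesgue_on \<Omega>) (\<lambda>x. U s x - U t x) \<le> 1 * H1_norm \<Omega> (\<lambda>x. U s x - U t x)"
      using L2_norm_le_H1_norm[of \<Omega> "\<lambda>x. U s x - U t x"] by simp
  qed
  show "L2_curve (lebesgue_on \<Omega>) I (\<lambda>t. wgrad \<Omega> (U t))"
  proof (rule L2_curve_dominated[where C = 1, OF wgrad_props(1)[OF U] lim])
    fix s t assume st: "s \<in> I" "t \<in> I"
    have "L2_norm (lebesgue_on \<Omega>) (\<lambda>x. wgrad \<Omega> (U s) x - wgrad \<Omega> (U t) x) =
        L2_norm (lebesgue_on \<Omega>) (wgrad \<Omega> (\<lambda>x. U s x - U t x))"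
      using L2_norm_wgrad_lincomb[OF \<Omega> U[OF st(1)] U[OF st(2)], of "-1"] by simp
    then show "L2_norm (lebesgue_on \<Omega>) (\<lambda>x. wgrad \<Omega> (U s) x - wgrad \<Omega> (U t) x) \<le> 1 * H1_norm \<Omega> (\<lambda>x. U s x - U t x)"
      using L2_norm_wgrad_le_H1_norm[of \<Omega> "\<lambda>x. U s x - U t x"] by simp
  qed
qed

text \<open>The traces may be chosen independently at different times: the trace inequality, applied
  to differences, makes any choice continuous.\<close>

lemma trace_L2_curve:
  assumes dom: "smooth_bounded_domain \<Omega>" and \<Gamma>: "\<Gamma> \<in> sets borel" "\<Gamma> \<subseteq> frontier \<Omega>"
    and tr: "\<And>t. t \<in> I \<Longrightarrow> is_trace \<Omega> (U t) (g t)" and c: "norm_continuous_on (H1_norm \<Omega>) I U"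
  shows "L2_curve (surface_on \<Gamma>) I g"
proof -
  obtain C where C: "0 \<le> C" "\<And>f g. is_trace \<Omega> f g \<Longrightarrow> L2_norm (surface_on (frontier \<Omega>)) g \<le> C * H1_norm \<Omega> f"
    by (rule trace_inequality[OF dom]) (rule that)
  have F: "frontier \<Omega> \<in> sets borel" by simp
  have L2: "g t \<in> L2 (surface_on (frontier \<Omega>))" if "t \<in> I" for t using tr[OF that] by (simp add: is_trace_def)
  show ?thesis
  proof (rule L2_curve_dominated)
    show "g t \<in> L2 (surface_on \<Gamma>)" if "t \<in> I" for t
      by (rule L2_surface_on_subset(1)[OF \<Gamma>(1) F \<Gamma>(2) L2[OF that]])
    show "((\<lambda>s. H1_norm \<Omega> (\<lambda>x. U s x - U t x)) \<longlongrightarrow> 0) (at t within I)" if "t \<in> I" for t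
      using c that by (simp add: norm_continuous_on_def)
    fix s t assume st: "s \<in> I" "t \<in> I"
    have "is_trace \<Omega> (\<lambda>x. U s x - U t x) (\<lambda>x. g s x - g t x)"
      using is_trace_lincomb[OF dom tr[OF st(1)] tr[OF st(2)], of "-1"] by simp
    then have "L2_norm (surface_on (frontier \<Omega>)) (\<lambda>x. g s x - g t x) \<le> C * H1_norm \<Omega> (\<lambda>x. U s x - U t x)"
      by (rule C(2))
    moreover have "L2_norm (surface_on \<Gamma>) (\<lambda>x. g s x - g t x) \<le> L2_norm (surface_on (frontier \<Omega>)) (\<lambda>x. g s x - g t x)"
      by (rule L2_surface_on_subset(2)[OF \<Gamma>(1) F \<Gamma>(2) L2_diff[OF L2[OF st(1)] L2[OF st(2)]]])
    ultimately show "L2_norm (surface_on \<Gamma>) (\<lambda>x. g s x - g t x) \<le> C * H1_norm \<Omega> (\<lambda>x. U s x - U t x)"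
      by (rule order_trans[rotated])
  qed
qed

lemma L2_inner_wgrad_add:
  assumes "open \<Omega>" "f \<in> H1 \<Omega>" "g \<in> H1 \<Omega>" "p \<in> L2 (lebesgue_on \<Omega>)"
  shows "L2_inner (lebesgue_on \<Omega>) (wgrad \<Omega> (\<lambda>x. f x + g x)) p =
    L2_inner (lebesgue_on \<Omega>) (wgrad \<Omega> f) p + L2_inner (lebesgue_on \<Omega>) (wgrad \<Omega> g) p"
proof -
  note w = wgrad_props(1)[OF assms(2)] wgrad_props(1)[OF assms(3)]
  have h: "(\<lambda>x. f x + g x) \<in> H1 \<Omega>" using H1_lincomb(1)[OF assms(1-3), of 1] by simp
  have "AE x in lebesgue_on \<Omega>. wgrad \<Omega> (\<lambda>x. f x + g x) x = wgrad \<Omega> f x + wgrad \<Omega> g x"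
    using H1_lincomb(2)[OF assms(1-3), of 1] by simp
  then have "L2_inner (lebesgue_on \<Omega>) (wgrad \<Omega> (\<lambda>x. f x + g x)) p =
      L2_inner (lebesgue_on \<Omega>) (\<lambda>x. wgrad \<Omega> f x + wgrad \<Omega> g x) p"
    by (rule L2_inner_cong_AE[OF wgrad_props(1)[OF h] assms(4) L2_add[OF w] assms(4)]) simp
  then show ?thesis using L2_inner_add_left[OF w assms(4)] by simp
qed

text \<open>The sum of the two parts of the solution solves one equation, in which the damping
  acts on the full velocity; and since all terms are continuous in time, the equation holds at every
  time and not only in the sense of distributions. The sum is only equal almost everywhere to the given
  solution at each time, hence the passage to a representative.\<close>

lemma weak_solution_representative:
  fixes \<Omega> :: "'a::euclidean_space set"
  assumes dom: "smooth_bounded_domain \<Omega>" and \<Gamma>1: "\<Gamma>\<^sub>1 \<in> sets borel" "\<Gamma>\<^sub>1 \<subseteq> frontier \<Omega>"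
    and a: "a \<in> borel_measurable (lebesgue_on \<Omega>)" "AE x in lebesgue_on \<Omega>. \<bar>a x\<bar> \<le> B" "0 \<le> B"
    and T: "0 < T" and h: "L2_curve (surface_on \<Gamma>\<^sub>1) {0..T} h"
    and u: "weak_solution \<Omega> \<Gamma>\<^sub>0 \<Gamma>\<^sub>1 a T u0 u1 h u"
  obtains U Ut where "\<And>t. t \<in> {0..T} \<Longrightarrow> U t \<in> H1_zero \<Omega> \<Gamma>\<^sub>0"
    "norm_continuous_on (H1_norm \<Omega>) {0..T} U"
    "L2_curve (lebesgue_on \<Omega>) {0..T} Ut"
    "\<And>t. t \<in> {0..T} \<Longrightarrow> has_L2_deriv (lebesgue_on \<Omega>) {0..T} U t (Ut t)"
    "AE x in lebesgue_on \<Omega>. U 0 x = u0 x" "AE x in lebesgue_on \<Omega>. Ut 0 x = u1 x"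
    "\<And>t. t \<in> {0..T} \<Longrightarrow> AE x in lebesgue_on \<Omega>. u t x = U t x"
    "\<And>\<phi> \<phi>\<^sub>\<Gamma> t. \<phi> \<in> H1_zero \<Omega> \<Gamma>\<^sub>0 \<Longrightarrow> is_trace \<Omega> \<phi> \<phi>\<^sub>\<Gamma> \<Longrightarrow> t \<in> {0<..<T} \<Longrightarrow>
       ((\<lambda>t. L2_inner (lebesgue_on \<Omega>) (Ut t) \<phi>) has_real_derivative
         (L2_inner (surface_on \<Gamma>\<^sub>1) (h t) \<phi>\<^sub>\<Gamma> - L2_inner (lebesgue_on \<Omega>) (wgrad \<Omega> (U t)) (wgrad \<Omega> \<phi>)
           - L2_inner (lebesgue_on \<Omega>) (\<lambda>x. a x * Ut t x) \<phi>)) (at t)"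
proof -
  let ?M = "lebesgue_on \<Omega>" and ?S = "surface_on \<Gamma>\<^sub>1" and ?I = "{0..T}"
  have \<Omega>: "open \<Omega>" using dom by (simp add: smooth_bounded_domain_def)
  obtain v w where sv: "weak_solution_v \<Omega> \<Gamma>\<^sub>0 \<Gamma>\<^sub>1 T u0 u1 h v" and sw: "weak_solution_w \<Omega> \<Gamma>\<^sub>0 T a v w"
    and uvw: "\<forall>t\<in>?I. AE x in ?M. u t x = v t x + w t x"
    using u unfolding weak_solution_def by blast
  define vt where "vt = L2_deriv ?M ?I v"
  define wt where "wt = L2_deriv ?M ?I w"
  have fv: "finite_energy \<Omega> \<Gamma>\<^sub>0 T v" and v0: "AE x in ?M. v 0 x = u0 x" "AE x in ?M. vt 0 x = u1 x"
    and wv: "\<And>\<phi> \<phi>\<^sub>\<Gamma>. \<phi> \<in> H1_zero \<Omega> \<Gamma>\<^sub>0 \<Longrightarrow> is_trace \<Omega> \<phi> \<phi>\<^sub>\<Gamma> \<Longrightarrow>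
         has_weak_deriv {0<..<T} 1 (\<lambda>t. L2_inner ?M (vt t) \<phi>)
           (\<lambda>t. L2_inner ?S (h t) \<phi>\<^sub>\<Gamma> - L2_inner ?M (wgrad \<Omega> (v t)) (wgrad \<Omega> \<phi>))"
    using sv unfolding weak_solution_v_def Let_def vt_def by blast+
  have fw: "finite_energy \<Omega> \<Gamma>\<^sub>0 T w" and w0: "AE x in ?M. w 0 x = 0" "AE x in ?M. wt 0 x = 0"
    and ww: "\<And>\<phi>. \<phi> \<in> H1_zero \<Omega> \<Gamma>\<^sub>0 \<Longrightarrow>
         has_weak_deriv {0<..<T} 1 (\<lambda>t. L2_inner ?M (wt t) \<phi>)
           (\<lambda>t. - L2_inner ?M (wgrad \<Omega> (w t)) (wgrad \<Omega> \<phi>) - L2_inner ?M (\<lambda>x. a x * (wt t x + vt t x)) \<phi>)"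
    using sw unfolding weak_solution_w_def Let_def vt_def wt_def by blast+
  have vz: "v t \<in> H1_zero \<Omega> \<Gamma>\<^sub>0" and wz: "w t \<in> H1_zero \<Omega> \<Gamma>\<^sub>0" if "t \<in> ?I" for t
    using fv fw that by (simp_all add: finite_energy_def)
  note vH = H1_zero_imp_H1[OF vz] and wH = H1_zero_imp_H1[OF wz]
  have vc: "norm_continuous_on (H1_norm \<Omega>) ?I v" "C1_L2 ?M ?I v" and wc: "norm_continuous_on (H1_norm \<Omega>) ?I w" "C1_L2 ?M ?I w"
    using fv fw by (simp_all add: finite_energy_def)
  note vC = C1_L2_props[OF vc(2), folded vt_def] and wC = C1_L2_props[OF wc(2), folded wt_def]
  define U where "U t x = v t x + w t x" for t x
  define Ut where "Ut t x = vt t x + wt t x" for t x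
  have Uz: "U t \<in> H1_zero \<Omega> \<Gamma>\<^sub>0" if "t \<in> ?I" for t
    using H1_zero_lincomb[OF dom vz[OF that] wz[OF that], of 1] by (simp add: U_def[abs_def])
  have Uc: "norm_continuous_on (H1_norm \<Omega>) ?I U"
    unfolding norm_continuous_on_def
  proof
    fix t assume t: "t \<in> ?I"
    show "((\<lambda>s. H1_norm \<Omega> (\<lambda>x. U s x - U t x)) \<longlongrightarrow> 0) (at t within ?I)"
    proof (rule Lim_null_comparison)
      show "\<forall>\<^sub>F s in at t within ?I. norm (H1_norm \<Omega> (\<lambda>x. U s x - U t x)) \<le>
          H1_norm \<Omega> (\<lambda>x. v s x - v t x) + H1_norm \<Omega> (\<lambda>x. w s x - w t x)"
        unfolding eventually_at_filter
      proof (intro always_eventually allI impI)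
        fix s assume s: "s \<in> ?I"
        have d: "(\<lambda>x. v s x - v t x) \<in> H1 \<Omega>" "(\<lambda>x. w s x - w t x) \<in> H1 \<Omega>"
          using H1_lincomb(1)[OF \<Omega> vH[OF s] vH[OF t], of "-1"] H1_lincomb(1)[OF \<Omega> wH[OF s] wH[OF t], of "-1"] by simp_all
        have "(\<lambda>x. U s x - U t x) = (\<lambda>x. (v s x - v t x) + 1 * (w s x - w t x))" by (simp add: U_def fun_eq_iff)
        then show "norm (H1_norm \<Omega> (\<lambda>x. U s x - U t x)) \<le>
            H1_norm \<Omega> (\<lambda>x. v s x - v t x) + H1_norm \<Omega> (\<lambda>x. w s x - w t x)"
          using H1_norm_lincomb_le[OF \<Omega> d, of 1] by simp
      qed
      have "((\<lambda>s. H1_norm \<Omega> (\<lambda>x. v s x - v t x) + H1_norm \<Omega> (\<lambda>x. w s x - w t x)) \<longlongrightarrow> 0 + 0) (at t within ?I)"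
        using vc(1) wc(1) t unfolding norm_continuous_on_def by (intro tendsto_add) blast+
      then show "((\<lambda>s. H1_norm \<Omega> (\<lambda>x. v s x - v t x) + H1_norm \<Omega> (\<lambda>x. w s x - w t x)) \<longlongrightarrow> 0) (at t within ?I)" by simp
    qed
  qed
  have Utc: "L2_curve ?M ?I Ut" unfolding Ut_def[abs_def] by (rule L2_curve_add[OF vC(3) wC(3)])
  have Ud: "has_L2_deriv ?M ?I U t (Ut t)" if "t \<in> ?I" for t
    unfolding U_def[abs_def] Ut_def[abs_def]
    by (rule has_L2_deriv_add[OF vC(2)[OF that] wC(2)[OF that] vC(1) wC(1) that])
  have U0: "AE x in ?M. U 0 x = u0 x" using v0(1) w0(1) by eventually_elim (simp add: U_def)
  have Ut0: "AE x in ?M. Ut 0 x = u1 x" using v0(2) w0(2) by eventually_elim (simp add: Ut_def)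
  have uU: "AE x in ?M. u t x = U t x" if "t \<in> ?I" for t using uvw that unfolding U_def by blast
  have eqn: "((\<lambda>t. L2_inner ?M (Ut t) \<phi>) has_real_derivative
         (L2_inner ?S (h t) \<phi>\<^sub>\<Gamma> - L2_inner ?M (wgrad \<Omega> (U t)) (wgrad \<Omega> \<phi>)
           - L2_inner ?M (\<lambda>x. a x * Ut t x) \<phi>)) (at t)"
    if \<phi>: "\<phi> \<in> H1_zero \<Omega> \<Gamma>\<^sub>0" "is_trace \<Omega> \<phi> \<phi>\<^sub>\<Gamma>" and t: "t \<in> {0<..<T}" for \<phi> \<phi>\<^sub>\<Gamma> t
  proof -
    have \<phi>L: "\<phi> \<in> L2 ?M" by (rule H1_imp_L2[OF H1_zero_imp_H1[OF \<phi>(1)]])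
    have \<phi>g: "wgrad \<Omega> \<phi> \<in> L2 ?M" by (rule wgrad_props(1)[OF H1_zero_imp_H1[OF \<phi>(1)]])
    have "\<phi>\<^sub>\<Gamma> \<in> L2 (surface_on (frontier \<Omega>))" using \<phi>(2) by (simp add: is_trace_def)
    then have \<phi>\<Gamma>: "\<phi>\<^sub>\<Gamma> \<in> L2 ?S" by (rule L2_surface_on_subset(1)[OF \<Gamma>1(1) _ \<Gamma>1(2), rotated]) simp
    have ti: "t \<in> ?I" using t by auto
    have gv: "L2_curve ?M ?I (\<lambda>t. wgrad \<Omega> (v t))" by (rule H1_curve_L2_curves(2)[OF dom vH vc(1)])
    have gw: "L2_curve ?M ?I (\<lambda>t. wgrad \<Omega> (w t))" by (rule H1_curve_L2_curves(2)[OF dom wH wc(1)])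
    have aUt: "L2_curve ?M ?I (\<lambda>t x. a x * (wt t x + vt t x))"
      by (rule L2_curve_mult_bounded[OF a L2_curve_add[OF wC(3) vC(3)]])
    have 1: "((\<lambda>t. L2_inner ?M (vt t) \<phi>) has_real_derivative
        (L2_inner ?S (h t) \<phi>\<^sub>\<Gamma> - L2_inner ?M (wgrad \<Omega> (v t)) (wgrad \<Omega> \<phi>))) (at t)"
    proof (rule continuous_weak_deriv_imp_deriv[OF T _ _ wv[OF \<phi>] t])
      show "continuous_on ?I (\<lambda>t. L2_inner ?M (vt t) \<phi>)" by (rule L2_curve_inner_continuous_on_left[OF vC(3) \<phi>L])
      show "continuous_on ?I (\<lambda>t. L2_inner ?S (h t) \<phi>\<^sub>\<Gamma> - L2_inner ?M (wgrad \<Omega> (v t)) (wgrad \<Omega> \<phi>))"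
        by (rule continuous_on_diff[OF L2_curve_inner_continuous_on_left[OF h \<phi>\<Gamma>] L2_curve_inner_continuous_on_left[OF gv \<phi>g]])
    qed
    have 2: "((\<lambda>t. L2_inner ?M (wt t) \<phi>) has_real_derivative
        (- L2_inner ?M (wgrad \<Omega> (w t)) (wgrad \<Omega> \<phi>) - L2_inner ?M (\<lambda>x. a x * (wt t x + vt t x)) \<phi>)) (at t)"
    proof (rule continuous_weak_deriv_imp_deriv[OF T _ _ ww[OF \<phi>(1)] t])
      show "continuous_on ?I (\<lambda>t. L2_inner ?M (wt t) \<phi>)" by (rule L2_curve_inner_continuous_on_left[OF wC(3) \<phi>L])
      show "continuous_on ?I (\<lambda>t. - L2_inner ?M (wgrad \<Omega> (w t)) (wgrad \<Omega> \<phi>) - L2_inner ?M (\<lambda>x. a x * (wt t x + vt t x)) \<phi>)"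
        by (rule continuous_on_diff[OF continuous_on_minus[OF L2_curve_inner_continuous_on_left[OF gw \<phi>g]]
              L2_curve_inner_continuous_on_left[OF aUt \<phi>L]])
    qed
    have eq1: "L2_inner ?M (wgrad \<Omega> (U t)) (wgrad \<Omega> \<phi>) =
        L2_inner ?M (wgrad \<Omega> (v t)) (wgrad \<Omega> \<phi>) + L2_inner ?M (wgrad \<Omega> (w t)) (wgrad \<Omega> \<phi>)"
      unfolding U_def[abs_def] by (rule L2_inner_wgrad_add[OF \<Omega> vH[OF ti] wH[OF ti] \<phi>g])
    have eq2: "(\<lambda>x. a x * (wt t x + vt t x)) = (\<lambda>x. a x * Ut t x)" by (simp add: Ut_def add.commute)
    have "((\<lambda>t. L2_inner ?M (vt t) \<phi> + L2_inner ?M (wt t) \<phi>) has_real_derivative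
        (L2_inner ?S (h t) \<phi>\<^sub>\<Gamma> - L2_inner ?M (wgrad \<Omega> (U t)) (wgrad \<Omega> \<phi>) - L2_inner ?M (\<lambda>x. a x * Ut t x) \<phi>)) (at t)"
      by (rule DERIV_cong[OF DERIV_add[OF 1 2[unfolded eq2]]]) (simp add: eq1)
    moreover have "L2_inner ?M (vt s) \<phi> + L2_inner ?M (wt s) \<phi> = L2_inner ?M (Ut s) \<phi>" if "s \<in> {0<..<T}" for s
    proof -
      have "s \<in> ?I" using that by auto
      then show ?thesis
        unfolding Ut_def[abs_def] by (intro L2_inner_add_left[symmetric] \<phi>L L2_curve_L2[OF vC(3)] L2_curve_L2[OF wC(3)])
    qed
    ultimately show ?thesis
      by (rule has_field_derivative_transform_within_open[OF _ open_greaterThanLessThan t])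
  qed
  show ?thesis by (rule that[of U Ut]) (fact Uz Uc Utc Ud U0 Ut0 uU eqn)+
qed

text \<open>The energy is built from a chosen weak gradient and a chosen derivative on the half line.
  Both are unique almost everywhere, so they can be computed from the representative on \<open>[0, T]\<close>; the
  assumption \<open>t < T\<close> makes the two time intervals agree near \<open>t\<close>.\<close>

lemma energy_of_representative:
  assumes dom: "smooth_bounded_domain \<Omega>" and t: "0 \<le> t" "t < T"
    and U: "\<And>t. t \<in> {0..T} \<Longrightarrow> U t \<in> H1 \<Omega>"
    and d: "has_L2_deriv (lebesgue_on \<Omega>) {0..T} U t g"
    and ae: "\<And>t. t \<in> {0..T} \<Longrightarrow> AE x in lebesgue_on \<Omega>. u t x = U t x"
  shows "energy \<Omega> u t = ((L2_norm (lebesgue_on \<Omega>) g)\<^sup>2 + (L2_norm (lebesgue_on \<Omega>) (wgrad \<Omega> (U t)))\<^sup>2) / 2"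
proof -
  let ?M = "lebesgue_on \<Omega>" and ?I = "{0..T}"
  have \<Omega>: "open \<Omega>" using dom by (simp add: smooth_bounded_domain_def)
  then have \<Omega>m: "\<Omega> \<in> sets lebesgue" by simp
  have ti: "t \<in> ?I" using t by simp
  have ae': "AE x in ?M. U s x = u s x" if "s \<in> ?I" for s using ae[OF that] by eventually_elim simp
  have UL: "U s \<in> L2 ?M" if "s \<in> ?I" for s by (rule H1_imp_L2[OF U[OF that]])
  have um: "u s \<in> borel_measurable ?M" if "s \<in> ?I" for s
    by (rule borel_measurable_lebesgue_on_cong_AE[OF \<Omega>m L2_measurable[OF UL[OF that]] ae'[OF that]])
  have uL: "u s \<in> L2 ?M" if "s \<in> ?I" for s by (rule L2_cong_AE[OF UL[OF that] um[OF that] ae'[OF that]])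
  have wu: "has_weak_grad \<Omega> (u t) (wgrad \<Omega> (U t))"
    by (rule has_weak_grad_cong_AE[OF \<Omega>m ae'[OF ti] wgrad_props(2)[OF U[OF ti]]])
  have uH: "u t \<in> H1 \<Omega>" unfolding H1_def using uL[OF ti] wu wgrad_props(1)[OF U[OF ti]] by blast
  have 1: "L2_norm ?M (wgrad \<Omega> (u t)) = L2_norm ?M (wgrad \<Omega> (U t))"
    by (rule L2_norm_cong_AE[OF L2_measurable[OF wgrad_props(1)[OF uH]] L2_measurable[OF wgrad_props(1)[OF U[OF ti]]]
          wgrad_AE_eq[OF \<Omega> uH wu]])
  have at: "at t within {0..} = at t within ?I"
    by (rule at_within_nhd[of t "{..<T}"]) (use t in auto)
  have iff: "has_L2_deriv ?M {0..} u t g' \<longleftrightarrow> has_L2_deriv ?M ?I U t g'" for g'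
  proof (cases "g' \<in> L2 ?M")
    case True
    have "\<forall>\<^sub>F s in at t within ?I. L2_norm ?M (\<lambda>x. (u s x - u t x) / (s - t) - g' x) = L2_norm ?M (\<lambda>x. (U s x - U t x) / (s - t) - g' x)"
      unfolding eventually_at_filter
    proof (intro always_eventually allI impI)
      fix s assume s: "s \<in> ?I"
      show "L2_norm ?M (\<lambda>x. (u s x - u t x) / (s - t) - g' x) = L2_norm ?M (\<lambda>x. (U s x - U t x) / (s - t) - g' x)"
      proof (rule L2_norm_cong_AE)
        show "(\<lambda>x. (u s x - u t x) / (s - t) - g' x) \<in> borel_measurable ?M"
          by (rule L2_measurable[OF L2_diff[OF L2_difference_quotient[where f = u, OF uL[OF s] uL[OF ti]] True]])
        show "(\<lambda>x. (U s x - U t x) / (s - t) - g' x) \<in> borel_measurable ?M"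
          by (rule L2_measurable[OF L2_diff[OF L2_difference_quotient[where f = U, OF UL[OF s] UL[OF ti]] True]])
        show "AE x in ?M. (u s x - u t x) / (s - t) - g' x = (U s x - U t x) / (s - t) - g' x"
          using ae[OF s] ae[OF ti] by eventually_elim simp
      qed
    qed
    then show ?thesis unfolding has_L2_deriv_def at by (simp add: tendsto_cong)
  qed (simp add: has_L2_deriv_def)
  have "has_L2_deriv ?M {0..} u t g" unfolding iff by (rule d)
  then have "has_L2_deriv ?M {0..} u t (L2_deriv ?M {0..} u t)" 
    unfolding L2_deriv_def by (rule someI[where P = "has_L2_deriv ?M {0..} u t"])
  then have d': "has_L2_deriv ?M ?I U t (L2_deriv ?M {0..} u t)" unfolding iff .
  have "at t within ?I \<noteq> bot" using t by (simp add: trivial_limit_within)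
  from has_L2_deriv_unique[OF d' d UL ti this]
  have 2: "L2_norm ?M (L2_deriv ?M {0..} u t) = L2_norm ?M g"
    using d d' unfolding has_L2_deriv_def by (intro L2_norm_cong_AE L2_measurable) blast+
  show ?thesis unfolding energy_def 1 2 by simp
qed

section \<open>Decay of the energy\<close>

text \<open>The estimate without the factor \<open>exp (\<delta>\<^sub>1 t)\<close>. The multiplier \<open>\<eta> = 2\<alpha>\<close> of the perturbation
  equals the decay rate, and the constant depends on the domain through \<open>c_p\<close> and the trace inequality.\<close>

lemma energy_decay_estimate:
  fixes \<Omega> \<Gamma>\<^sub>0 \<Gamma>\<^sub>1 :: "'a::euclidean_space set"
  assumes dom: "smooth_bounded_domain \<Omega>" and \<Gamma>1: "\<Gamma>\<^sub>1 \<in> sets borel" "\<Gamma>\<^sub>1 \<subseteq> frontier \<Omega>"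
    and a: "a \<in> borel_measurable (lebesgue_on \<Omega>)" "AE x in lebesgue_on \<Omega>. a_min \<le> a x \<and> a x \<le> a_max"
    and pos: "0 < a_min" "0 < a_max" "0 < c_p"
    and poincare: "\<And>\<phi>. \<phi> \<in> H1_zero \<Omega> \<Gamma>\<^sub>0 \<Longrightarrow>
          (L2_norm (lebesgue_on \<Omega>) \<phi>)\<^sup>2 \<le> c_p * (L2_norm (lebesgue_on \<Omega>) (wgrad \<Omega> \<phi>))\<^sup>2"
    and \<alpha>: "0 < \<alpha>" "\<alpha> < eps0 a_min a_max c_p / 2"
  obtains c where "0 < c" "\<And>u0 u1 h u t. u0 \<in> H1_zero \<Omega> \<Gamma>\<^sub>0 \<Longrightarrow> u1 \<in> L2 (lebesgue_on \<Omega>) \<Longrightarrow>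
    C1_L2 (surface_on \<Gamma>\<^sub>1) {0..} h \<Longrightarrow> global_weak_solution \<Omega> \<Gamma>\<^sub>0 \<Gamma>\<^sub>1 a u0 u1 h u \<Longrightarrow> 0 \<le> t \<Longrightarrow>
    energy \<Omega> u t \<le> c * exp (- 2 * \<alpha> * t) * data_bound \<Omega> \<Gamma>\<^sub>1 \<alpha> u0 u1 h t"
proof -
  let ?M = "lebesgue_on \<Omega>" and ?S = "surface_on \<Gamma>\<^sub>1" and ?F = "surface_on (frontier \<Omega>)"
  have \<Omega>: "open \<Omega>" "\<Omega> \<noteq> {}" using dom by (simp_all add: smooth_bounded_domain_def)
  define \<eta> where "\<eta> = 2 * \<alpha>"
  have \<eta>0: "0 < \<eta>" using \<alpha> by (simp add: \<eta>_def)
  have \<eta>1: "\<eta> \<le> a_min / 4" "\<eta> \<le> a_min / (2 * a_max\<^sup>2 * c_p)" using \<alpha>(2) by (simp_all add: \<eta>_def eps0_def)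
  have ac: "0 < a_max\<^sup>2 * c_p" using pos by simp
  have \<eta>2: "\<eta> * (a_max\<^sup>2 * c_p) \<le> a_min / 2"
    using mult_right_mono[OF \<eta>1(2), of "a_max\<^sup>2 * c_p"] ac pos by simp
  \<comment> \<open>The bounds on \<open>a\<close> hold almost everywhere on a set of positive measure.\<close>
  have amm: "a_min \<le> a_max"
  proof (rule ccontr)
    assume "\<not> ?thesis"
    then have "AE x in ?M. False" using a(2) by (auto elim: eventually_mono)
    then have "AE x in lebesgue. x \<notin> \<Omega>" using \<Omega>(1) by (simp add: AE_restrict_space_iff)
    then have "\<Omega> \<in> null_sets lebesgue" using \<Omega>(1) by (simp add: AE_iff_null_sets)
    then have "negligible \<Omega>" by (simp add: negligible_iff_null_sets)
    then show False using open_not_negligible[OF \<Omega>] by simp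
  qed
  have \<eta>3: "\<eta>\<^sup>2 * c_p \<le> 1 / 8"
  proof -
    have "\<eta> * (\<eta> * (a_max\<^sup>2 * c_p)) \<le> (a_min / 4) * (a_min / 2)"
      using \<eta>1(1) \<eta>2 \<eta>0 ac pos by (intro mult_mono) auto
    also have "\<dots> \<le> a_max\<^sup>2 / 8" using amm pos by (simp add: power2_eq_square mult_mono)
    finally have "(\<eta>\<^sup>2 * c_p) * a_max\<^sup>2 \<le> (1 / 8) * a_max\<^sup>2" by (simp add: power2_eq_square algebra_simps)
    then show ?thesis using pos by simp
  qed
  have abs_a: "AE x in ?M. \<bar>a x\<bar> \<le> a_max" using a(2) by eventually_elim (use pos in auto)
  \<comment> \<open>Subtracting \<open>\<eta>\<close> from \<open>a\<close> merges the damping term with the term \<open>\<eta>\<^sup>2 (u\<^sub>t, u)\<close> that comes from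
      \<open>\<eta> E\<close>, without enlarging the bound.\<close>
  have abs_a\<eta>: "AE x in ?M. \<bar>a x - \<eta>\<bar> \<le> a_max" using a(2) by eventually_elim (use pos \<eta>0 \<eta>1(1) in auto)
  have a\<eta>m: "(\<lambda>x. a x - \<eta>) \<in> borel_measurable ?M" using a(1) by (intro borel_measurable_diff) auto
  obtain C0 where C0: "0 \<le> C0" "\<And>f g. is_trace \<Omega> f g \<Longrightarrow> L2_norm ?F g \<le> C0 * H1_norm \<Omega> f"
    by (rule trace_inequality[OF dom]) (rule that)
  \<comment> \<open>By the Poincare inequality, \<open>C\<close> bounds traces by the gradient alone.\<close>
  define C where "C = C0 * sqrt (1 + c_p)"
  have C: "0 \<le> C" using C0 pos by (simp add: C_def)
  define C1 where "C1 = 3 * C\<^sup>2 / (2 * \<eta>)"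
  have C1: "0 \<le> C1" using \<eta>0 by (simp add: C1_def)
  \<comment> \<open>The energy is at most \<open>4 E + 8 C\<^sup>2 \<bar>h\<bar>\<^sup>2\<close>, and \<open>c\<close> dominates every coefficient that results.\<close>
  define c where "c = 4 * (1 + 2 * C\<^sup>2 + C1)"
  have c0: "0 < c" unfolding c_def using C1 by (intro mult_pos_pos add_pos_nonneg) auto
  have "energy \<Omega> u t \<le> c * exp (- 2 * \<alpha> * t) * data_bound \<Omega> \<Gamma>\<^sub>1 \<alpha> u0 u1 h t"
    if u0: "u0 \<in> H1_zero \<Omega> \<Gamma>\<^sub>0" and u1: "u1 \<in> L2 ?M" and h: "C1_L2 ?S {0..} h"
      and sol: "global_weak_solution \<Omega> \<Gamma>\<^sub>0 \<Gamma>\<^sub>1 a u0 u1 h u" and t: "0 \<le> t" for u0 u1 h u t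
  proof -
    \<comment> \<open>The solution is needed slightly beyond \<open>t\<close>, so that \<open>t\<close> is not the right end of the interval.\<close>
    define T where "T = t + 1"
    have T: "0 < T" "t < T" using t by (auto simp: T_def)
    let ?J = "{0..T}" and ?I = "{0<..<T}"
    define ht where "ht = L2_deriv ?S {0..} h"
    note hC = C1_L2_props[OF h, folded ht_def]
    have J0: "?J \<subseteq> {0..}" by auto
    have IJ: "?I \<subseteq> ?J" by auto
    have hJ: "L2_curve ?S ?J h" and htJ: "L2_curve ?S ?J ht" by (rule L2_curve_subset[OF _ J0], rule hC)+
    have "weak_solution \<Omega> \<Gamma>\<^sub>0 \<Gamma>\<^sub>1 a T u0 u1 h u" using sol T(1) by (simp add: global_weak_solution_def)
    then obtain U Ut where Uz: "\<And>t. t \<in> ?J \<Longrightarrow> U t \<in> H1_zero \<Omega> \<Gamma>\<^sub>0"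
      and Uc: "norm_continuous_on (H1_norm \<Omega>) ?J U" and Utc: "L2_curve ?M ?J Ut"
      and Ud: "\<And>t. t \<in> ?J \<Longrightarrow> has_L2_deriv ?M ?J U t (Ut t)"
      and U0: "AE x in ?M. U 0 x = u0 x" and Ut0: "AE x in ?M. Ut 0 x = u1 x"
      and uU: "\<And>t. t \<in> ?J \<Longrightarrow> AE x in ?M. u t x = U t x"
      and eqn: "\<And>\<phi> \<phi>\<^sub>\<Gamma> t. \<phi> \<in> H1_zero \<Omega> \<Gamma>\<^sub>0 \<Longrightarrow> is_trace \<Omega> \<phi> \<phi>\<^sub>\<Gamma> \<Longrightarrow> t \<in> ?I \<Longrightarrow>
       ((\<lambda>t. L2_inner ?M (Ut t) \<phi>) has_real_derivative
         (L2_inner ?S (h t) \<phi>\<^sub>\<Gamma> - L2_inner ?M (wgrad \<Omega> (U t)) (wgrad \<Omega> \<phi>)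
           - L2_inner ?M (\<lambda>x. a x * Ut t x) \<phi>)) (at t)"
      by (rule weak_solution_representative[OF dom \<Gamma>1 a(1) abs_a less_imp_le[OF pos(2)] T(1) hJ]) (rule that)
    have UH: "U s \<in> H1 \<Omega>" if "s \<in> ?J" for s by (rule H1_zero_imp_H1[OF Uz[OF that]])
    note UL = H1_imp_L2[OF UH] and gL = wgrad_props(1)[OF UH] and UtL = L2_curve_L2[OF Utc]
    note gc = H1_curve_L2_curves(2)[OF dom UH Uc] and ULc = H1_curve_L2_curves(1)[OF dom UH Uc]
    have "\<exists>g. is_trace \<Omega> (U s) g" if "s \<in> ?J" for s using Uz[OF that] by (auto simp: H1_zero_def)
    then obtain \<tau> where \<tau>: "\<And>s. s \<in> ?J \<Longrightarrow> is_trace \<Omega> (U s) (\<tau> s)" by metis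
    have \<tau>c: "L2_curve ?S ?J \<tau>" by (rule trace_L2_curve[OF dom \<Gamma>1 \<tau> Uc])
    have auc: "L2_curve ?M ?J (\<lambda>t x. a x * Ut t x)"
      by (rule L2_curve_mult_bounded[OF a(1) abs_a less_imp_le[OF pos(2)] Utc])
    note auL = L2_curve_L2[OF auc]
    \<comment> \<open>The functions of two times to which the scalar energy identity applies.\<close>
    define k where "k t s = L2_inner ?M (Ut t) (U s)" for t s
    define P where "P t s = L2_inner ?M (Ut t) (Ut s)" for t s
    define A where "A t s = L2_inner ?M (wgrad \<Omega> (U t)) (wgrad \<Omega> (U s))" for t s
    define D where "D t s = L2_inner ?M (\<lambda>x. a x * Ut t x) (U s)" for t s
    define D' where "D' t s = L2_inner ?M (\<lambda>x. a x * Ut t x) (Ut s)" for t s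
    define b where "b t s = L2_inner ?S (h t) (\<tau> s)" for t s
    define b' where "b' t s = L2_inner ?S (ht t) (\<tau> s)" for t s
    have contJ: "continuous_on (?J \<times> ?J) (\<lambda>p. F (fst p) (snd p))" if "F \<in> {P, A, D, D', b, b', k}" for F
    proof -
      have "continuous_on (?J \<times> ?J) (\<lambda>p. P (fst p) (snd p))" unfolding P_def by (rule L2_curve_inner_continuous_on[OF Utc Utc])
      moreover have "continuous_on (?J \<times> ?J) (\<lambda>p. A (fst p) (snd p))" unfolding A_def by (rule L2_curve_inner_continuous_on[OF gc gc])
      moreover have "continuous_on (?J \<times> ?J) (\<lambda>p. D (fst p) (snd p))" unfolding D_def by (rule L2_curve_inner_continuous_on[OF auc ULc])
      moreover have "continuous_on (?J \<times> ?J) (\<lambda>p. D' (fst p) (snd p))" unfolding D'_def by (rule L2_curve_inner_continuous_on[OF auc Utc])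
      moreover have "continuous_on (?J \<times> ?J) (\<lambda>p. b (fst p) (snd p))" unfolding b_def by (rule L2_curve_inner_continuous_on[OF hJ \<tau>c])
      moreover have "continuous_on (?J \<times> ?J) (\<lambda>p. b' (fst p) (snd p))" unfolding b'_def by (rule L2_curve_inner_continuous_on[OF htJ \<tau>c])
      moreover have "continuous_on (?J \<times> ?J) (\<lambda>p. k (fst p) (snd p))" unfolding k_def by (rule L2_curve_inner_continuous_on[OF Utc ULc])
      ultimately show ?thesis using that by (elim insertE) simp_all
    qed
    have contI: "continuous_on (?I \<times> ?I) (\<lambda>p. F (fst p) (snd p))" if "F \<in> {P, A, D, D', b, b'}" for F
      by (rule continuous_on_subset[OF contJ Sigma_mono[OF IJ IJ]]) (use that in blast)
    have diag: "continuous_on ?J (\<lambda>t. F t t)" if "F \<in> {P, A, D, D', b, b', k}" for F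
    proof -
      have "continuous_on ?J (\<lambda>t. (\<lambda>p. F (fst p) (snd p)) (t, t))"
        by (rule continuous_on_compose2[OF contJ[OF that]]) (auto intro!: continuous_intros)
      then show ?thesis by simp
    qed
    have inJ: "s \<in> ?J" if "s \<in> ?I" for s using that by auto
    have atJ: "at s within ?J = at s" if "s \<in> ?I" for s using that by (simp add: at_within_Icc_at)
    have ks: "((\<lambda>s. k t s) has_real_derivative P t s) (at s)" if "t \<in> ?I" "s \<in> ?I" for t s
      using has_L2_deriv_inner[OF UtL[OF inJ[OF that(1)]] Ud[OF inJ[OF that(2)]] UL inJ[OF that(2)]]
      unfolding atJ[OF that(2)] k_def P_def .
    have Ds: "((\<lambda>s. D t s) has_real_derivative D' t s) (at s)" if "t \<in> ?I" "s \<in> ?I" for t s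
      using has_L2_deriv_inner[OF auL[OF inJ[OF that(1)]] Ud[OF inJ[OF that(2)]] UL inJ[OF that(2)]]
      unfolding atJ[OF that(2)] D_def D'_def .
    have bt: "((\<lambda>t. b t s) has_real_derivative b' t s) (at t)" if "t \<in> ?I" "s \<in> ?I" for t s
    proof -
      have "has_L2_deriv ?S ?J h t (ht t)"
        by (rule has_L2_deriv_subset[OF hC(2) J0]) (use that in auto)
      from has_L2_deriv_inner[OF L2_curve_L2[OF \<tau>c inJ[OF that(2)]] this L2_curve_L2[OF hJ] inJ[OF that(1)]]
      show ?thesis unfolding atJ[OF that(1)] b_def b'_def
        L2_inner_commute[of ?S "h _" "\<tau> s"] L2_inner_commute[of ?S "ht _" "\<tau> s"] .
    qed
    have kt: "((\<lambda>t. k t s) has_real_derivative (b t s - A t s - D t s)) (at t)" if "t \<in> ?I" "s \<in> ?I" for t s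
      unfolding k_def b_def A_def D_def by (rule eqn[OF Uz[OF inJ[OF that(2)]] \<tau>[OF inJ[OF that(2)]] that(1)])
    have symP: "P t s = P s t" and symA: "A t s = A s t" for t s
      unfolding P_def A_def by (rule L2_inner_commute)+
    \<comment> \<open>The perturbed energy; \<open>E'\<close> adds the derivative from the energy identity and \<open>\<eta>\<close> times that of
      \<open>k\<close> along the diagonal.\<close>
    define E where "E s = (P s s + A s s) / 2 - b s s + \<eta> * k s s" for s
    define E' where "E' s = (- D' s s - b' s s) + \<eta> * (b s s - A s s - D s s + P s s)" for s
    have E_deriv: "(E has_real_derivative E' s) (at s)" if s: "s \<in> ?I" for s
    proof -
      have 1: "((\<lambda>t. (P t t + A t t) / 2 - b t t) has_real_derivative (- D' s s - b' s s)) (at s)"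
        by (rule scalar_energy_identity[OF kt ks Ds bt contI symP symA s])
      have "((\<lambda>r. k (0 + 1 * r) (0 + 1 * r)) has_real_derivative
          (1 * (b (0 + 1 * s) (0 + 1 * s) - A (0 + 1 * s) (0 + 1 * s) - D (0 + 1 * s) (0 + 1 * s)) + 1 * P (0 + 1 * s) (0 + 1 * s))) (at s)"
        by (rule has_real_derivative_along_curve[where kt = "\<lambda>t s. b t s - A t s - D t s" and ks = P, OF kt ks contI])
           (use s in simp_all)
      then have 2: "((\<lambda>r. k r r) has_real_derivative (b s s - A s s - D s s + P s s)) (at s)" by simp
      show ?thesis unfolding E_def[abs_def] E'_def by (rule DERIV_add[OF 1 DERIV_cmult[OF 2]])
    qed
    define p g l n n' where "p s = L2_norm ?M (Ut s)" and "g s = L2_norm ?M (wgrad \<Omega> (U s))"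
      and "l s = L2_norm ?M (U s)" and "n s = L2_norm ?S (h s)" and "n' s = L2_norm ?S (ht s)" for s
    have Pp: "P s s = (p s)\<^sup>2" and Ag: "A s s = (g s)\<^sup>2" for s
      by (simp_all add: P_def A_def p_def g_def L2_norm_power2)
    have nn: "0 \<le> p s" "0 \<le> g s" "0 \<le> l s" for s by (simp_all add: p_def g_def l_def)
    have lg: "(l s)\<^sup>2 \<le> c_p * (g s)\<^sup>2" if "s \<in> ?J" for s
      unfolding l_def g_def by (rule poincare[OF Uz[OF that]])
    have \<tau>n: "L2_norm ?S (\<tau> s) \<le> C * g s" if s: "s \<in> ?J" for s
    proof -
      have \<tau>L: "\<tau> s \<in> L2 ?F" using \<tau>[OF s] by (simp add: is_trace_def)
      have "L2_norm ?S (\<tau> s) \<le> L2_norm ?F (\<tau> s)"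
        by (rule L2_surface_on_subset(2)[OF \<Gamma>1(1) _ \<Gamma>1(2) \<tau>L]) simp
      also have "\<dots> \<le> C0 * H1_norm \<Omega> (U s)" by (rule C0(2)[OF \<tau>[OF s]])
      also have "H1_norm \<Omega> (U s) \<le> sqrt ((1 + c_p) * (g s)\<^sup>2)"
        unfolding H1_norm_def using lg[OF s] by (intro real_sqrt_le_mono) (simp add: l_def g_def algebra_simps)
      also have "\<dots> = sqrt (1 + c_p) * g s" using nn by (simp add: real_sqrt_mult)
      finally show ?thesis using C0(1) by (simp add: C_def mult.assoc mult_left_mono)
    qed
    have bn: "\<bar>b s s\<bar> \<le> C * n s * g s" and bn': "\<bar>b' s s\<bar> \<le> C * n' s * g s" if s: "s \<in> ?J" for s
    proof -
      note \<tau>L = L2_curve_L2[OF \<tau>c s]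
      have "\<bar>b s s\<bar> \<le> n s * L2_norm ?S (\<tau> s)"
        unfolding b_def n_def by (rule L2_Cauchy_Schwarz[OF L2_curve_L2[OF hJ s] \<tau>L])
      also have "\<dots> \<le> n s * (C * g s)" by (rule mult_left_mono[OF \<tau>n[OF s]]) (simp add: n_def)
      finally show "\<bar>b s s\<bar> \<le> C * n s * g s" by (simp only: mult_ac)
      have "\<bar>b' s s\<bar> \<le> n' s * L2_norm ?S (\<tau> s)"
        unfolding b'_def n'_def by (rule L2_Cauchy_Schwarz[OF L2_curve_L2[OF htJ s] \<tau>L])
      also have "\<dots> \<le> n' s * (C * g s)" by (rule mult_left_mono[OF \<tau>n[OF s]]) (simp add: n'_def)
      finally show "\<bar>b' s s\<bar> \<le> C * n' s * g s" by (simp only: mult_ac)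
    qed
    have kb: "\<bar>k s s\<bar> \<le> p s * l s" if s: "s \<in> ?J" for s
      unfolding k_def p_def l_def by (rule L2_Cauchy_Schwarz[OF UtL[OF s] UL[OF s]])
    have D'b: "a_min * (p s)\<^sup>2 \<le> D' s s" if s: "s \<in> ?J" for s
    proof -
      have i: "integrable ?M (\<lambda>x. Ut s x \<bullet> Ut s x)" by (rule L2_integrable_inner[OF UtL[OF s] UtL[OF s]])
      have "a_min * (p s)\<^sup>2 = (\<integral>x. a_min * (Ut s x \<bullet> Ut s x) \<partial>?M)"
        unfolding p_def L2_norm_power2 L2_inner_def by simp
      also have "\<dots> \<le> (\<integral>x. (a x * Ut s x) \<bullet> Ut s x \<partial>?M)"
      proof (rule integral_mono_AE)
        show "integrable ?M (\<lambda>x. a_min * (Ut s x \<bullet> Ut s x))" using i by simp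
        show "integrable ?M (\<lambda>x. (a x * Ut s x) \<bullet> Ut s x)" by (rule L2_integrable_inner[OF auL[OF s] UtL[OF s]])
        show "AE x in ?M. a_min * (Ut s x \<bullet> Ut s x) \<le> (a x * Ut s x) \<bullet> Ut s x"
          using a(2)
        proof eventually_elim
          case (elim x)
          have "a_min * (Ut s x * Ut s x) \<le> a x * (Ut s x * Ut s x)" using elim by (intro mult_right_mono) auto
          then show ?case by (simp add: mult.assoc)
        qed
      qed
      finally show ?thesis by (simp add: D'_def L2_inner_def)
    qed
    have Dk: "\<bar>D s s - \<eta> * k s s\<bar> \<le> a_max * p s * l s" if s: "s \<in> ?J" for s
    proof -
      note m = L2_mult_bounded[OF a\<eta>m abs_a\<eta> less_imp_le[OF pos(2)] UtL[OF s]]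
      have "D s s - \<eta> * k s s = L2_inner ?M (\<lambda>x. a x * Ut s x + (- \<eta>) *\<^sub>R Ut s x) (U s)"
        unfolding D_def k_def L2_inner_lincomb_left[OF auL[OF s] UtL[OF s] UL[OF s]] by simp
      also have "(\<lambda>x. a x * Ut s x + (- \<eta>) *\<^sub>R Ut s x) = (\<lambda>x. (a x - \<eta>) * Ut s x)" by (simp add: left_diff_distrib)
      finally have "\<bar>D s s - \<eta> * k s s\<bar> \<le> L2_norm ?M (\<lambda>x. (a x - \<eta>) * Ut s x) * l s"
        using L2_Cauchy_Schwarz[OF m(1) UL[OF s]] by (simp add: l_def)
      also have "\<dots> \<le> (a_max * p s) * l s" using m(2) nn by (intro mult_right_mono) (simp_all add: p_def)
      finally show ?thesis .
    qed
    have diss: "E' s + \<eta> * E s \<le> C1 * (n' s)\<^sup>2" if "s \<in> ?I" for s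
    proof -
      note sJ = inJ[OF that]
      from dissipation_bound[OF \<eta>0 \<eta>1(1) \<eta>2 pos(3) pos(2) nn(1)[of s] nn(2)[of s] nn(3)[of s]
          lg[OF sJ] D'b[OF sJ] Dk[OF sJ] bn'[OF sJ], where b = "b s s"]
      show ?thesis unfolding E'_def E_def C1_def Pp Ag .
    qed
    have nc: "continuous_on ?J (\<lambda>s. (n s)\<^sup>2)" "continuous_on ?J (\<lambda>s. (n' s)\<^sup>2)"
      unfolding n_def n'_def L2_norm_power2
      by (rule L2_curve_inner_continuous_on_diag[OF hJ hJ], rule L2_curve_inner_continuous_on_diag[OF htJ htJ])
    have tJ: "{0..t} \<subseteq> ?J" using T by auto
    have Ec: "continuous_on ?J E" unfolding E_def[abs_def] by (intro continuous_intros diag) simp_all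
    have gron: "exp (\<eta> * t) * E t \<le> E 0 + integral {0..t} (\<lambda>s. exp (\<eta> * s) * (C1 * (n' s)\<^sup>2))"
    proof (rule gronwall_exponential[OF t])
      show "continuous_on {0..t} E" by (rule continuous_on_subset[OF Ec tJ])
      show "continuous_on {0..t} (\<lambda>s. C1 * (n' s)\<^sup>2)"
        by (intro continuous_intros continuous_on_subset[OF nc(2) tJ])
      show "(E has_real_derivative E' s) (at s) \<and> E' s + \<eta> * E s \<le> C1 * (n' s)\<^sup>2" if "0 < s" "s < t" for s
        using E_deriv[of s] diss[of s] that T by simp
    qed
    define J1 where "J1 = integral {0..t} (\<lambda>s. exp (\<eta> * s) * ((n s)\<^sup>2 + (n' s)\<^sup>2))"
    have i1: "(\<lambda>s. exp (\<eta> * s) * (n' s)\<^sup>2) integrable_on {0..t}"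
      by (intro integrable_continuous_real continuous_intros continuous_on_subset[OF nc(2) tJ])
    have i2: "(\<lambda>s. exp (\<eta> * s) * ((n s)\<^sup>2 + (n' s)\<^sup>2)) integrable_on {0..t}"
      by (intro integrable_continuous_real continuous_intros continuous_on_subset[OF nc(1) tJ] continuous_on_subset[OF nc(2) tJ])
    have "integral {0..t} (\<lambda>s. exp (\<eta> * s) * (C1 * (n' s)\<^sup>2)) = C1 * integral {0..t} (\<lambda>s. exp (\<eta> * s) * (n' s)\<^sup>2)"
      unfolding integral_mult_right[symmetric] by (simp only: mult_ac)
    also have "\<dots> \<le> C1 * J1"
      unfolding J1_def by (intro mult_left_mono integral_le i1 i2 C1) simp_all
    finally have J1: "integral {0..t} (\<lambda>s. exp (\<eta> * s) * (C1 * (n' s)\<^sup>2)) \<le> C1 * J1" .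
    have zJ: "0 \<in> ?J" "t \<in> ?J" using T t by auto
    define X where "X = (H1_norm \<Omega> u0)\<^sup>2 + (L2_norm ?M u1)\<^sup>2"
    have init: "(p 0)\<^sup>2 + (g 0)\<^sup>2 \<le> X"
    proof -
      have u0H: "u0 \<in> H1 \<Omega>" by (rule H1_zero_imp_H1[OF u0])
      have \<Omega>m: "\<Omega> \<in> sets lebesgue" using \<Omega>(1) by simp
      have ae: "AE x in ?M. u0 x = U 0 x" using U0 by eventually_elim simp
      have "has_weak_grad \<Omega> (U 0) (wgrad \<Omega> u0)"
      proof (rule has_weak_grad_cong_AE[OF \<Omega>m ae])
        show "has_weak_grad \<Omega> u0 (wgrad \<Omega> u0)" by (rule wgrad_props(2)[OF u0H])
      qed
      from wgrad_AE_eq[OF \<Omega>(1) UH[OF zJ(1)] this]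
      have "g 0 = L2_norm ?M (wgrad \<Omega> u0)"
        unfolding g_def by (rule L2_norm_cong_AE[OF L2_measurable[OF gL[OF zJ(1)]] L2_measurable[OF wgrad_props(1)[OF u0H]]])
      moreover have "p 0 = L2_norm ?M u1"
        unfolding p_def by (rule L2_norm_cong_AE[OF L2_measurable[OF UtL[OF zJ(1)]] L2_measurable[OF u1] Ut0])
      ultimately show ?thesis by (simp add: X_def H1_norm_power2)
    qed
    have equiv: "((p s)\<^sup>2 + (g s)\<^sup>2) / 8 - 2 * C\<^sup>2 * (n s)\<^sup>2 \<le> E s" "E s \<le> ((p s)\<^sup>2 + (g s)\<^sup>2) + 2 * C\<^sup>2 * (n s)\<^sup>2"
      if s: "s \<in> ?J" for s
      using perturbed_energy_equivalent[OF \<eta>0 \<eta>3 nn(1)[of s] nn(2)[of s] nn(3)[of s] lg[OF s] kb[OF s] bn[OF s]]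
      unfolding E_def Pp Ag by blast+
    have E0: "E 0 \<le> X + 2 * C\<^sup>2 * (n 0)\<^sup>2"
      using equiv(2)[OF zJ(1)] init by linarith
    have Et: "((p t)\<^sup>2 + (g t)\<^sup>2) / 8 - 2 * C\<^sup>2 * (n t)\<^sup>2 \<le> E t"
      by (rule equiv(1)[OF zJ(2)])
    define ex where "ex = exp (- 2 * \<alpha> * t)"
    have ex: "ex * exp (\<eta> * t) = 1" "0 < ex" by (simp_all add: ex_def \<eta>_def exp_add[symmetric])
    have en: "energy \<Omega> u t = ((p t)\<^sup>2 + (g t)\<^sup>2) / 2"
      unfolding p_def g_def by (rule energy_of_representative[OF dom t T(2) UH Ud[OF zJ(2)] uU])
    define N0 where "N0 = integral {0..t} (\<lambda>s. (n s)\<^sup>2)"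
    have N0: "0 \<le> N0" unfolding N0_def
      by (rule integral_nonneg) (simp_all add: integrable_continuous_real continuous_on_subset[OF nc(1) tJ])
    have J10: "0 \<le> J1" unfolding J1_def by (rule integral_nonneg[OF i2]) simp
    have X0: "0 \<le> X" by (simp add: X_def)
    have db: "data_bound \<Omega> \<Gamma>\<^sub>1 \<alpha> u0 u1 h t = X + J1 + exp (\<eta> * t) * (n t)\<^sup>2 + (n 0)\<^sup>2 + N0"
      unfolding data_bound_def Let_def X_def J1_def N0_def n_def n'_def ht_def \<eta>_def by simp
    define Y where "Y = X + J1 + exp (\<eta> * t) * (n t)\<^sup>2 + (n 0)\<^sup>2"
    have "energy \<Omega> u t \<le> 4 * E t + 8 * C\<^sup>2 * (n t)\<^sup>2" unfolding en using Et by linarith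
    also have "\<dots> = ex * exp (\<eta> * t) * (4 * E t + 8 * C\<^sup>2 * (n t)\<^sup>2)" unfolding ex(1) by simp
    also have "\<dots> = ex * (4 * (exp (\<eta> * t) * E t) + 8 * C\<^sup>2 * (exp (\<eta> * t) * (n t)\<^sup>2))" by (simp add: algebra_simps)
    also have "\<dots> \<le> ex * (4 * (X + 2 * C\<^sup>2 * (n 0)\<^sup>2 + C1 * J1) + 8 * C\<^sup>2 * (exp (\<eta> * t) * (n t)\<^sup>2))"
      using gron J1 E0 ex(2) by (intro mult_left_mono) auto
    also have "\<dots> \<le> ex * (c * Y)"
    proof (rule mult_left_mono)
      let ?e = "exp (\<eta> * t) * (n t)\<^sup>2"
      have nonneg: "0 \<le> C\<^sup>2 * X" "0 \<le> C1 * X" "0 \<le> C\<^sup>2 * J1" "0 \<le> C1 * ?e" "0 \<le> C1 * (n 0)\<^sup>2" "0 \<le> J1" "0 \<le> ?e" "0 \<le> (n 0)\<^sup>2"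
        using X0 J10 C1 by simp_all
      have "c * Y = 4 * X + 8 * (C\<^sup>2 * X) + 4 * (C1 * X) + 4 * J1 + 8 * (C\<^sup>2 * J1) + 4 * (C1 * J1) +
          4 * ?e + 8 * (C\<^sup>2 * ?e) + 4 * (C1 * ?e) + 4 * (n 0)\<^sup>2 + 8 * (C\<^sup>2 * (n 0)\<^sup>2) + 4 * (C1 * (n 0)\<^sup>2)"
        unfolding c_def Y_def by (simp add: algebra_simps)
      moreover have "4 * (X + 2 * C\<^sup>2 * (n 0)\<^sup>2 + C1 * J1) + 8 * C\<^sup>2 * ?e =
          4 * X + 8 * (C\<^sup>2 * (n 0)\<^sup>2) + 4 * (C1 * J1) + 8 * (C\<^sup>2 * ?e)" by (simp add: algebra_simps)
      ultimately show "4 * (X + 2 * C\<^sup>2 * (n 0)\<^sup>2 + C1 * J1) + 8 * C\<^sup>2 * ?e \<le> c * Y" using nonneg by linarith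
    qed (use ex(2) in simp)
    also have "\<dots> \<le> ex * (c * data_bound \<Omega> \<Gamma>\<^sub>1 \<alpha> u0 u1 h t)"
      unfolding db using N0 ex(2) c0 by (intro mult_left_mono) (simp_all add: Y_def)
    finally show ?thesis unfolding ex_def by (simp only: mult_ac)
  qed
  with c0 show ?thesis by (rule that)
qed

text \<open>The weight \<open>exp (2\<alpha>s)\<close> is beaten by the decay of the data because \<open>2\<alpha> < \<gamma>\<close>.\<close>

lemma data_bound_bounded:
  assumes h: "C1_L2 (surface_on \<Gamma>) {0..} h" and \<alpha>: "0 < \<alpha>" "2 * \<alpha> < \<gamma>"
    and hO: "(\<lambda>t. (L2_norm (surface_on \<Gamma>) (h t))\<^sup>2) \<in> O(\<lambda>t. exp (- \<gamma> * t))"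
    and htO: "(\<lambda>t. (L2_norm (surface_on \<Gamma>) (L2_deriv (surface_on \<Gamma>) {0..} h t))\<^sup>2) \<in> O(\<lambda>t. exp (- \<gamma> * t))"
  obtains K where "0 \<le> K" "\<And>t. 0 \<le> t \<Longrightarrow> data_bound \<Omega> \<Gamma> \<alpha> u0 u1 h t \<le> K"
proof -
  let ?S = "surface_on \<Gamma>"
  define n n' where "n t = (L2_norm ?S (h t))\<^sup>2" and "n' t = (L2_norm ?S (L2_deriv ?S {0..} h t))\<^sup>2" for t
  note hC = C1_L2_props[OF h]
  have \<gamma>: "0 < \<gamma>" using \<alpha> by linarith
  have nc: "continuous_on {0..} n" "continuous_on {0..} n'"
    unfolding n_def n'_def L2_norm_power2
    by (rule L2_curve_inner_continuous_on_diag[OF hC(4) hC(4)], rule L2_curve_inner_continuous_on_diag[OF hC(3) hC(3)])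
  have n0: "0 \<le> n t" "0 \<le> n' t" for t by (simp_all add: n_def n'_def)
  have bound: "\<exists>B\<ge>0. \<forall>t\<ge>0. f t \<le> B * exp (- \<gamma> * t)"
    if c: "continuous_on {0..} f" and O: "f \<in> O(\<lambda>t. exp (- \<gamma> * t))" and f0: "\<And>t. 0 \<le> f t" for f :: "real \<Rightarrow> real"
  proof -
    obtain B1 where B1: "\<forall>\<^sub>F t in at_top. norm (f t) \<le> B1 * norm (exp (- \<gamma> * t))"
      using landau_o.bigE[OF O] by metis
    then obtain T0 where T0: "\<And>t. T0 \<le> t \<Longrightarrow> norm (f t) \<le> B1 * norm (exp (- \<gamma> * t))"
      unfolding eventually_at_top_linorder by blast
    define T where "T = max T0 0"
    have "compact (f ` {0..T})"
      by (intro compact_continuous_image continuous_on_subset[OF c] compact_Icc) auto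
    then obtain B2 where B2: "\<And>t. t \<in> {0..T} \<Longrightarrow> norm (f t) \<le> B2"
      using compact_imp_bounded bounded_iff by (metis imageI)
    \<comment> \<open>The Landau bound holds from \<open>T\<close> on; before \<open>T\<close> the function is bounded, and the exponential
        is at least \<open>exp (- \<gamma> T)\<close>.\<close>
    define B where "B = max B1 0 + max B2 0 * exp (\<gamma> * T)"
    have "f t \<le> B * exp (- \<gamma> * t)" if t: "0 \<le> t" for t
    proof (cases "t \<le> T")
      case True
      have "f t \<le> max B2 0" using B2[of t] t True by auto
      also have "\<dots> = max B2 0 * (exp (\<gamma> * t) * exp (- \<gamma> * t))" by (simp add: exp_add[symmetric])
      also have "\<dots> \<le> max B2 0 * (exp (\<gamma> * T) * exp (- \<gamma> * t))"
        using True \<gamma> by (intro mult_left_mono mult_right_mono) auto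
      also have "\<dots> \<le> B * exp (- \<gamma> * t)" by (simp add: B_def distrib_right mult.assoc)
      finally show ?thesis .
    next
      case False
      then have "T0 \<le> t" by (simp add: T_def)
      from T0[OF this] have "f t \<le> B1 * exp (- \<gamma> * t)" using abs_ge_self[of "f t"] by simp
      also have "\<dots> \<le> B * exp (- \<gamma> * t)" by (rule mult_right_mono) (simp_all add: B_def add_increasing2)
      finally show ?thesis .
    qed
    moreover have "0 \<le> B" by (simp add: B_def)
    ultimately show ?thesis by blast
  qed
  obtain B where B: "0 \<le> B" "\<And>t. 0 \<le> t \<Longrightarrow> n t \<le> B * exp (- \<gamma> * t)"
    using bound[OF nc(1) hO[folded n_def] n0(1)] by blast
  obtain B' where B': "0 \<le> B'" "\<And>t. 0 \<le> t \<Longrightarrow> n' t \<le> B' * exp (- \<gamma> * t)"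
    using bound[OF nc(2) htO[folded n'_def] n0(2)] by blast
  have int_exp: "integral {0..t} (\<lambda>s. exp (- r * s)) \<le> 1 / r" if r: "0 < r" and t: "0 \<le> t" for r t :: real
  proof -
    have "((\<lambda>s. exp (- r * s)) has_integral (- exp (- r * t) / r - - exp (- r * 0) / r)) {0..t}"
    proof (rule fundamental_theorem_of_calculus[OF t])
      fix x
      show "((\<lambda>s. - exp (- r * s) / r) has_vector_derivative exp (- r * x)) (at x within {0..t})"
        unfolding has_real_derivative_iff_has_vector_derivative[symmetric]
        using r by (auto intro!: derivative_eq_intros)
    qed
    then have "integral {0..t} (\<lambda>s. exp (- r * s)) = - exp (- r * t) / r + 1 / r" by (simp add: integral_unique)
    then show ?thesis using r by simp
  qed
  define \<rho> where "\<rho> = \<gamma> - 2 * \<alpha>"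
  have \<rho>: "0 < \<rho>" using \<alpha> by (simp add: \<rho>_def)
  define X where "X = (H1_norm \<Omega> u0)\<^sup>2 + (L2_norm (lebesgue_on \<Omega>) u1)\<^sup>2"
  define K where "K = X + (B + B') * (1 / \<rho>) + B + n 0 + B * (1 / \<gamma>)"
  have K: "0 \<le> K" using B(1) B'(1) n0(1)[of 0] \<rho> \<gamma> by (simp add: K_def X_def)
  have "data_bound \<Omega> \<Gamma> \<alpha> u0 u1 h t \<le> K" if t: "0 \<le> t" for t
  proof -
    have c1: "continuous_on {0..t} n" "continuous_on {0..t} n'" by (rule continuous_on_subset[OF nc(1)]; simp) (rule continuous_on_subset[OF nc(2)]; simp)
    have e: "exp (2 * \<alpha> * s) * exp (- \<gamma> * s) = exp (- \<rho> * s)" for s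
      unfolding exp_add[symmetric] \<rho>_def by (simp add: algebra_simps)
    have pw: "exp (2 * \<alpha> * s) * (n s + n' s) \<le> (B + B') * exp (- \<rho> * s)" if s: "s \<in> {0..t}" for s
    proof -
      have "n s + n' s \<le> (B + B') * exp (- \<gamma> * s)" using B(2)[of s] B'(2)[of s] s by (simp add: distrib_right)
      then have "exp (2 * \<alpha> * s) * (n s + n' s) \<le> exp (2 * \<alpha> * s) * ((B + B') * exp (- \<gamma> * s))" by (intro mult_left_mono) auto
      also have "\<dots> = (B + B') * exp (- \<rho> * s)" unfolding e[symmetric] by (simp only: mult_ac)
      finally show ?thesis .
    qed
    have "integral {0..t} (\<lambda>s. exp (2 * \<alpha> * s) * (n s + n' s)) \<le> integral {0..t} (\<lambda>s. (B + B') * exp (- \<rho> * s))"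
      by (intro integral_le integrable_continuous_real continuous_intros c1 pw)
    also have "\<dots> \<le> (B + B') * (1 / \<rho>)"
      unfolding integral_mult_right using B(1) B'(1) by (intro mult_left_mono int_exp \<rho> t) simp
    finally have 1: "integral {0..t} (\<lambda>s. exp (2 * \<alpha> * s) * (n s + n' s)) \<le> (B + B') * (1 / \<rho>)" .
    have "exp (2 * \<alpha> * t) * n t \<le> exp (2 * \<alpha> * t) * (B * exp (- \<gamma> * t))" using B(2)[OF t] by (intro mult_left_mono) auto
    also have "\<dots> = B * exp (- \<rho> * t)" unfolding e[symmetric] by (simp only: mult_ac)
    also have "\<dots> \<le> B * 1" using B(1) \<rho> t by (intro mult_left_mono) auto
    finally have 2: "exp (2 * \<alpha> * t) * n t \<le> B" by simp
    have "integral {0..t} n \<le> integral {0..t} (\<lambda>s. B * exp (- \<gamma> * s))"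
      by (intro integral_le integrable_continuous_real continuous_intros c1 B(2)) simp
    also have "\<dots> \<le> B * (1 / \<gamma>)"
      unfolding integral_mult_right using B(1) by (intro mult_left_mono int_exp \<gamma> t) simp
    finally have 3: "integral {0..t} n \<le> B * (1 / \<gamma>)" .
    have "data_bound \<Omega> \<Gamma> \<alpha> u0 u1 h t = X + integral {0..t} (\<lambda>s. exp (2 * \<alpha> * s) * (n s + n' s)) +
        exp (2 * \<alpha> * t) * n t + n 0 + integral {0..t} n"
      by (simp add: data_bound_def Let_def X_def n_def[abs_def] n'_def)
    then show ?thesis using 1 2 3 by (simp add: K_def)
  qed
  with K show ?thesis by (rule that)
qed

text \<open>Integrals of nonnegative functions are nonnegative even without integrability, since the
  default value is 0.\<close>

lemma data_bound_nonneg: "0 \<le> data_bound \<Omega> \<Gamma> \<alpha> u0 u1 h t"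
proof -
  have i: "0 \<le> integral {0..t} f" if "\<And>s. 0 \<le> f s" for f :: "real \<Rightarrow> real"
    using that by (cases "f integrable_on {0..t}") (simp_all add: integral_nonneg not_integrable_integral)
  show ?thesis unfolding data_bound_def Let_def by (intro add_nonneg_nonneg i) simp_all
qed

theorem theorem3p5:
  fixes \<Omega> \<Gamma>\<^sub>0 \<Gamma>\<^sub>1 :: "'a::euclidean_space set"
    and a :: "'a \<Rightarrow> real"
    and a_min a_max c_p :: real
  assumes "smooth_bounded_domain \<Omega>"
    and "\<Gamma>\<^sub>0 \<in> sets borel" "\<Gamma>\<^sub>1 \<in> sets borel"
    and "\<Gamma>\<^sub>0 \<subseteq> frontier \<Omega>" "\<Gamma>\<^sub>1 \<subseteq> frontier \<Omega>"
    and "frontier \<Omega> = closure \<Gamma>\<^sub>0 \<union> closure \<Gamma>\<^sub>1"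
    and "\<Gamma>\<^sub>0 \<noteq> {}" "\<Gamma>\<^sub>0 \<inter> \<Gamma>\<^sub>1 = {}"
    and "a \<in> borel_measurable (lebesgue_on \<Omega>)"
    and "a_min > 0" "a_max > 0"
    and "AE x in lebesgue_on \<Omega>. a_min \<le> a x \<and> a x \<le> a_max"
    and "c_p > 0"
    and "\<And>\<phi>. \<phi> \<in> H1_zero \<Omega> \<Gamma>\<^sub>0 \<Longrightarrow>
          (L2_norm (lebesgue_on \<Omega>) \<phi>)\<^sup>2 \<le> c_p * (L2_norm (lebesgue_on \<Omega>) (wgrad \<Omega> \<phi>))\<^sup>2"
  shows
    "(\<forall>\<alpha> \<delta>. 0 < \<alpha> \<and> \<alpha> < eps0 a_min a_max c_p / 2 \<and> 0 < \<delta> \<and> \<delta> < 1 / (2 * c_p) \<longrightarrow>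
       (\<exists>c>0. \<forall>u0 u1 h u.
          u0 \<in> H1_zero \<Omega> \<Gamma>\<^sub>0 \<and> u1 \<in> L2 (lebesgue_on \<Omega>) \<and> C1_L2 (surface_on \<Gamma>\<^sub>1) {0..} h \<and>
          global_weak_solution \<Omega> \<Gamma>\<^sub>0 \<Gamma>\<^sub>1 a u0 u1 h u \<longrightarrow>
          (\<forall>t\<ge>0. energy \<Omega> u t \<le>
             c * exp (- 2 * \<alpha> * t) * exp (4 * \<delta> * \<alpha> * c_p / (1 - 2 * \<delta> * c_p) * t) *
             data_bound \<Omega> \<Gamma>\<^sub>1 \<alpha> u0 u1 h t))) \<and>
     (\<forall>u0 u1 h u \<gamma>.
        u0 \<in> H1_zero \<Omega> \<Gamma>\<^sub>0 \<and> u1 \<in> L2 (lebesgue_on \<Omega>) \<and> C1_L2 (surface_on \<Gamma>\<^sub>1) {0..} h \<and>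
        global_weak_solution \<Omega> \<Gamma>\<^sub>0 \<Gamma>\<^sub>1 a u0 u1 h u \<and> \<gamma> > 0 \<and>
        (\<lambda>t. (L2_norm (surface_on \<Gamma>\<^sub>1) (h t))\<^sup>2) \<in> O(\<lambda>t. exp (- \<gamma> * t)) \<and>
        (\<lambda>t. (L2_norm (surface_on \<Gamma>\<^sub>1) (L2_deriv (surface_on \<Gamma>\<^sub>1) {0..} h t))\<^sup>2) \<in> O(\<lambda>t. exp (- \<gamma> * t)) \<longrightarrow>
        (\<exists>C>0. \<exists>\<omega>>0. \<forall>t\<ge>0. energy \<Omega> u t \<le> C * exp (- \<omega> * t)))"
proof (intro conjI allI impI)
  note \<Gamma>1 = assms(3,5) and a = assms(9,12) and pos = assms(10,11,13) and poincare = assms(14)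
  have \<epsilon>0: "0 < eps0 a_min a_max c_p" using pos by (simp add: eps0_def)
  {
    fix \<alpha> \<delta> :: real
    assume ad: "0 < \<alpha> \<and> \<alpha> < eps0 a_min a_max c_p / 2 \<and> 0 < \<delta> \<and> \<delta> < 1 / (2 * c_p)"
    then have \<alpha>: "0 < \<alpha>" "\<alpha> < eps0 a_min a_max c_p / 2" by simp_all
    obtain c where c: "0 < c" "\<And>u0 u1 h u t. u0 \<in> H1_zero \<Omega> \<Gamma>\<^sub>0 \<Longrightarrow> u1 \<in> L2 (lebesgue_on \<Omega>) \<Longrightarrow>
        C1_L2 (surface_on \<Gamma>\<^sub>1) {0..} h \<Longrightarrow> global_weak_solution \<Omega> \<Gamma>\<^sub>0 \<Gamma>\<^sub>1 a u0 u1 h u \<Longrightarrow> 0 \<le> t \<Longrightarrow>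
        energy \<Omega> u t \<le> c * exp (- 2 * \<alpha> * t) * data_bound \<Omega> \<Gamma>\<^sub>1 \<alpha> u0 u1 h t"
      by (rule energy_decay_estimate[OF assms(1) \<Gamma>1 a pos poincare \<alpha>]) (assumption, rule that)
    have \<delta>0: "0 \<le> 4 * \<delta> * \<alpha> * c_p / (1 - 2 * \<delta> * c_p)"
      using ad pos by (intro divide_nonneg_nonneg) (simp_all add: field_simps)
    have \<delta>1: "1 \<le> exp (4 * \<delta> * \<alpha> * c_p / (1 - 2 * \<delta> * c_p) * t)" if "0 \<le> t" for t
      using mult_nonneg_nonneg[OF \<delta>0 that] by (simp only: one_le_exp_iff)
    have "energy \<Omega> u t \<le> c * exp (- 2 * \<alpha> * t) * exp (4 * \<delta> * \<alpha> * c_p / (1 - 2 * \<delta> * c_p) * t) *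
             data_bound \<Omega> \<Gamma>\<^sub>1 \<alpha> u0 u1 h t"
      if "u0 \<in> H1_zero \<Omega> \<Gamma>\<^sub>0 \<and> u1 \<in> L2 (lebesgue_on \<Omega>) \<and> C1_L2 (surface_on \<Gamma>\<^sub>1) {0..} h \<and>
          global_weak_solution \<Omega> \<Gamma>\<^sub>0 \<Gamma>\<^sub>1 a u0 u1 h u" and t: "0 \<le> t" for u0 u1 h u t
    proof -
      have "energy \<Omega> u t \<le> c * exp (- 2 * \<alpha> * t) * data_bound \<Omega> \<Gamma>\<^sub>1 \<alpha> u0 u1 h t"
        using c(2) that by blast
      also have "\<dots> \<le> c * exp (- 2 * \<alpha> * t) * exp (4 * \<delta> * \<alpha> * c_p / (1 - 2 * \<delta> * c_p) * t) *
             data_bound \<Omega> \<Gamma>\<^sub>1 \<alpha> u0 u1 h t"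
        using mult_left_mono[OF \<delta>1[OF t], of "c * exp (- 2 * \<alpha> * t)"] c(1)
        by (intro mult_right_mono data_bound_nonneg) simp
      finally show ?thesis .
    qed
    with c(1) show "\<exists>c>0. \<forall>u0 u1 h u.
          u0 \<in> H1_zero \<Omega> \<Gamma>\<^sub>0 \<and> u1 \<in> L2 (lebesgue_on \<Omega>) \<and> C1_L2 (surface_on \<Gamma>\<^sub>1) {0..} h \<and>
          global_weak_solution \<Omega> \<Gamma>\<^sub>0 \<Gamma>\<^sub>1 a u0 u1 h u \<longrightarrow>
          (\<forall>t\<ge>0. energy \<Omega> u t \<le>
             c * exp (- 2 * \<alpha> * t) * exp (4 * \<delta> * \<alpha> * c_p / (1 - 2 * \<delta> * c_p) * t) *
             data_bound \<Omega> \<Gamma>\<^sub>1 \<alpha> u0 u1 h t)"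
      by (intro exI[of _ c] conjI allI impI)
  next
    fix u0 u1 h u and \<gamma> :: real
    assume *: "u0 \<in> H1_zero \<Omega> \<Gamma>\<^sub>0 \<and> u1 \<in> L2 (lebesgue_on \<Omega>) \<and> C1_L2 (surface_on \<Gamma>\<^sub>1) {0..} h \<and>
        global_weak_solution \<Omega> \<Gamma>\<^sub>0 \<Gamma>\<^sub>1 a u0 u1 h u \<and> \<gamma> > 0 \<and>
        (\<lambda>t. (L2_norm (surface_on \<Gamma>\<^sub>1) (h t))\<^sup>2) \<in> O(\<lambda>t. exp (- \<gamma> * t)) \<and>
        (\<lambda>t. (L2_norm (surface_on \<Gamma>\<^sub>1) (L2_deriv (surface_on \<Gamma>\<^sub>1) {0..} h t))\<^sup>2) \<in> O(\<lambda>t. exp (- \<gamma> * t))"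
    \<comment> \<open>Small enough both for the decay estimate and for the decay rate of the data.\<close>
    define \<alpha> where "\<alpha> = min (eps0 a_min a_max c_p / 4) (\<gamma> / 4)"
    have \<alpha>: "0 < \<alpha>" "\<alpha> < eps0 a_min a_max c_p / 2" "2 * \<alpha> < \<gamma>" using \<epsilon>0 * by (auto simp: \<alpha>_def min_def)
    obtain c where c: "0 < c" "\<And>u0 u1 h u t. u0 \<in> H1_zero \<Omega> \<Gamma>\<^sub>0 \<Longrightarrow> u1 \<in> L2 (lebesgue_on \<Omega>) \<Longrightarrow>
        C1_L2 (surface_on \<Gamma>\<^sub>1) {0..} h \<Longrightarrow> global_weak_solution \<Omega> \<Gamma>\<^sub>0 \<Gamma>\<^sub>1 a u0 u1 h u \<Longrightarrow> 0 \<le> t \<Longrightarrow>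
        energy \<Omega> u t \<le> c * exp (- 2 * \<alpha> * t) * data_bound \<Omega> \<Gamma>\<^sub>1 \<alpha> u0 u1 h t"
      by (rule energy_decay_estimate[OF assms(1) \<Gamma>1 a pos poincare \<alpha>(1,2)]) (assumption, rule that)
    have hC: "C1_L2 (surface_on \<Gamma>\<^sub>1) {0..} h"
      and hO: "(\<lambda>t. (L2_norm (surface_on \<Gamma>\<^sub>1) (h t))\<^sup>2) \<in> O(\<lambda>t. exp (- \<gamma> * t))"
      and htO: "(\<lambda>t. (L2_norm (surface_on \<Gamma>\<^sub>1) (L2_deriv (surface_on \<Gamma>\<^sub>1) {0..} h t))\<^sup>2) \<in> O(\<lambda>t. exp (- \<gamma> * t))"
      using * by blast+
    obtain K where K: "0 \<le> K" "\<And>t. 0 \<le> t \<Longrightarrow> data_bound \<Omega> \<Gamma>\<^sub>1 \<alpha> u0 u1 h t \<le> K"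
      by (rule data_bound_bounded[OF hC \<alpha>(1,3) hO htO]) (rule that)
    \<comment> \<open>The summand 1 makes the constant positive also for \<open>K = 0\<close>.\<close>
    have "energy \<Omega> u t \<le> (c * K + 1) * exp (- (2 * \<alpha>) * t)" if t: "0 \<le> t" for t
    proof -
      have "energy \<Omega> u t \<le> c * exp (- 2 * \<alpha> * t) * data_bound \<Omega> \<Gamma>\<^sub>1 \<alpha> u0 u1 h t"
        using c(2) * t by blast
      also have "\<dots> \<le> c * exp (- 2 * \<alpha> * t) * K" using c(1) by (intro mult_left_mono K(2)[OF t]) simp
      also have "\<dots> = (c * K) * exp (- (2 * \<alpha>) * t)" by simp
      also have "\<dots> \<le> (c * K + 1) * exp (- (2 * \<alpha>) * t)" by (intro mult_right_mono) simp_all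
      finally show ?thesis .
    qed
    moreover have "0 < c * K + 1" using c(1) K(1) by (simp add: add_nonneg_pos)
    moreover have "0 < 2 * \<alpha>" using \<alpha> by simp
    ultimately show "\<exists>C>0. \<exists>\<omega>>0. \<forall>t\<ge>0. energy \<Omega> u t \<le> C * exp (- \<omega> * t)" by blast
  }
qed

end
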